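(* Let $v \equiv 0$ or $4 \pmod{12}$ and let $\lambda$ be an even integer with $2 \le \lambda \le v-2$. Then there exists a simple ${\rm TS}(v,\lambda)$ which has a cyclic $2$-intersecting Gray code; equivalently, there is a simple ${\rm TS}(v,\lambda)$ whose $2$-block intersection graph is Hamiltonian.
   Context: A triple system ${\rm TS}(v,\lambda)$ is a pair $(V,\mathcal{B})$ where $|V|=v$ and $\mathcal{B}$ is a collection of $3$-element subsets (blocks) of $V$ such that every pair of distinct points of $V$ lies in exactly $\lambda$ blocks. It is simple if no block is repeated. The $2$-block intersection graph ($2$-BIG) of a ${\rm TS}(v,\lambda)$ has the blocks as vertices, two blocks being adjacent if they share exactly two points. A cyclic $2$-intersecting Gray code is a cyclic ordering of all blocks in which each pair of cyclically consecutive blocks shares exactly two points, i.e. a Hamilton cycle of the $2$-BIG. (For $v \equiv 0,4 \pmod{12}$, a simple ${\rm TS}(v,\lambda)$ exists exactly when $\lambda$ is even and $\lambda\le v-2$.) *)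

theory Defs
  imports "HOL-Library.Multiset" "Graph_Theory.Graph_Theory"
begin

text \<open>Blocks form a multiset, so that repeated blocks are possible in general.\<close>

definition triple_system :: "'a set \<Rightarrow> 'a set multiset \<Rightarrow> nat \<Rightarrow> nat \<Rightarrow> bool" where
  "triple_system V B v l \<longleftrightarrow>
     finite V \<and> card V = v \<and>
     (\<forall>b\<in>#B. b \<subseteq> V \<and> card b = 3) \<and>
     (\<forall>x\<in>V. \<forall>y\<in>V. x \<noteq> y \<longrightarrow> size {#b \<in># B. x \<in> b \<and> y \<in> b#} = l)"

definition simple_triple_system :: "'a set \<Rightarrow> 'a set multiset \<Rightarrow> nat \<Rightarrow> nat \<Rightarrow> bool" where
  "simple_triple_system V B v l \<longleftrightarrow> triple_system V B v l \<and> (\<forall>b. count B b \<le> 1)"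

text \<open>
  The 2-block intersection graph, as a symmetric digraph. A block of multiplicity \<open>m\<close> gives
  the \<open>m\<close> vertices \<open>(b, 0), \<dots>, (b, m - 1)\<close>; for a simple system the vertices are just
  the pairs \<open>(b, 0)\<close>. There are no loops, since blocks have three points.
\<close>

definition two_big :: "'a set multiset \<Rightarrow> ('a set \<times> nat) pair_pre_digraph" where
  "two_big B = (let W = {(b, i). i < count B b} in
     \<lparr> pverts = W,
       parcs = {(p, q). p \<in> W \<and> q \<in> W \<and> card (fst p \<inter> fst q) = 2} \<rparr>)"

text \<open>
  A Hamilton cycle of an undirected graph given as a symmetric digraph. The bound on the length
  excludes traversing a single edge back and forth, which \<open>pre_digraph.cycle\<close> allows.
\<close>

definition hamilton_cycle :: "('a, 'b) pre_digraph \<Rightarrow> 'b list \<Rightarrow> bool" where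
  "hamilton_cycle G p \<longleftrightarrow>
     pre_digraph.cycle G p \<and> 3 \<le> length p \<and> tail G ` set p = verts G"

definition hamiltonian :: "('a, 'b) pre_digraph \<Rightarrow> bool" where
  "hamiltonian G \<longleftrightarrow> (\<exists>p. hamilton_cycle G p)"

text \<open>The bound on the length is the one for Hamilton cycles.\<close>

definition cyclic_two_gray_code :: "'a set multiset \<Rightarrow> 'a set list \<Rightarrow> bool" where
  "cyclic_two_gray_code B bs \<longleftrightarrow>
     mset bs = B \<and> 3 \<le> length bs \<and>
     (\<forall>i<length bs. card (bs ! i \<inter> bs ! (Suc i mod length bs)) = 2)"

end

(* For l = 2 the points are three copies of the residues modulo some m and possibly one fixed point,
   and the blocks are the translates of a list of base blocks in which every difference occurs twice.
   Consecutive base blocks share a pair, and so do the last one and a translate of the first by a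
   generator; hence the translates, taken in turn, form a Gray code.

   For l = 2 k with k >= 2 put n = v / 2 - 1, which is coprime to 6, and take as points two copies of
   the residues modulo n and two further points. All triples are coloured with n colours such that
   every pair of points lies in exactly two triples of each colour; the blocks are the triples of
   the first k colours. Regard pairs as vertices and blocks as edges joining any two of their pairs:
   a closed trail through all blocks is then a Gray code. The eight blocks over three given
   residues form a cube, which has a closed trail through many of its pairs; the blocks in which one
   point has the residue that enters the colour only once form paths between two pairs, which are
   closed up two by two. These closed trails are merged at common pairs, and the remaining blocks
   are inserted at a pair through which the merged trail passes. *)

theory Submission
  imports Defs
begin

text \<open>The colouring cannot serve \<open>l = 2\<close>: cubes of one colour with two common
  residues coincide, and a pivot has just one path, with no second one to close it up. Hence the
  separate construction by differences. For \<open>k >= 2\<close> the obstacle is that trails merge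
  only at a pair that both really visit, while a closed trail through the eight blocks of a cube
  visits at most eight of its twelve pairs. A tournament on the residues, \<open>ahead\<close>,
  resolves this: it assigns one pair of points to any two residues, and every cube over these
  residues has a trail through that pair, because each triangle of a tournament has a vertex with
  one arrow in and one arrow out. Cubes are linked by changing a residue by 1 and the colour with
  it. The tightest case is \<open>k = 2\<close>: with two colours these links can break once around
  a residue, and there the pivot trail bridges the gap. Coprimality with 6 makes division by 2 and
  by 3 possible modulo \<open>n\<close>; the exact count of third points and the pivots rest on
  it.\<close>

section \<open>Gray codes, Hamilton cycles and relabelling of points\<close>

definition gray_system :: "nat \<Rightarrow> nat \<Rightarrow> bool" where
  "gray_system v l \<longleftrightarrow> (\<exists>(V :: nat set) B. simple_triple_system V B v l \<and>
     (\<exists>bs. cyclic_two_gray_code B bs) \<and> hamiltonian (with_proj (two_big B)))"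

lemma cas_map_upt:
  assumes "tail G = fst" "head G = snd" "a \<le> b"
  shows "pre_digraph.cas G (w a) (map (\<lambda>i. (w i, w (Suc i))) [a..<b]) (w b)"
  using assms(3)
proof (induction b rule: dec_induct)
  case base
  then show ?case by (simp add: pre_digraph.cas.simps)
next
  case (step b)
  have app: "pre_digraph.cas G u (p @ [e]) v"
    if "pre_digraph.cas G u p (tail G e)" "v = head G e" for u p e v
    using that
    by (induction p arbitrary: u) (auto simp: pre_digraph.cas.simps)
  from step show ?case by (simp add: app assms)
qed

lemma awalk_verts_map_upt:
  assumes "tail G = fst" "head G = snd"
  shows "a \<le> b \<Longrightarrow> pre_digraph.awalk_verts G (w a) (map (\<lambda>i. (w i, w (Suc i))) [a..<b]) = map w [a..<Suc b]"
proof (induction "b - a" arbitrary: a)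
  case 0
  then show ?case by (simp add: pre_digraph.awalk_verts.simps)
next
  case (Suc n)
  then have "[a..<b] = a # [Suc a..<b]" "[a..<Suc b] = a # [Suc a..<Suc b]"
    by (auto simp: upt_conv_Cons simp del: upt_Suc)
  with Suc(1)[of "Suc a"] Suc(2,3) show ?case
    by (simp add: pre_digraph.awalk_verts.simps assms del: upt_Suc)
qed

text \<open>A simple system has one vertex \<open>(b, 0)\<close> for each block, so the Gray code
  itself is the sequence of vertices; simplicity also makes its entries distinct, as
  \<open>cycle\<close> demands.\<close>

lemma gray_code_imp_hamiltonian:
  assumes "cyclic_two_gray_code B bs" and simple: "\<And>b. count B b \<le> 1"
  shows "hamiltonian (with_proj (two_big B))"
proof -
  define N where "N = length bs"
  \<comment> \<open>Indices are read modulo \<open>N\<close>, so that \<open>w N = w 0\<close> and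
    the closing arc needs no special treatment.\<close>
  define w where "w i = (bs ! (i mod N), 0 :: nat)" for i
  define p where "p = map (\<lambda>i. (w i, w (Suc i))) [0..<N]"
  let ?G = "with_proj (two_big B)"
  have B: "mset bs = B" and N3: "3 \<le> N"
    and adj: "\<And>i. i < N \<Longrightarrow> card (bs ! i \<inter> bs ! (Suc i mod N)) = 2"
    using assms(1) by (auto simp: cyclic_two_gray_code_def N_def)
  have dist: "distinct bs"
    using simple unfolding B[symmetric]
    by (metis (no_types, lifting) One_nat_def count_greater_zero_iff distinct_count_atmost_1
        le_antisym linorder_not_less not_in_iff set_mset_mset less_one not_less_eq_eq)
  have GT: "tail ?G = fst" "head ?G = snd" by auto
  have V: "verts ?G = {(b, i). i < count B b}"
    by (simp add: two_big_def Let_def)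
  have V': "verts ?G = (\<lambda>b. (b, 0)) ` set bs"
  proof -
    have "count B b = (if b \<in> set bs then 1 else 0)" for b
      using dist B by (metis distinct_count_atmost_1)
    then show ?thesis unfolding V by (auto split: if_splits)
  qed
  have wV: "w i \<in> verts ?G" for i
    unfolding V' w_def N_def using N3 by (intro imageI nth_mem mod_less_divisor) (auto simp: N_def)
  have A: "arcs ?G = {(p, q). p \<in> verts ?G \<and> q \<in> verts ?G \<and> card (fst p \<inter> fst q) = 2}"
    by (simp add: two_big_def Let_def)
  have "card (fst (w i) \<inter> fst (w (Suc i))) = 2" for i
    using adj[of "i mod N"] N3 by (simp add: w_def mod_Suc_eq)
  then have arcs: "set p \<subseteq> arcs ?G"
    unfolding A p_def using wV by auto
  have wN: "w N = w 0" by (simp add: w_def)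
  have aw: "pre_digraph.awalk ?G (w 0) p (w 0)"
    unfolding pre_digraph.awalk_def using wV arcs cas_map_upt[OF GT, of 0 N w] wN
    by (auto simp: p_def)
  \<comment> \<open>\<open>cycle\<close> asks for distinct vertices after removal of the first one,
    which returns at the end; the indices \<open>1\<close> to \<open>N\<close> remain.\<close>
  have tl: "tl (pre_digraph.awalk_verts ?G (w 0) p) = map w [Suc 0..<Suc N]"
    using N3 unfolding p_def awalk_verts_map_upt[OF GT le0] 
    by (subst upt_conv_Cons) (auto simp del: upt_Suc)
  have "inj_on w {Suc 0..<Suc N}"
  proof (rule inj_onI)
    fix i j assume ij: "i \<in> {Suc 0..<Suc N}" "j \<in> {Suc 0..<Suc N}" "w i = w j"
    have "k mod length bs < length bs" for k
      by (rule mod_less_divisor) (use N3 in \<open>auto simp: N_def\<close>)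
    then have "i mod N = j mod N"
      using ij(3) dist by (simp add: w_def N_def nth_eq_iff_index_eq)
    with ij(1,2) show "i = j"
      by (metis One_nat_def Suc_eq_plus1 Suc_leI Suc_le_mono add.right_neutral atLeastLessThan_iff
          le_antisym less_Suc_eq mod_less mod_self not_less_eq_eq zero_less_iff_neq_zero)
  qed
  then have "distinct (tl (pre_digraph.awalk_verts ?G (w 0) p))"
    unfolding tl by (simp add: distinct_map del: upt_Suc)
  with aw N3 have "pre_digraph.cycle ?G p"
    unfolding pre_digraph.cycle_def by (intro exI[of _ "w 0"]) (auto simp: p_def)
  moreover have "tail ?G ` set p = verts ?G"
  proof -
    have "tail ?G ` set p = w ` {0..<N}" by (simp add: p_def image_image)
    also have "\<dots> = (\<lambda>b. (b, 0)) ` set bs"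
      unfolding w_def set_conv_nth N_def by (auto simp: image_iff intro!: bexI)
    finally show ?thesis unfolding V' .
  qed
  ultimately show ?thesis
    unfolding hamiltonian_def hamilton_cycle_def using N3 by (intro exI[of _ p]) (simp add: p_def)
qed

text \<open>A bijection onto the numbers below \<open>v\<close> preserves intersections of blocks
  and hence the cyclic order. The constructions may therefore take their points from any
  type.\<close>

lemma gray_systemI:
  fixes V :: "'a set" and bs :: "'a set list"
  assumes V: "finite V" "card V = v" and bs: "distinct bs" "3 \<le> length bs"
    and blocks: "\<And>b. b \<in> set bs \<Longrightarrow> b \<subseteq> V \<and> card b = 3"
    and pairs: "\<And>x y. x \<in> V \<Longrightarrow> y \<in> V \<Longrightarrow> x \<noteq> y \<Longrightarrow> card {b \<in> set bs. x \<in> b \<and> y \<in> b} = l"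
    and adj: "\<And>i. i < length bs \<Longrightarrow> card (bs ! i \<inter> bs ! (Suc i mod length bs)) = 2"
  shows "gray_system v l"
proof -
  obtain f :: "'a \<Rightarrow> nat" where f: "bij_betw f V {..<v}"
    using V by (metis bij_betw_iff_card finite_lessThan card_lessThan)
  have inj: "inj_on f V" using f by (rule bij_betw_imp_inj_on)
  define cs where "cs = map (image f) bs"
  have injc: "inj_on (image f) (set bs)"
    using blocks inj by (meson inj_on_image_eq_iff inj_onI)
  have dist: "distinct cs" unfolding cs_def using bs injc by (simp add: distinct_map)
  have sub: "b \<subseteq> {..<v} \<and> card b = 3" if "b \<in> set cs" for b
    using that blocks f inj unfolding cs_def bij_betw_def
    by (auto simp: card_image inj_on_subset)
  have pr: "size {#b \<in># mset cs. x \<in> b \<and> y \<in> b#} = l"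
    if xy: "x \<in> {..<v}" "y \<in> {..<v}" "x \<noteq> y" for x y
  proof -
    obtain x' y' where x': "x' \<in> V" "x = f x'" and y': "y' \<in> V" "y = f y'"
      using xy f unfolding bij_betw_def by (metis imageE)
    have mem: "f z \<in> f ` b \<longleftrightarrow> z \<in> b" if "b \<in> set bs" "z \<in> V" for b z
      using blocks[OF that(1)] that(2) inj by (meson inj_on_image_mem_iff)
    have "size {#b \<in># mset cs. x \<in> b \<and> y \<in> b#} = length (filter (\<lambda>b. x \<in> b \<and> y \<in> b) cs)"
      by (metis mset_filter size_mset)
    also have "\<dots> = card {b \<in> set cs. x \<in> b \<and> y \<in> b}"
      using dist by (metis distinct_card distinct_filter set_filter)
    also have "{b \<in> set cs. x \<in> b \<and> y \<in> b} = image f ` {b \<in> set bs. x' \<in> b \<and> y' \<in> b}"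
      using mem x' y' by (auto simp: cs_def)
    also have "card \<dots> = card {b \<in> set bs. x' \<in> b \<and> y' \<in> b}"
      by (rule card_image) (rule inj_on_subset[OF injc], auto)
    also have "\<dots> = l" using pairs x' y' xy by auto
    finally show ?thesis .
  qed
  have "simple_triple_system {..<v} (mset cs) v l"
    unfolding simple_triple_system_def triple_system_def
    using sub pr dist by (auto simp: distinct_count_atmost_1 count_mset_gt_0)
  moreover have gc: "cyclic_two_gray_code (mset cs) cs"
    unfolding cyclic_two_gray_code_def
  proof (intro conjI allI impI)
    fix i assume i: "i < length cs"
    let ?j = "Suc i mod length cs"
    have j: "?j < length bs" using i by (simp add: cs_def) (metis bs(2) mod_less_divisor length_greater_0_conv list.size(3) not_numeral_le_zero)
    have "cs ! i \<inter> cs ! ?j = f ` (bs ! i) \<inter> f ` (bs ! ?j)"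
      using i j by (simp add: cs_def)
    also have "\<dots> = f ` (bs ! i \<inter> bs ! ?j)"
      using blocks i j inj by (metis cs_def inj_on_image_Int length_map nth_mem)
    also have "card \<dots> = card (bs ! i \<inter> bs ! ?j)"
      using blocks[OF nth_mem, of i] i by (intro card_image inj_on_subset[OF inj]) (auto simp: cs_def)
    finally show "card (cs ! i \<inter> cs ! ?j) = 2"
      using adj i by (simp add: cs_def)
  qed (use bs in \<open>auto simp: cs_def\<close>)
  moreover have "hamiltonian (with_proj (two_big (mset cs)))"
    using gc dist by (intro gray_code_imp_hamiltonian) (auto simp: distinct_count_atmost_1)
  ultimately show ?thesis unfolding gray_system_def by blast
qed

lemma card_two_subset_pair:
  assumes "card P = 2" shows "\<exists>x y. x \<noteq> y \<and> P = {x, y}"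
  using assms by (auto simp: card_2_iff)

section \<open>Twofold systems: a counting criterion, and translates of base blocks\<close>

text \<open>Lower bounds suffice, by double counting: the sets \<open>f i\<close> contain at most
  \<open>3 * N\<close> pairs in all, and the assumed covering requires at least twice the number of
  pairs, which is \<open>v * (v - 1) = 3 * N\<close>. Equality throughout gives three points in each
  block and multiplicity exactly two.\<close>

lemma twofold_gray_systemI:
  fixes V :: "'a set" and f :: "nat \<Rightarrow> 'a set"
  assumes V: "finite V" "card V = v" and N: "3 \<le> N" "3 * N = v * (v - 1)"
    and sub: "\<And>i. i < N \<Longrightarrow> f i \<subseteq> V \<and> card (f i) \<le> 3"
    and adj: "\<And>i. i < N \<Longrightarrow> 2 \<le> card (f i \<inter> f (Suc i mod N))"
    and cov: "\<And>x y. x \<in> V \<Longrightarrow> y \<in> V \<Longrightarrow> x \<noteq> y \<Longrightarrow>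
      \<exists>i<N. \<exists>j<N. i \<noteq> j \<and> {x, y} \<subseteq> f i \<and> {x, y} \<subseteq> f j"
  shows "gray_system v 2"
proof -
  define D where "D = {P. P \<subseteq> V \<and> card P = 2}"
  define c where "c P = card {i \<in> {..<N}. P \<subseteq> f i}" for P
  have fin: "finite (f i)" if "i < N" for i
    using sub[OF that] V finite_subset by blast
  have finD: "finite D" unfolding D_def using V by auto
  have "card D = v choose 2"
    unfolding D_def using n_subsets[OF V(1), of 2] V(2) by simp
  then have cardD: "2 * card D = 3 * N"
    using N by (cases v) (auto simp: choose_two)
  have c2: "2 \<le> c P" if P: "P \<in> D" for P
  proof -
    obtain x y where xy: "x \<noteq> y" "P = {x, y}"
      using P card_two_subset_pair unfolding D_def by blast
    then obtain i j where ij: "i < N" "j < N" "i \<noteq> j" "P \<subseteq> f i" "P \<subseteq> f j"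
      using cov[of x y] P unfolding D_def by auto
    then have "{i, j} \<subseteq> {i \<in> {..<N}. P \<subseteq> f i}" by auto
    then have "card {i, j} \<le> c P" unfolding c_def by (intro card_mono) auto
    then show ?thesis using ij by simp
  qed
  have ch: "k choose 2 \<le> 3" if "k \<le> 3" for k :: nat
  proof -
    have "k \<in> {0, 1, 2, 3}" using that by auto
    then show ?thesis by (auto simp: choose_two)
  qed
  have "sum c D = (\<Sum>P\<in>D. \<Sum>i\<in>{..<N}. if P \<subseteq> f i then 1 else 0)"
    unfolding c_def by (simp add: sum.If_cases Int_def)
  also have "\<dots> = (\<Sum>i\<in>{..<N}. \<Sum>P\<in>D. if P \<subseteq> f i then 1 else 0)"
    by (rule sum.swap)
  also have "\<dots> = (\<Sum>i\<in>{..<N}. card (f i) choose 2)"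
  proof (rule sum.cong)
    fix i assume i: "i \<in> {..<N}"
    have "(\<Sum>P\<in>D. if P \<subseteq> f i then 1 else 0) = card {P \<in> D. P \<subseteq> f i}"
      using finD by (simp add: sum.If_cases Int_def)
    also have "{P \<in> D. P \<subseteq> f i} = {P. P \<subseteq> f i \<and> card P = 2}"
      using sub[of i] i unfolding D_def by auto
    also have "card \<dots> = card (f i) choose 2"
      using n_subsets[OF fin, of i 2] i by simp
    finally show "(\<Sum>P\<in>D. if P \<subseteq> f i then 1 else 0) = card (f i) choose 2" .
  qed simp
  finally have sumc: "sum c D = (\<Sum>i\<in>{..<N}. card (f i) choose 2)" .
  have le: "(\<Sum>i\<in>{..<N}. card (f i) choose 2) \<le> (\<Sum>i\<in>{..<N}. 3)"
    using sub by (intro sum_mono ch) auto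
  have ge: "(\<Sum>P\<in>D. 2) \<le> sum c D" using c2 by (intro sum_mono) auto
  have eq: "(\<Sum>P\<in>D. 2) = sum c D" "(\<Sum>i\<in>{..<N}. card (f i) choose 2) = (\<Sum>i\<in>{..<N}. 3)"
    using sumc le ge cardD by auto
  have cP: "c P = 2" if "P \<in> D" for P
    using sum_mono_inv[OF eq(1) c2 that finD] by simp
  have card3: "card (f i) = 3" if "i < N" for i
  proof -
    have "card (f i) choose 2 = 3"
      using sum_mono_inv[OF eq(2) _ _ finite_lessThan, of i] sub ch that by auto
    moreover have "card (f i) \<in> {0, 1, 2, 3}" using sub[OF that] by auto
    ultimately show ?thesis by (auto simp: choose_two)
  qed
  have only: "k \<in> {i, j}" if "i < N" "j < N" "k < N" "i \<noteq> j" "P \<in> D"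
    "P \<subseteq> f i" "P \<subseteq> f j" "P \<subseteq> f k" for i j k P
  proof (rule ccontr)
    assume "k \<notin> {i, j}"
    then have "card {i, j, k} = 3" using \<open>i \<noteq> j\<close> by auto
    moreover have "{i, j, k} \<subseteq> {i \<in> {..<N}. P \<subseteq> f i}" using that by auto
    then have "card {i, j, k} \<le> c P" unfolding c_def by (intro card_mono) auto
    ultimately show False using cP that by simp
  qed
  have next_neq: "Suc i mod N \<noteq> i" if "i < N" for i
    using that N(1) by (cases "Suc i = N") auto
  have common: "\<exists>P\<in>D. P \<subseteq> f i \<and> P \<subseteq> f (Suc i mod N)" if "i < N" for i
  proof -
    from adj[OF \<open>i < N\<close>] have "2 \<le> card (f i \<inter> f (Suc i mod N))" .
    then obtain P where "P \<subseteq> f i \<inter> f (Suc i mod N)" "card P = 2"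
      by (rule obtain_subset_with_card_n) auto
    then show ?thesis using sub[OF that] unfolding D_def by blast
  qed
  \<comment> \<open>The pair shared by \<open>f i\<close> and its successor also lies in
    \<open>f j\<close>, and only two indices may contain it.\<close>
  have step: "Suc i mod N = j" if "i < N" "j < N" "i \<noteq> j" "f i = f j" for i j
  proof -
    from common[OF that(1)] obtain P
      where P: "P \<in> D" "P \<subseteq> f i" "P \<subseteq> f (Suc i mod N)" by blast
    have "Suc i mod N < N" using N by simp
    then have "Suc i mod N \<in> {i, j}" using only[OF that(1,2) _ that(3) P(1)] P that by auto
    then show ?thesis using next_neq that by auto
  qed
  text \<open>A repeated block would exhaust the multiplicity of its pairs, so both its copies
    would have to be each other's successor.\<close>
  have inj: "inj_on f {0..<N}"
  proof (rule inj_onI, rule ccontr)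
    fix i j assume ij: "i \<in> {0..<N}" "j \<in> {0..<N}" "f i = f j" "i \<noteq> j"
    then have 1: "Suc i mod N = j" "Suc j mod N = i" using step[of i j] step[of j i] by auto
    then have "Suc (Suc i) mod N = i" by (metis mod_Suc_eq)
    moreover have "i < N" using ij by auto
    ultimately show False using N(1)
      by (cases "Suc (Suc i) < N"; cases "Suc i = N") (auto simp: mod_if split: if_splits)
  qed
  define bs where "bs = map f [0..<N]"
  have len: "length bs = N" by (simp add: bs_def)
  show ?thesis
  proof (rule gray_systemI[OF V])
    show "distinct bs" unfolding bs_def using inj by (simp add: distinct_map)
    show "3 \<le> length bs" using N len by simp
    show "b \<subseteq> V \<and> card b = 3" if "b \<in> set bs" for b
      using that sub card3 unfolding bs_def by fastforce
    show "card {b \<in> set bs. x \<in> b \<and> y \<in> b} = 2" if "x \<in> V" "y \<in> V" "x \<noteq> y" for x y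
    proof -
      have "{b \<in> set bs. x \<in> b \<and> y \<in> b} = f ` {i \<in> {..<N}. {x, y} \<subseteq> f i}"
        by (auto simp: bs_def)
      also have "card \<dots> = c {x, y}"
        unfolding c_def by (rule card_image) (rule inj_on_subset[OF inj], auto)
      also have "\<dots> = 2" using that by (intro cP) (auto simp: D_def)
      finally show ?thesis .
    qed
    show "card (bs ! i \<inter> bs ! (Suc i mod length bs)) = 2" if "i < length bs" for i
    proof -
      have i: "i < N" using that len by simp
      have i': "Suc i mod N < N" using N by simp
      have "card (f i \<inter> f (Suc i mod N)) \<noteq> 3"
      proof
        assume 3: "card (f i \<inter> f (Suc i mod N)) = 3"
        have "f i \<inter> f (Suc i mod N) = f i" "f i \<inter> f (Suc i mod N) = f (Suc i mod N)"
          using 3 card3[OF i] card3[OF i'] fin[OF i] fin[OF i']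
          by (intro card_subset_eq; auto)+
        then have "f i = f (Suc i mod N)" by simp
        then show False using inj next_neq[OF i] i i' by (auto simp: inj_on_def)
      qed
      moreover have "card (f i \<inter> f (Suc i mod N)) \<le> 3"
        using card_mono[OF fin[OF i], of "f i \<inter> f (Suc i mod N)"] card3[OF i] by auto
      ultimately have "card (f i \<inter> f (Suc i mod N)) = 2" using adj[OF i] by linarith
      then show ?thesis using i i' by (simp add: len) (simp add: bs_def)
    qed
  qed
qed

text \<open>Level \<open>3\<close> is reserved for a single point fixed by all translations.\<close>

definition shift_pt :: "int \<Rightarrow> int \<Rightarrow> int \<times> nat \<Rightarrow> int \<times> nat" where
  "shift_pt m s p = (if snd p = 3 then (0, 3) else ((fst p + s) mod m, snd p))"

text \<open>\<open>A\<close> and the translate of \<open>B\<close> by \<open>s\<close> have two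
  common points. Four witnesses replace the cardinality of an intersection, since the base blocks
  depend on a parameter and some of them coincide only modulo \<open>m\<close>.\<close>

definition share_pair :: "int \<Rightarrow> int \<Rightarrow> (int \<times> nat) set \<Rightarrow> (int \<times> nat) set \<Rightarrow> bool" where
  "share_pair m s A B \<longleftrightarrow> (\<exists>p\<in>A. \<exists>q\<in>A. \<exists>p'\<in>B. \<exists>q'\<in>B.
     shift_pt m 0 p = shift_pt m s p' \<and> shift_pt m 0 q = shift_pt m s q' \<and>
     shift_pt m 0 p \<noteq> shift_pt m 0 q)"

definition has_diff :: "int \<Rightarrow> nat \<Rightarrow> nat \<Rightarrow> int \<Rightarrow> (int \<times> nat) set \<Rightarrow> bool" where
  "has_diff m i j d A \<longleftrightarrow> (\<exists>a b. (a, i) \<in> A \<and> (b, j) \<in> A \<and> m dvd (b - a - d))"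

lemma shift_pt_cong:
  "shift_pt m s p = shift_pt m s' p' \<longleftrightarrow> shift_pt m (r + s) p = shift_pt m (r + s') p'"
proof -
  have "((a + s) mod m = (b + s') mod m) = ((a + (r + s)) mod m = (b + (r + s')) mod m)" for a b
    by (simp add: mod_eq_dvd_iff algebra_simps)
  then show ?thesis unfolding shift_pt_def by auto
qed

lemma share_pairD:
  assumes "share_pair m s A B" "finite A"
  shows "2 \<le> card (shift_pt m r ` A \<inter> shift_pt m (r + s) ` B)"
proof -
  obtain p q p' q' where *: "p \<in> A" "q \<in> A" "p' \<in> B" "q' \<in> B"
    "shift_pt m 0 p = shift_pt m s p'" "shift_pt m 0 q = shift_pt m s q'"
    "shift_pt m 0 p \<noteq> shift_pt m 0 q"
    using assms(1) unfolding share_pair_def by blast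
  have **: "shift_pt m r p = shift_pt m (r + s) p'" "shift_pt m r q = shift_pt m (r + s) q'"
    "shift_pt m r p \<noteq> shift_pt m r q"
    using *(5-7) shift_pt_cong[of m 0 _ _ _ r] by (metis add.right_neutral)+
  have "shift_pt m r p \<in> shift_pt m r ` A \<inter> shift_pt m (r + s) ` B"
    using *(1,3) **(1) by (metis IntI imageI)
  moreover have "shift_pt m r q \<in> shift_pt m r ` A \<inter> shift_pt m (r + s) ` B"
    using *(2,4) **(2) by (metis IntI imageI)
  ultimately have "{shift_pt m r p, shift_pt m r q} \<subseteq> shift_pt m r ` A \<inter> shift_pt m (r + s) ` B"
    and "card {shift_pt m r p, shift_pt m r q} = 2"
    using **(3) by auto
  then show ?thesis using assms(2) by (metis card_mono finite_Int finite_imageI)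
qed

text \<open>Index \<open>n\<close> stands for base block \<open>n mod K\<close> translated by
  \<open>(n div K) * g\<close>. As \<open>g\<close> is invertible modulo \<open>m\<close>, these
  translations run through all residues, so a pair of points is covered as often as its difference
  occurs in the base blocks. Differences within a level matter only up to sign, whence the bound
  \<open>2 * d \<le> m\<close>.\<close>

lemma shifted_gray_systemI:
  fixes ts :: "'t list" and blk :: "'t \<Rightarrow> (int \<times> nat) set" and fixpt :: bool
  defines "K \<equiv> length ts"
  assumes m: "0 < m" and dist: "distinct ts" and g: "coprime g m"
    and K: "3 \<le> nat m * K"
    and count: "3 * (nat m * K) = v * (v - 1)" and v: "v = 3 * nat m + of_bool fixpt"
    and blk: "\<And>t. t \<in> set ts \<Longrightarrow> finite (blk t) \<and> card (blk t) \<le> 3 \<and>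
      snd ` blk t \<subseteq> {..<3} \<union> (if fixpt then {3} else {})"
    and succ: "successively (\<lambda>t t'. share_pair m 0 (blk t) (blk t')) ts"
    and close: "share_pair m g (blk (last ts)) (blk (hd ts))"
    and pure: "\<And>i d. i < 3 \<Longrightarrow> 0 < d \<Longrightarrow> 2 * d \<le> m \<Longrightarrow>
      (\<exists>t\<in>set ts. has_diff m i i d (blk t) \<and>
        (2 * d = m \<or> (\<exists>t'\<in>set ts. t \<noteq> t' \<and> has_diff m i i d (blk t'))))"
    and mixed: "\<And>i j d. (i, j) \<in> {(0, 1), (1, 2), (2, 0)} \<Longrightarrow> 0 \<le> d \<Longrightarrow> d < m \<Longrightarrow>
      (\<exists>t\<in>set ts. \<exists>t'\<in>set ts. t \<noteq> t' \<and> has_diff m i j d (blk t) \<and> has_diff m i j d (blk t'))"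
    and fixed: "\<And>i. fixpt \<Longrightarrow> i < 3 \<Longrightarrow>
      (\<exists>t\<in>set ts. \<exists>t'\<in>set ts. t \<noteq> t' \<and> {3, i} \<subseteq> snd ` blk t \<and> {3, i} \<subseteq> snd ` blk t')"
  shows "gray_system v 2"
proof -
  define V where "V = {0..<m} \<times> {..<3::nat} \<union> (if fixpt then {(0, 3)} else {})"
  define N where "N = nat m * K"
  define f where "f n = shift_pt m (int (n div K) * g) ` blk (ts ! (n mod K))" for n
  have K0: "0 < K" using K by (cases K) auto
  have finV: "finite V" unfolding V_def by auto
  have cardV: "card V = v"
    unfolding V_def v using m by (auto simp: card_cartesian_product card_insert_if)
  have tsK: "ts ! (n mod K) \<in> set ts" for n
    using K0 unfolding K_def by simp
  have divK: "n div K < nat m" if "n < N" for n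
    using that K0 unfolding N_def by (simp add: less_mult_imp_div_less)
  have ex_index: "\<exists>n<N. ts ! (n mod K) = t \<and> m dvd (int (n div K) * g - s)"
    if "t \<in> set ts" for t s
  proof -
    from that obtain \<tau> where \<tau>: "\<tau> < K" "ts ! \<tau> = t"
      unfolding K_def by (meson in_set_conv_nth)
    \<comment> \<open>The inverse \<open>a\<close> of \<open>g\<close> modulo \<open>m\<close> turns
      the wanted translation \<open>s\<close> into the round \<open>a * s\<close> modulo
      \<open>m\<close>.\<close>
    obtain a b where a: "a * g + b * m = 1" using bezout_int[of g m] g by auto
    define r where "r = nat ((a * s) mod m)"
    have r: "int r = (a * s) mod m" unfolding r_def using m by simp
    have rm: "r < nat m" using r m by (metis int_nat_eq less_imp_le of_nat_less_iff pos_mod_bound)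
    have dv: "m dvd (int r * g - s)"
    proof -
      have "m dvd (int r - a * s)" unfolding r by (simp add: mod_eq_dvd_iff [symmetric])
      then have "m dvd (int r - a * s) * g - m * (b * s)" by (rule dvd_diff[OF dvd_mult2 dvd_triv_left])
      also have "(int r - a * s) * g - m * (b * s) = int r * g - (a * g + b * m) * s"
        by (simp add: algebra_simps)
      finally show ?thesis by (simp add: a)
    qed
    define n where "n = r * K + \<tau>"
    have "n div K = r" "n mod K = \<tau>" using \<tau>(1) by (auto simp: n_def)
    moreover have "n < N"
    proof -
      have "n < r * K + K" using \<tau> by (simp add: n_def)
      also have "\<dots> = Suc r * K" by simp
      also have "\<dots> \<le> nat m * K" using rm by (intro mult_le_mono1) simp
      finally show ?thesis by (simp add: N_def)
    qed
    ultimately show ?thesis using dv \<tau> by auto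
  qed
  have in_f: "(x, i) \<in> f n"
    if "(u, i) \<in> blk (ts ! (n mod K))" "i \<noteq> 3" "m dvd (int (n div K) * g - s)"
      "m dvd (u + s - x)" "0 \<le> x" "x < m" for u i n s x
  proof -
    have "m dvd (int (n div K) * g - s) + (u + s - x)" using that by (intro dvd_add)
    then have "m dvd (u + int (n div K) * g) - x" by (simp add: algebra_simps)
    then have "(u + int (n div K) * g) mod m = x mod m" by (simp add: mod_eq_dvd_iff)
    then have "shift_pt m (int (n div K) * g) (u, i) = (x, i)" using that by (simp add: shift_pt_def)
    then show ?thesis unfolding f_def using that(1) by (metis imageI)
  qed
  have diff_index: "\<exists>n<N. ts ! (n mod K) = t \<and> m dvd (int (n div K) * g - (x - a)) \<and> {(x, i), (y, j)} \<subseteq> f n"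
    if "t \<in> set ts" "(a, i) \<in> blk t" "(b, j) \<in> blk t" "m dvd (b - a - (y - x))" "i < 3" "j < 3"
      "0 \<le> x" "x < m" "0 \<le> y" "y < m" for t i j a b x y
  proof -
    from ex_index[OF that(1), of "x - a"] obtain n
      where n: "n < N" "ts ! (n mod K) = t" "m dvd (int (n div K) * g - (x - a))" by blast
    have "(x, i) \<in> f n" by (rule in_f[of a _ _ "x - a"]) (use n that in auto)
    moreover have "(y, j) \<in> f n"
      by (rule in_f[of b _ _ "x - a"]) (use n that in \<open>auto simp: algebra_simps\<close>)
    ultimately show ?thesis using n by auto
  qed
  have pure_cov: "\<exists>n<N. \<exists>n'<N. n \<noteq> n' \<and> {(x, i), (y, i)} \<subseteq> f n \<and> {(x, i), (y, i)} \<subseteq> f n'"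
    if xy: "0 \<le> x" "x < m" "0 \<le> y" "y < m" "x \<noteq> y" "i < 3" "2 * ((y - x) mod m) \<le> m" for x y i
  proof -
    define d where "d = (y - x) mod m"
    have md: "m dvd (d - (y - x))" unfolding d_def by (simp add: mod_eq_dvd_iff [symmetric])
    have "\<not> m dvd (y - x)" using xy by (auto simp: mod_eq_dvd_iff[symmetric])
    then have d: "0 < d" "2 * d \<le> m" using xy m unfolding d_def
      by (auto simp: dvd_eq_mod_eq_0 order_less_le)
    obtain t where t: "t \<in> set ts" "has_diff m i i d (blk t)"
      and t': "2 * d = m \<or> (\<exists>t'\<in>set ts. t \<noteq> t' \<and> has_diff m i i d (blk t'))"
      using pure[OF xy(6) d] by blast
    have D: "\<exists>n<N. ts ! (n mod K) = t \<and> {(x, i), (y, i)} \<subseteq> f n"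
      if "t \<in> set ts" "has_diff m i i d (blk t)" for t
    proof -
      from that(2) obtain a b where ab: "(a, i) \<in> blk t" "(b, i) \<in> blk t" "m dvd (b - a - d)"
        unfolding has_diff_def by blast
      have "m dvd (b - a - d) + (d - (y - x))" using ab md by (intro dvd_add)
      then have "m dvd (b - a - (y - x))" by (simp add: algebra_simps)
      from diff_index[OF that(1) ab(1,2) this] xy show ?thesis by auto
    qed
    from t' show ?thesis
    proof
      assume "\<exists>t'\<in>set ts. t \<noteq> t' \<and> has_diff m i i d (blk t')"
      then show ?thesis using D[OF t] D by metis
    next
      \<comment> \<open>For the difference \<open>m / 2\<close> one base block is enough: the
        translations by \<open>x - a\<close> and by \<open>x - b\<close> put its two points on the
        pair in the two possible orders, and they are different.\<close>
      assume h: "2 * d = m"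
      obtain a b where ab: "(a, i) \<in> blk t" "(b, i) \<in> blk t" "m dvd (b - a - d)"
        using t unfolding has_diff_def by blast
      have 1: "m dvd (b - a - (y - x))"
        using dvd_add[OF ab(3) md] by (simp add: algebra_simps)
      from diff_index[OF t(1) ab(1,2) 1 xy(6,6,1-4)] obtain n
        where n: "n < N" "m dvd (int (n div K) * g - (x - a))" "{(x, i), (y, i)} \<subseteq> f n"
        by blast
      have "m dvd (- (b - a - d) + (d - (y - x))) - m"
        by (rule dvd_diff[OF dvd_add[OF iffD2[OF dvd_minus_iff ab(3)] md] dvd_refl])
      also have "(- (b - a - d) + (d - (y - x))) - m = a - b - (y - x)" using h by simp
      finally have 2: "m dvd (a - b - (y - x))" .
      from diff_index[OF t(1) ab(2,1) 2 xy(6,6,1-4)] obtain n'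
        where n': "n' < N" "m dvd (int (n' div K) * g - (x - b))" "{(x, i), (y, i)} \<subseteq> f n'"
        by blast
      have "n \<noteq> n'"
      proof
        assume "n = n'"
        then have "m dvd b - a"
          using dvd_diff[OF n'(2) n(2)] by (simp add: algebra_simps)
        from dvd_diff[OF this ab(3)] have "m dvd d" by simp
        then show False using d h by (auto dest: zdvd_imp_le)
      qed
      then show ?thesis using n n' by blast
    qed
  qed
  have mixed_cov: "\<exists>n<N. \<exists>n'<N. n \<noteq> n' \<and> {(x, i), (y, j)} \<subseteq> f n \<and> {(x, i), (y, j)} \<subseteq> f n'"
    if xy: "0 \<le> x" "x < m" "0 \<le> y" "y < m" "(i, j) \<in> {(0, 1), (1, 2), (2, 0)}" for x y i j
  proof -
    have D: "\<exists>n<N. ts ! (n mod K) = t \<and> {(x, i), (y, j)} \<subseteq> f n"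
      if "t \<in> set ts" "has_diff m i j ((y - x) mod m) (blk t)" for t
    proof -
      from that(2) obtain a b where ab: "(a, i) \<in> blk t" "(b, j) \<in> blk t" "m dvd (b - a - (y - x) mod m)"
        unfolding has_diff_def by blast
      have md: "m dvd ((y - x) mod m - (y - x))" by (simp add: mod_eq_dvd_iff [symmetric])
      have "m dvd (b - a - (y - x))" using dvd_add[OF ab(3) md] by (simp add: algebra_simps)
      from diff_index[OF that(1) ab(1,2) this] xy show ?thesis by auto
    qed
    obtain t t' where "t \<in> set ts" "t' \<in> set ts" "t \<noteq> t'"
      "has_diff m i j ((y - x) mod m) (blk t)" "has_diff m i j ((y - x) mod m) (blk t')"
      using mixed[OF xy(5), of "(y - x) mod m"] m by auto
    then show ?thesis using D[of t] D[of t'] by metis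
  qed
  have fixed_cov: "\<exists>n<N. \<exists>n'<N. n \<noteq> n' \<and> {(x, i), (0, 3)} \<subseteq> f n \<and> {(x, i), (0, 3)} \<subseteq> f n'"
    if xy: "0 \<le> x" "x < m" "i < 3" "fixpt" for x i
  proof -
    have D: "\<exists>n<N. ts ! (n mod K) = t \<and> {(x, i), (0, 3)} \<subseteq> f n"
      if t: "t \<in> set ts" "{3, i} \<subseteq> snd ` blk t" for t
    proof -
      obtain a c where a: "(a, i) \<in> blk t" "(c, 3) \<in> blk t" using t(2) by force
      obtain n where n: "n < N" "ts ! (n mod K) = t" "m dvd (int (n div K) * g - (x - a))"
        using ex_index[OF t(1)] by blast
      have "(x, i) \<in> f n" by (rule in_f[of a _ _ "x - a"]) (use n a xy in auto)
      moreover have "(0, 3) \<in> f n" unfolding f_def using n(2) a(2)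
        by (force simp: shift_pt_def image_iff)
      ultimately show ?thesis using n by auto
    qed
    obtain t t' where "t \<in> set ts" "t' \<in> set ts" "t \<noteq> t'"
      "{3, i} \<subseteq> snd ` blk t" "{3, i} \<subseteq> snd ` blk t'"
      using fixed[OF xy(4,3)] by blast
    then show ?thesis using D[of t] D[of t'] by metis
  qed
  show ?thesis
  proof (rule twofold_gray_systemI[OF finV cardV])
    show "3 \<le> N" "3 * N = v * (v - 1)" using K count by (simp_all add: N_def)
    show "f n \<subseteq> V \<and> card (f n) \<le> 3" if "n < N" for n
    proof
      have b: "finite (blk (ts ! (n mod K)))" "card (blk (ts ! (n mod K))) \<le> 3"
        "snd ` blk (ts ! (n mod K)) \<subseteq> {..<3} \<union> (if fixpt then {3} else {})"
        using blk[OF tsK] by auto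
      show "card (f n) \<le> 3" unfolding f_def using card_image_le[OF b(1)] b(2) le_trans by blast
      show "f n \<subseteq> V" using b(3) m unfolding f_def V_def
        by (force simp: shift_pt_def split: if_splits)
    qed
    show "2 \<le> card (f n \<inter> f (Suc n mod N))" if n: "n < N" for n
    proof (cases "Suc (n mod K) < K")
      case True
      then have 1: "Suc n div K = n div K" "Suc n mod K = Suc (n mod K)"
        by (auto simp: mod_Suc div_Suc)
      have "Suc n < N"
      proof -
        have "Suc n div K < nat m" using divK[OF n] 1 by simp
        then show ?thesis unfolding N_def by (metis K0 less_mult_imp_div_less div_less_iff_less_mult)
      qed
      moreover have "share_pair m 0 (blk (ts ! (n mod K))) (blk (ts ! Suc (n mod K)))"
        using succ True unfolding K_def by (simp add: successively_conv_nth)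
      ultimately show ?thesis
        using share_pairD[of m 0 _ _ "int (n div K) * g"] blk[OF tsK] 1 unfolding f_def by auto
    next
      case False
      then have last: "Suc (n mod K) = K" using K0 by (meson Suc_lessI mod_less_divisor)
      then have 1: "Suc n div K = Suc (n div K)" "Suc n mod K = 0"
        by (auto simp: mod_Suc div_Suc)
      \<comment> \<open>This holds at the wrap-around too: after the last round the translation is
        \<open>m * g\<close>, which is 0 modulo \<open>m\<close>.\<close>
      have "f (Suc n mod N) = shift_pt m (int (Suc (n div K)) * g) ` blk (ts ! 0)"
      proof (cases "Suc n < N")
        case True
        then show ?thesis using 1 by (simp add: f_def)
      next
        case False
        then have eq: "Suc n = N" using n by simp
        then have "Suc (n div K) = nat m" using 1 K0 by (simp add: N_def)
        then have "int (Suc (n div K)) = m" using m by simp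
        then have "shift_pt m (int (Suc (n div K)) * g) = shift_pt m 0"
          by (auto simp: shift_pt_def fun_eq_iff)
        then show ?thesis using eq by (simp add: f_def)
      qed
      moreover have "share_pair m g (blk (ts ! (n mod K))) (blk (ts ! 0))"
      proof -
        have "ts \<noteq> []" using K0 by (auto simp: K_def)
        moreover have "n mod K = length ts - 1" using last by (simp add: K_def)
        ultimately show ?thesis using close by (simp add: last_conv_nth hd_conv_nth)
      qed
      ultimately show ?thesis
        using share_pairD[of m g _ _ "int (n div K) * g"] blk[OF tsK] unfolding f_def
        by (auto simp: algebra_simps)
    qed
    fix p q assume pq: "p \<in> V" "q \<in> V" "p \<noteq> q"
    obtain x i where p: "p = (x, i)" by force
    obtain y j where q: "q = (y, j)" by force
    have sym: "\<exists>n<N. \<exists>n'<N. n \<noteq> n' \<and> {p, q} \<subseteq> f n \<and> {p, q} \<subseteq> f n'"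
      if "\<exists>n<N. \<exists>n'<N. n \<noteq> n' \<and> {q, p} \<subseteq> f n \<and> {q, p} \<subseteq> f n'"
      using that by (simp add: insert_commute)
    consider "i < 3" "j = i" | "i < 3" "j < 3" "(i, j) \<in> {(0, 1), (1, 2), (2, 0)}"
      | "i < 3" "j < 3" "(j, i) \<in> {(0, 1), (1, 2), (2, 0)}" | "j = 3" "i < 3" | "i = 3" "j < 3"
    proof -
      have "i \<in> {0, 1, 2, 3}" "j \<in> {0, 1, 2, 3}" "\<not> (i = 3 \<and> j = 3)"
        using pq by (auto simp: V_def p q split: if_splits)
      then show ?thesis using that by (elim insertE emptyE) auto
    qed
    then show "\<exists>n<N. \<exists>n'<N. n \<noteq> n' \<and> {p, q} \<subseteq> f n \<and> {p, q} \<subseteq> f n'"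
    proof cases
      case 1
      then have xy: "0 \<le> x" "x < m" "0 \<le> y" "y < m" "x \<noteq> y"
        using pq by (auto simp: V_def p q split: if_splits)
      show ?thesis
      \<comment> \<open>One of the two orders of the pair has a difference of at most half of
        \<open>m\<close>.\<close>
      proof (cases "2 * ((y - x) mod m) \<le> m")
        case True
        then show ?thesis using pure_cov[OF xy 1(1)] 1 by (simp add: p q)
      next
        case False
        have "(x - y) mod m = m - (y - x) mod m"
          using zmod_zminus1_eq_if[of "y - x" m] False m by (auto split: if_splits)
        then have "2 * ((x - y) mod m) \<le> m" using False by linarith
        then show ?thesis using pure_cov[OF xy(3,4,1,2) xy(5)[symmetric] 1(1)] 1
          by (intro sym) (simp add: p q)
      qed
    next
      case 2
      then show ?thesis using mixed_cov[of x y i j] pq by (auto simp: V_def p q split: if_splits)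
    next
      case 3
      show ?thesis by (rule sym)
        (use 3 mixed_cov[of y x j i] pq in \<open>auto simp: V_def p q split: if_splits\<close>)
    next
      case 4
      then show ?thesis using fixed_cov[of x i] pq by (auto simp: V_def p q split: if_splits)
    next
      case 5
      show ?thesis by (rule sym)
        (use 5 fixed_cov[of y j] pq in \<open>auto simp: V_def p q split: if_splits\<close>)
    qed
  qed
qed

section \<open>Twofold systems on \<open>12 j + 4\<close> points\<close>

text \<open>The sequence 0, 1, -1, 2, -2, ... has steps of lengths 1, 2, 3, ..., and its first
  \<open>m\<close> values represent each residue modulo \<open>m\<close> once. A fan of blocks, with
  a fixed apex and two successive values each, thus has every step length once and every inner value
  twice.\<close>

definition zigzag :: "nat \<Rightarrow> int" where
  "zigzag t = (if even t then - int (t div 2) else int (Suc t div 2))"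

lemma zigzag_diff: "zigzag (Suc t) - zigzag t = (if even t then int (Suc t) else - int (Suc t))"
  by (auto simp: zigzag_def elim!: evenE oddE)

lemma zigzag_double [simp]: "zigzag (2 * j) = - int j" "j > 0 \<Longrightarrow> zigzag (2 * j - 1) = int j"
  "zigzag 0 = 0" "zigzag (Suc 0) = 1"
  by (auto simp: zigzag_def)

lemma zigzag_surj:
  assumes "0 < m" shows "\<exists>t<m. int m dvd (zigzag t - d)"
proof -
  define e where "e = d mod int m"
  have e: "0 \<le> e" "e < int m" "int m dvd (e - d)"
    using assms by (auto simp: e_def mod_eq_dvd_iff[symmetric])
  show ?thesis
  proof (cases "2 * e \<le> int m")
    case True
    show ?thesis
    proof (cases "e = 0")
      case True
      then show ?thesis using e assms by (intro exI[of _ 0]) auto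
    next
      case False
      then have "zigzag (2 * nat e - 1) = e" using e zigzag_double(2)[of "nat e"] by simp
      then show ?thesis using e True False by (intro exI[of _ "2 * nat e - 1"]) auto
    qed
  next
    case False
    have "zigzag (2 * nat (int m - e)) = e - int m" using e by simp
    moreover have "int m dvd (e - int m - d)" 
      using dvd_diff[OF e(3) dvd_refl[of "int m"]] by (simp add: algebra_simps)
    ultimately show ?thesis using e False by (intro exI[of _ "2 * nat (int m - e)"]) auto
  qed
qed

text \<open>The three alternatives spare reductions modulo \<open>m\<close>: the differences of
  concrete points are off by at most one \<open>m\<close>.\<close>

lemma has_diffI:
  assumes "(a, i) \<in> A" "(b, j) \<in> A" "m dvd (e - d)" "b - a = e \<or> b - a = e + m \<or> b - a = e - m"
  shows "has_diff m i j d A"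
proof -
  have "m dvd (e + m - d)" "m dvd (e - m - d)"
    using dvd_add[OF assms(3) dvd_refl[of m]] dvd_diff[OF assms(3) dvd_refl[of m]]
    by (simp_all add: algebra_simps)
  then have "m dvd (b - a - d)" using assms(3,4) by auto
  then show ?thesis unfolding has_diff_def using assms(1,2) by blast
qed

lemma has_diff_pureI:
  assumes "(a, i) \<in> A" "(b, i) \<in> A" "\<bar>b - a\<bar> = d \<or> \<bar>b - a\<bar> = m - d"
  shows "has_diff m i i d A"
proof (cases "b - a = d \<or> b - a = d - m")
  case True
  then show ?thesis using has_diffI[OF assms(1,2), of m d d] by auto
next
  case False
  then have "a - b = d \<or> a - b = d - m" using assms(3) by linarith
  then show ?thesis using has_diffI[OF assms(2,1), of m d d] by auto
qed

lemma share_pairI: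
  assumes "(a, i) \<in> A" "(b, j) \<in> A" "(a', i) \<in> B" "(b', j) \<in> B"
    and "a - a' \<in> {s, s + m, s - m}" "b - b' \<in> {s, s + m, s - m}" "i \<noteq> j \<or> i < 3 \<and> \<not> m dvd (a - b)"
  shows "share_pair m s A B"
proof -
  have *: "shift_pt m 0 (x, k) = shift_pt m s (x', k)" if "x - x' \<in> {s, s + m, s - m}" for x x' k
  proof -
    from that have "x - (x' + s) \<in> {0, m, - m}" by auto
    then have "m dvd (x - (x' + s))" by auto
    then show ?thesis by (simp add: shift_pt_def mod_eq_dvd_iff)
  qed
  have "shift_pt m 0 (a, i) \<noteq> shift_pt m 0 (b, j)"
    using assms(7) by (auto simp: shift_pt_def mod_eq_dvd_iff)
  then show ?thesis unfolding share_pair_def using * assms(1-6) by metis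
qed

lemma share_pair0I:
  assumes "(a, i) \<in> A" "(b, j) \<in> A" "(a, i) \<in> B" "(b, j) \<in> B" "i \<noteq> j"
  shows "share_pair m 0 A B"
  by (rule share_pairI[of a i A b j a B b]) (use assms in auto)

lemma successively_map_upt:
  assumes "\<And>t. a \<le> t \<Longrightarrow> Suc t < b \<Longrightarrow> R (f t) (f (Suc t))"
  shows "successively R (map f [a..<b])"
  using assms by (simp add: successively_conv_nth)

lemma successively_map_rev_upt:
  assumes "\<And>t. a \<le> t \<Longrightarrow> Suc t < b \<Longrightarrow> R (f (Suc t)) (f t)"
  shows "successively R (map f (rev [a..<b]))"
proof -
  have "successively (\<lambda>x y. R y x) (map f [a..<b])"
    using assms by (rule successively_map_upt)
  then show ?thesis by (simp only: rev_map[symmetric] successively_rev)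
qed

lemma mem_Pair_image: "(c, t) \<in> Pair a ` S \<longleftrightarrow> c = a \<and> t \<in> S"
  by auto

lemma inj_on_Pair: "inj_on (Pair a) S"
  by (auto simp: inj_on_def)

text \<open>Families 0, 1 and 2 are fans. Modulo \<open>4 j + 1\<close> and up to sign, their step
  lengths \<open>1, ..., 4 j - 1\<close> give the differences \<open>2, ..., 2 j\<close> twice and
  the difference 1 once. The seven special blocks of family 3 supply what is still missing,
  including the pairs with the fixed point, and link the fans to each other.\<close>

definition blkB :: "nat \<Rightarrow> nat \<times> nat \<Rightarrow> (int \<times> nat) set" where
  "blkB j ct = (let j = int j; t = snd ct in
     if fst ct = 0 then {(0, 1), (zigzag t, 0), (zigzag (Suc t), 0)}
     else if fst ct = 1 then {(-1, 0), (-1 - zigzag (Suc t), 2), (-1 - zigzag t, 2)}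
     else if fst ct = 2 then {(-2, 2), (-2 - zigzag (Suc t), 1), (-2 - zigzag t, 1)}
     else [{(0, 0), (0, 1), (0, 2)}, {(2 * j, 0), (0, 1), (-1, 1)},
       {(0, 3), (2 * j, 0), (-1, 1)}, {(0, 3), (-1, 1), (2 * j, 2)}, {(0, 3), (2 * j, 2), (0, 0)},
       {(2 * j, 2), (0, 0), (-1, 0)}, {(-2 - 2 * j, 1), (-2, 2), (-1, 2)}] ! t)"

text \<open>Fans 1 and 2 run backwards. Fan 2 thus ends with a block containing
  \<open>(-2, 2)\<close> and \<open>(-2, 1)\<close>, which belong to the translate of the first
  block by \<open>-2\<close>; this is where the generator \<open>-2\<close> comes from.\<close>

definition tagsB :: "nat \<Rightarrow> (nat \<times> nat) list" where
  "tagsB j = [(3, 0)] @ map (Pair 0) [0..<4 * j - 1] @ [(3, 1), (3, 2), (3, 3), (3, 4), (3, 5)] @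
     map (Pair 1) (rev [0..<4 * j - 1]) @ [(3, 6)] @ map (Pair 2) (rev [0..<4 * j - 1])"

lemma gray_system_B:
  assumes j: "0 < j"
  shows "gray_system (12 * j + 4) 2"
proof (rule shifted_gray_systemI[where m = "4 * int j + 1" and ts = "tagsB j" and blk = "blkB j"
      and fixpt = True and g = "-2"])
  let ?m = "4 * int j + 1"
  let ?S = "\<lambda>t t'. share_pair ?m 0 (blkB j t) (blkB j t')" and ?D = "\<lambda>i k d t. has_diff ?m i k d (blkB j t)"
  let ?T = "set (tagsB j)"
  note bl = blkB_def Let_def
  have len: "length (tagsB j) = 12 * j + 4" using j by (simp add: tagsB_def)
  have nm: "nat ?m = 4 * j + 1" by simp
  \<comment> \<open>\<open>2 j\<close> is the last value of a fan, and \<open>- 2 j\<close> in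
    \<open>z2\<close> represents the one residue that no fan reaches.\<close>
  have z1: "zigzag (4 * j - 1) = 2 * int j" "zigzag (4 * j - Suc 0) = 2 * int j"
    using j zigzag_double(2)[of "2 * j"] by simp_all
  have z2: "zigzag (4 * j) = - 2 * int j" using zigzag_double(1)[of "2 * j"] by simp
  have Suc1: "Suc (4 * j - 2) = 4 * j - 1" using j by simp
  have mem: "(c, t) \<in> ?T \<longleftrightarrow> c \<in> {0, 1, 2} \<and> t < 4 * j - 1 \<or> c = 3 \<and> t < 7" for c t
  proof -
    have "t < 7 \<longleftrightarrow> t = 0 \<or> t = 1 \<or> t = 2 \<or> t = 3 \<or> t = 4 \<or> t = 5 \<or> t = 6" by arith
    then show ?thesis unfolding tagsB_def by (simp add: mem_Pair_image) blast
  qed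
  show "0 < ?m" by simp
  show "distinct (tagsB j)"
    unfolding tagsB_def by (simp add: distinct_map inj_on_Pair disjoint_iff mem_Pair_image)
  show "coprime (-2) ?m"
    by simp
  show "3 \<le> nat ?m * length (tagsB j)" unfolding len nm by (simp add: algebra_simps)
  show "12 * j + 4 = 3 * nat ?m + of_bool True" by simp
  show "3 * (nat ?m * length (tagsB j)) = (12 * j + 4) * (12 * j + 4 - 1)"
    unfolding len nm by (simp add: algebra_simps)
  show "finite (blkB j ct) \<and> card (blkB j ct) \<le> 3 \<and> snd ` blkB j ct \<subseteq> {..<3} \<union> (if True then {3} else {})"
    if "ct \<in> ?T" for ct
  proof -
    have c: "card {a, b} \<le> 2" "card {a, b, c} \<le> 3" for a b c :: "int \<times> nat"
      by (simp_all add: card_insert_if)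
    obtain c t where ct: "ct = (c, t)" by force
    have "c \<in> {0, 1, 2} \<or> c = 3 \<and> t \<in> {0, 1, 2, 3, 4, 5, 6}"
      using that unfolding ct mem by auto
    then show ?thesis unfolding ct bl
      by (elim disjE conjE insertE emptyE) (simp_all add: c)
  qed
  show "successively ?S (tagsB j)"
  proof -
    have L0: "successively ?S (map (Pair 0) [0..<4 * j - 1])"
    proof (rule successively_map_upt)
      show "?S (0, t) (0, Suc t)" for t
        by (rule share_pair0I[of 0 1 _ "zigzag (Suc t)" 0]) (auto simp: blkB_def)
    qed
    have L1: "successively ?S (map (Pair 1) (rev [0..<4 * j - 1]))"
    proof (rule successively_map_rev_upt)
      show "?S (1, Suc t) (1, t)" for t
        by (rule share_pair0I[of "-1" 0 _ "-1 - zigzag (Suc t)" 2]) (auto simp: blkB_def)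
    qed
    have L2: "successively ?S (map (Pair 2) (rev [0..<4 * j - 1]))"
    proof (rule successively_map_rev_upt)
      show "?S (2, Suc t) (2, t)" for t
        by (rule share_pair0I[of "-2" 2 _ "-2 - zigzag (Suc t)" 1]) (auto simp: blkB_def)
    qed
    have S0: "?S (3, 0) (0, 0)"
      by (rule share_pair0I[of 0 0 _ 0 1]) (simp_all add: blkB_def Suc1 z1)
    have S1: "?S (0, 4 * j - 2) (3, 1)"
      by (rule share_pair0I[of "2 * int j" 0 _ 0 1]) (simp_all add: blkB_def Suc1 z1)
    have S2: "?S (3, 1) (3, 2)"
      by (rule share_pair0I[of "2 * int j" 0 _ "-1" 1]) (simp_all add: blkB_def Suc1 z1)
    have S3: "?S (3, 2) (3, 3)"
      by (rule share_pair0I[of 0 3 _ "-1" 1]) (simp_all add: blkB_def Suc1 z1)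
    have S4: "?S (3, 3) (3, 4)"
      by (rule share_pair0I[of 0 3 _ "2 * int j" 2]) (simp_all add: blkB_def Suc1 z1)
    have S5: "?S (3, 4) (3, 5)"
      by (rule share_pair0I[of "2 * int j" 2 _ 0 0]) (simp_all add: blkB_def Suc1 z1)
    have S': "share_pair ?m 0 (blkB j (3, 5)) (blkB j (1, 4 * j - 2))"
      by (rule share_pairI[of "-1" 0 _ "2 * int j" 2 "-1" _ "-1 - 2 * int j"])
        (simp_all add: blkB_def Suc1 z1)
    have S'': "share_pair ?m 0 (blkB j (1, 0)) (blkB j (3, 6))"
      by (rule share_pairI[of "-1" 2 _ "-2" 2 "-1" _ "-2"]) (use j in \<open>simp_all add: blkB_def\<close>)
    have S6: "?S (3, 6) (2, 4 * j - 2)"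
      by (rule share_pair0I[of "-2" 2 _ "-2 - 2 * int j" 1]) (simp_all add: blkB_def Suc1 z1)
    have ne: "[0..<4 * j - 1] \<noteq> []" "last [0..<4 * j - 1] = 4 * j - 2" "hd [0..<4 * j - 1] = 0"
      using j by auto
    show ?thesis
      unfolding tagsB_def
      using L0 L1 L2 S0 S1 S2 S3 S4 S5 S' S'' S6 ne
      by (simp add: successively_append_iff successively_Cons hd_append hd_map last_map hd_rev last_rev)
  qed
  show "share_pair ?m (-2) (blkB j (last (tagsB j))) (blkB j (hd (tagsB j)))"
  proof -
    have "[0..<4 * j - 1] \<noteq> []" "hd [0..<4 * j - 1] = 0"
      using j by auto
    then have "last (tagsB j) = (2, 0)" "hd (tagsB j) = (3, 0)"
      by (simp_all add: tagsB_def last_map last_rev)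
    moreover have "share_pair ?m (-2) (blkB j (2, 0)) (blkB j (3, 0))"
      by (rule share_pairI[of "-2" 2 _ "-2" 1 0 _ 0]) (simp_all add: blkB_def)
    ultimately show ?thesis by simp
  qed
  have pick: "\<exists>t\<in>?T. \<exists>t'\<in>?T. t \<noteq> t' \<and> P t \<and> P t'"
    if "P x" "P y" "x \<noteq> y" "x \<in> ?T" "y \<in> ?T" for P x y
    using that by blast
  show "\<exists>t\<in>?T. has_diff ?m i i d (blkB j t) \<and> (2 * d = ?m \<or>
     (\<exists>t'\<in>?T. t \<noteq> t' \<and> has_diff ?m i i d (blkB j t')))"
    if id: "i < 3" "0 < d" "2 * d \<le> ?m" for i d
  proof -
    \<comment> \<open>The level that carries the zigzag values of fan \<open>c\<close>; the apex
      lies on another one.\<close>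
    define lev :: "nat \<Rightarrow> nat" where "lev c = (if c = 0 then 0 else if c = 1 then 2 else 1)" for c
    have low: "has_diff ?m (lev c) (lev c) d (blkB j (c, t))"
      if c: "c \<in> {0, 1, 2}" and t: "int (Suc t) = d \<or> int (Suc t) = ?m - d" for c t
    proof -
      have abs: "\<bar>zigzag (Suc t) - zigzag t\<bar> = d \<or> \<bar>zigzag (Suc t) - zigzag t\<bar> = ?m - d"
        using t zigzag_diff[of t] by auto
      consider "c = 0" | "c = 1" | "c = 2" using c by auto
      then show ?thesis
      proof cases
        case 1
        show ?thesis by (rule has_diff_pureI[of "zigzag t" _ _ "zigzag (Suc t)"])
          (use 1 abs in \<open>auto simp: blkB_def lev_def\<close>)
      next
        case 2
        show ?thesis by (rule has_diff_pureI[of "-1 - zigzag (Suc t)" _ _ "-1 - zigzag t"])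
          (use 2 abs in \<open>auto simp: blkB_def lev_def\<close>)
      next
        case 3
        show ?thesis by (rule has_diff_pureI[of "-2 - zigzag (Suc t)" _ _ "-2 - zigzag t"])
          (use 3 abs in \<open>auto simp: blkB_def lev_def\<close>)
      qed
    qed
    obtain c where c: "c \<in> {0, 1, 2}" "lev c = i"
    proof -
      have "lev 0 = 0" "lev 1 = 2" "lev 2 = 1" by (auto simp: lev_def)
      moreover have "i = 0 \<or> i = 1 \<or> i = 2" using id by auto
      ultimately show thesis using that[of 0] that[of 1] that[of 2] by auto
    qed
    have "\<exists>t\<in>?T. \<exists>t'\<in>?T. t \<noteq> t' \<and> has_diff ?m i i d (blkB j t) \<and>
      has_diff ?m i i d (blkB j t')"
    \<comment> \<open>The step length \<open>4 j\<close> would give the difference 1 a second time,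
      but the fans stop at \<open>4 j - 1\<close>. One special block on each level replaces
      it.\<close>
    proof (cases "d = 1")
      case True
      have "has_diff ?m 0 0 1 (blkB j (3, 5))"
        by (rule has_diff_pureI[of 0 _ _ "-1"]) (auto simp: blkB_def)
      moreover have "has_diff ?m 1 1 1 (blkB j (3, 1))"
        by (rule has_diff_pureI[of 0 _ _ "-1"]) (auto simp: blkB_def)
      moreover have "has_diff ?m 2 2 1 (blkB j (3, 6))"
        by (rule has_diff_pureI[of "-2" _ _ "-1"]) (auto simp: blkB_def)
      moreover have "i = 0 \<or> i = 1 \<or> i = 2" using id by auto
      moreover define s :: nat where "s = (if i = 0 then 5 else if i = 1 then 1 else 6)"
      ultimately have s: "s < 7" "?D i i d (3, s)"
        using True by (auto simp: s_def)
      show ?thesis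
        by (rule pick[of _ "(c, 0)" "(3, s)"]) (use s c low[of c 0] True j in \<open>auto simp: mem\<close>)
    next
      case False
      have d: "d = int (nat d)" "2 \<le> nat d" "nat d \<le> 2 * j" using False id by auto
      have "?D i i d (c, nat d - 1)" "?D i i d (c, 4 * j - nat d)"
        using low[of c "nat d - 1"] low[of c "4 * j - nat d"] c d by auto
      then show ?thesis
        by (rule pick[of _ "(c, nat d - 1)" "(c, 4 * j - nat d)"]) (use c d in \<open>auto simp: mem\<close>)
    qed
    then show ?thesis by blast
  qed
  show "\<exists>t\<in>?T. \<exists>t'\<in>?T. t \<noteq> t' \<and> ?D i k d t \<and> ?D i k d t'"
    if ik: "(i, k) \<in> {(0, 1), (1, 2), (2, 0)}" for i k d
  proof -
    have surj: "\<exists>t\<le>4 * j. ?m dvd (zigzag t - d)" for d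
      using zigzag_surj[of "4 * j + 1" d] by (simp add: less_Suc_eq_le algebra_simps)
    \<comment> \<open>The first and the last value of a fan occur in one of its blocks, the inner
      values in two, and the value with index \<open>4 j\<close> in none.\<close>
    have cases: "t = 0 \<or> (\<exists>u. t = Suc u \<and> u < 4 * j - 2) \<or> t = 4 * j - 1 \<or> t = 4 * j" if "t \<le> 4 * j" for t
      using that by (cases t) auto
    from ik consider "i = 0" "k = 1" | "i = 1" "k = 2" | "i = 2" "k = 0" by auto
    then show ?thesis
    proof cases
      case 1
      \<comment> \<open>Here the apex is the end point of the difference and lies at 0, so the
        difference is minus the zigzag value.\<close>
      obtain t where t: "t \<le> 4 * j" "?m dvd (zigzag t - (- d))" using surj by blast
      have e: "?m dvd (- zigzag t - d)" 
        using iffD2[OF dvd_minus_iff t(2)] by simp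
      note D = has_diffI[OF _ _ e]
      consider "t = 0" | u where "t = Suc u" "u < 4 * j - 2" | "t = 4 * j - 1" | "t = 4 * j"
        using cases[OF t(1)] by blast
      then show ?thesis
      proof cases
        case 1
        then show ?thesis using j
          by (intro pick[of _ "(3, 0)" "(0, 0)"] D[of 0 _ _ 0]) (auto simp: mem blkB_def \<open>i = 0\<close> \<open>k = 1\<close>)
      next
        case 2
        then show ?thesis
          by (intro pick[of _ "(0, u)" "(0, Suc u)"] D[of "zigzag t" _ _ 0]) (auto simp: mem blkB_def \<open>i = 0\<close> \<open>k = 1\<close>)
      next
        case 3
        then show ?thesis using j
          by (intro pick[of _ "(0, 4 * j - 2)" "(3, 1)"] D[of "2 * int j" _ _ 0])
            (auto simp: mem blkB_def \<open>i = 0\<close> \<open>k = 1\<close> Suc1 z1)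
      next
        case 4
        then show ?thesis
          by (intro pick[of _ "(3, 1)" "(3, 2)"] D[of "2 * int j" _ _ "-1"])
            (auto simp: mem blkB_def \<open>i = 0\<close> \<open>k = 1\<close> z2)
      qed
    next
      case 2
      obtain t where t: "t \<le> 4 * j" and e: "?m dvd (zigzag t - d)" using surj by blast
      note D = has_diffI[OF _ _ e]
      consider "t = 0" | u where "t = Suc u" "u < 4 * j - 2" | "t = 4 * j - 1" | "t = 4 * j"
        using cases[OF t] by blast
      then show ?thesis
      proof cases
        case 1
        have "?D i k d (3, 0)"
          by (rule D[of 0 _ _ 0]) (use 1 2 in \<open>auto simp: blkB_def\<close>)
        moreover have "?D i k d (2, 0)"
          by (rule D[of "-2" _ _ "-2"]) (use 1 2 in \<open>auto simp: blkB_def\<close>)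
        ultimately show ?thesis using j
          by (intro pick[of _ "(3, 0)" "(2, 0)"]) (auto simp: mem)
      next
        case (2 u)
        then show ?thesis
          by (intro pick[of _ "(2, u)" "(2, Suc u)"] D[of "-2 - zigzag t" _ _ "-2"]) (auto simp: mem blkB_def \<open>i = 1\<close> \<open>k = 2\<close>)
      next
        case 3
        then show ?thesis using j
          by (intro pick[of _ "(2, 4 * j - 2)" "(3, 6)"] D[of "-2 - 2 * int j" _ _ "-2"])
            (auto simp: mem blkB_def \<open>i = 1\<close> \<open>k = 2\<close> Suc1 z1)
      next
        case 4
        have "?D i k d (3, 6)"
          by (rule D[of "-2 - 2 * int j" _ _ "-1"]) (use 4 2 in \<open>auto simp: blkB_def z2\<close>)
        moreover have "?D i k d (3, 3)"
          by (rule D[of "-1" _ _ "2 * int j"]) (use 4 2 in \<open>auto simp: blkB_def z2\<close>)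
        ultimately show ?thesis
          by (intro pick[of _ "(3, 6)" "(3, 3)"]) (auto simp: mem)
      qed
    next
      case 3
      obtain t where t: "t \<le> 4 * j" and e: "?m dvd (zigzag t - d)" using surj by blast
      note D = has_diffI[OF _ _ e]
      consider "t = 0" | u where "t = Suc u" "u < 4 * j - 2" | "t = 4 * j - 1" | "t = 4 * j"
        using cases[OF t] by blast
      then show ?thesis
      proof cases
        case 1
        have "?D i k d (3, 0)"
          by (rule D[of 0 _ _ 0]) (use 1 3 in \<open>auto simp: blkB_def\<close>)
        moreover have "?D i k d (1, 0)"
          by (rule D[of "-1" _ _ "-1"]) (use 1 3 in \<open>auto simp: blkB_def\<close>)
        ultimately show ?thesis using j
          by (intro pick[of _ "(3, 0)" "(1, 0)"]) (auto simp: mem)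
      next
        case (2 u)
        then show ?thesis
          by (intro pick[of _ "(1, u)" "(1, Suc u)"] D[of "-1 - zigzag t" _ _ "-1"]) (auto simp: mem blkB_def \<open>i = 2\<close> \<open>k = 0\<close>)
      next
        case 3
        have "?D i k d (1, 4 * j - 2)"
          by (rule D[of "-1 - 2 * int j" _ _ "-1"]) (use 3 \<open>i = 2\<close> \<open>k = 0\<close> in \<open>auto simp: blkB_def z1 Suc1\<close>)
        moreover have "?D i k d (3, 5)"
          by (rule D[of "2 * int j" _ _ "-1"]) (use 3 \<open>i = 2\<close> \<open>k = 0\<close> in \<open>auto simp: blkB_def z1\<close>)
        ultimately show ?thesis using j
          by (intro pick[of _ "(1, 4 * j - 2)" "(3, 5)"]) (auto simp: mem)
      next
        case 4
        then show ?thesis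
          by (intro pick[of _ "(3, 5)" "(3, 4)"] D[of "2 * int j" _ _ 0])
            (auto simp: mem blkB_def \<open>i = 2\<close> \<open>k = 0\<close> z2)
      qed
    qed
  qed
  show "\<exists>t\<in>?T. \<exists>t'\<in>?T. t \<noteq> t' \<and> {3, i} \<subseteq> snd ` blkB j t \<and> {3, i} \<subseteq> snd ` blkB j t'"
    if "i < 3" for i
  proof -
    from that consider "i = 0" | "i = 1" | "i = 2" by linarith
    then show ?thesis
    proof cases
      case 1
      show ?thesis by (rule pick[of _ "(3, 2)" "(3, 4)"]) (use 1 in \<open>auto simp: mem blkB_def\<close>)
    next
      case 2
      show ?thesis by (rule pick[of _ "(3, 2)" "(3, 3)"]) (use 2 in \<open>auto simp: mem blkB_def\<close>)
    next
      case 3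
      show ?thesis by (rule pick[of _ "(3, 3)" "(3, 4)"]) (use 3 in \<open>auto simp: mem blkB_def\<close>)
    qed
  qed
qed

section \<open>The orders 4 and 12\<close>

text \<open>The blocks are all four triples; two of them miss one point each and share the other
  two.\<close>

lemma gray_system_4: "gray_system 4 2"
proof (rule twofold_gray_systemI[where V = "{0, 1, 2, 3 :: nat}" and f = "\<lambda>i. {0, 1, 2, 3} - {i}" and N = 4])
  have less4: "i < 4 \<longleftrightarrow> i = 0 \<or> i = 1 \<or> i = 2 \<or> i = 3" for i :: nat by arith
  show "2 \<le> card (({0, 1, 2, 3 :: nat} - {i}) \<inter> ({0, 1, 2, 3} - {Suc i mod 4}))" if "i < 4" for i
    using that unfolding less4 by (elim disjE) (simp_all add: insert_Diff_if)
  show "\<exists>i<4. \<exists>j<4. i \<noteq> j \<and> {x, y} \<subseteq> {0, 1, 2, 3} - {i} \<and> {x, y} \<subseteq> {0, 1, 2, 3} - {j}"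
    if xy: "x \<in> {0, 1, 2, 3 :: nat}" "y \<in> {0, 1, 2, 3}" "x \<noteq> y" for x y
  proof -
    have "card ({0, 1, 2, 3} - {x, y}) = 2" using xy by auto
    then obtain i j where "i \<noteq> j" "{0, 1, 2, 3} - {x, y} = {i, j}" by (meson card_2_iff)
    then have "i \<noteq> j" "i \<in> {0, 1, 2, 3} - {x, y}" "j \<in> {0, 1, 2, 3} - {x, y}" by auto
    with xy show ?thesis unfolding less4 by (intro exI[of _ i] conjI exI[of _ j]) auto
  qed
  show "{0, 1, 2, 3} - {i} \<subseteq> {0, 1, 2, 3 :: nat} \<and> card ({0, 1, 2, 3 :: nat} - {i}) \<le> 3" if "i < 4" for i
    using that unfolding less4 by (elim disjE) (simp_all add: insert_Diff_if)
qed auto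

text \<open>Found by computer search.\<close>

definition blk12 :: "nat \<Rightarrow> (int \<times> nat) set" where
  "blk12 t = [{(0, 0), (2, 0), (0, 1)}, {(1, 0), (2, 0), (0, 1)}, {(1, 0), (2, 0), (0, 2)},
     {(1, 0), (0, 2), (1, 2)}, {(0, 0), (0, 2), (1, 2)}, {(0, 0), (3, 1), (1, 2)},
     {(3, 1), (1, 2), (3, 2)}, {(0, 1), (3, 1), (3, 2)}, {(0, 1), (2, 1), (3, 2)},
     {(1, 0), (2, 1), (3, 2)}, {(1, 0), (1, 1), (2, 1)}] ! t"

text \<open>Order 12 is treated on its own since \<open>gray_system_A\<close> needs
  \<open>2 \<le> j\<close>; below that its fan over \<open>rosa\<close> would be empty.\<close>

lemma gray_system_12: "gray_system 12 2"
proof (rule shifted_gray_systemI[where m = 4 and ts = "[0..<11]" and blk = blk12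
      and fixpt = False and g = 1])
  have less11: "{..<11::nat} = {0, 1, 2, 3, 4, 5, 6, 7, 8, 9, 10}" by (simp add: lessThan_nat_numeral lessThan_Suc) auto
  have set11: "set [0..<11] = {..<11::nat}" by auto
  show "finite (blk12 t) \<and> card (blk12 t) \<le> 3 \<and> snd ` blk12 t \<subseteq> {..<3} \<union> (if False then {3} else {})"
    if "t \<in> set [0..<11]" for t
    using that unfolding set11 less11 by (elim insertE emptyE) (simp_all add: blk12_def)
  show "successively (\<lambda>t t'. share_pair 4 0 (blk12 t) (blk12 t')) [0..<11]"
  proof -
    have S0: "share_pair 4 0 (blk12 0) (blk12 1)"
      by (rule share_pairI[of 2 0 _ 0 1 2 _ 0]) (simp_all add: blk12_def)
    have S1: "share_pair 4 0 (blk12 1) (blk12 2)"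
      by (rule share_pairI[of 1 0 _ 2 0 1 _ 2]) (simp_all add: blk12_def)
    have S2: "share_pair 4 0 (blk12 2) (blk12 3)"
      by (rule share_pairI[of 1 0 _ 0 2 1 _ 0]) (simp_all add: blk12_def)
    have S3: "share_pair 4 0 (blk12 3) (blk12 4)"
      by (rule share_pairI[of 0 2 _ 1 2 0 _ 1]) (simp_all add: blk12_def)
    have S4: "share_pair 4 0 (blk12 4) (blk12 5)"
      by (rule share_pairI[of 0 0 _ 1 2 0 _ 1]) (simp_all add: blk12_def)
    have S5: "share_pair 4 0 (blk12 5) (blk12 6)"
      by (rule share_pairI[of 3 1 _ 1 2 3 _ 1]) (simp_all add: blk12_def)
    have S6: "share_pair 4 0 (blk12 6) (blk12 7)"
      by (rule share_pairI[of 3 1 _ 3 2 3 _ 3]) (simp_all add: blk12_def)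
    have S7: "share_pair 4 0 (blk12 7) (blk12 8)"
      by (rule share_pairI[of 0 1 _ 3 2 0 _ 3]) (simp_all add: blk12_def)
    have S8: "share_pair 4 0 (blk12 8) (blk12 9)"
      by (rule share_pairI[of 2 1 _ 3 2 2 _ 3]) (simp_all add: blk12_def)
    have S9: "share_pair 4 0 (blk12 9) (blk12 10)"
      by (rule share_pairI[of 1 0 _ 2 1 1 _ 2]) (simp_all add: blk12_def)
    have "[0..<11] = [0, 1, 2, 3, 4, 5, 6, 7, 8, 9, 10 :: nat]" by (simp add: upt_rec)
    with S0 S1 S2 S3 S4 S5 S6 S7 S8 S9 show ?thesis by (simp add: successively_Cons)
  qed
  show "share_pair 4 1 (blk12 (last [0..<11])) (blk12 (hd [0..<11]))"
  proof -
    have "share_pair 4 1 (blk12 10) (blk12 0)"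
      by (rule share_pairI[of 1 0 _ 1 1 0 _ 0]) (simp_all add: blk12_def)
    moreover have "last [0..<11] = (10::nat)" "hd [0..<11] = (0::nat)" by (simp_all add: upt_rec)
    ultimately show ?thesis by simp
  qed
  note hd = has_diff_def blk12_def ex_disj_distrib conj_disj_distribL conj_disj_distribR
  have pick: "\<exists>t\<in>set [0..<11]. \<exists>t'\<in>set [0..<11]. t \<noteq> t' \<and> P t \<and> P t'"
    if "P x" "P y" "x \<noteq> y" "x < 11" "y < 11" for P and x y :: nat
    using that by (intro bexI[of _ x] bexI[of _ y]) auto
  show "\<exists>t\<in>set [0..<11]. has_diff 4 i i d (blk12 t) \<and> (2 * d = 4 \<or>
     (\<exists>t'\<in>set [0..<11]. t \<noteq> t' \<and> has_diff 4 i i d (blk12 t')))"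
    if "i < 3" "0 < d" "2 * d \<le> 4" for i and d :: int
  proof -
    have P0: "has_diff 4 0 0 1 (blk12 1)" "has_diff 4 0 0 1 (blk12 2)" by (simp_all add: hd)
    have Q0: "\<exists>t\<in>set [0..<11]. has_diff 4 0 0 2 (blk12 t)"
      by (rule bexI[of _ 0]) (simp_all add: hd)
    have P1: "has_diff 4 1 1 1 (blk12 7)" "has_diff 4 1 1 1 (blk12 10)" by (simp_all add: hd)
    have Q1: "\<exists>t\<in>set [0..<11]. has_diff 4 1 1 2 (blk12 t)"
      by (rule bexI[of _ 8]) (simp_all add: hd)
    have P2: "has_diff 4 2 2 1 (blk12 3)" "has_diff 4 2 2 1 (blk12 4)" by (simp_all add: hd)
    have Q2: "\<exists>t\<in>set [0..<11]. has_diff 4 2 2 2 (blk12 t)"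
      by (rule bexI[of _ 6]) (simp_all add: hd)
    from that have "i = 0 \<or> i = 1 \<or> i = 2" "d = 1 \<or> d = 2" by auto
    then show ?thesis using pick[OF P0] pick[OF P1] pick[OF P2] Q0 Q1 Q2 by auto
  qed
  show "\<exists>t\<in>set [0..<11]. \<exists>t'\<in>set [0..<11]. t \<noteq> t' \<and> has_diff 4 i k d (blk12 t) \<and> has_diff 4 i k d (blk12 t')"
    if "(i, k) \<in> {(0, 1), (1, 2), (2, 0)}" "0 \<le> d" "d < 4" for i k and d :: int
  proof -
    have M0: "has_diff 4 0 1 0 (blk12 0)" "has_diff 4 0 1 0 (blk12 10)" by (simp_all add: hd)
    have M1: "has_diff 4 0 1 1 (blk12 9)" "has_diff 4 0 1 1 (blk12 10)" by (simp_all add: hd)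
    have M2: "has_diff 4 0 1 2 (blk12 0)" "has_diff 4 0 1 2 (blk12 1)" by (simp_all add: hd)
    have M3: "has_diff 4 0 1 3 (blk12 1)" "has_diff 4 0 1 3 (blk12 5)" by (simp_all add: hd)
    have M4: "has_diff 4 1 2 0 (blk12 6)" "has_diff 4 1 2 0 (blk12 7)" by (simp_all add: hd)
    have M5: "has_diff 4 1 2 1 (blk12 8)" "has_diff 4 1 2 1 (blk12 9)" by (simp_all add: hd)
    have M6: "has_diff 4 1 2 2 (blk12 5)" "has_diff 4 1 2 2 (blk12 6)" by (simp_all add: hd)
    have M7: "has_diff 4 1 2 3 (blk12 7)" "has_diff 4 1 2 3 (blk12 8)" by (simp_all add: hd)
    have M8: "has_diff 4 2 0 0 (blk12 3)" "has_diff 4 2 0 0 (blk12 4)" by (simp_all add: hd)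
    have M9: "has_diff 4 2 0 1 (blk12 2)" "has_diff 4 2 0 1 (blk12 3)" by (simp_all add: hd)
    have M10: "has_diff 4 2 0 2 (blk12 2)" "has_diff 4 2 0 2 (blk12 9)" by (simp_all add: hd)
    have M11: "has_diff 4 2 0 3 (blk12 4)" "has_diff 4 2 0 3 (blk12 5)" by (simp_all add: hd)
    from that have "d = 0 \<or> d = 1 \<or> d = 2 \<or> d = 3" by auto
    with that show ?thesis
      using pick[OF M0] pick[OF M1] pick[OF M2] pick[OF M3] pick[OF M4] pick[OF M5] pick[OF M6] pick[OF M7] pick[OF M8] pick[OF M9] pick[OF M10] pick[OF M11]
      by auto
  qed
qed (auto simp: upt_rec)

section \<open>Twofold systems on \<open>12 j\<close> points\<close>

text \<open>Up to a reflection, the graceful labelling of the cycle of length \<open>4j - 1\<close> by Rosa, which omits the label \<open>j\<close>.\<close>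

definition rosa :: "nat \<Rightarrow> nat \<Rightarrow> int" where
  "rosa j i = (if even i then int (i div 2) - 2 * int j
     else if i < 2 * j then 2 * int j - int (i div 2) else 2 * int j - int (i div 2) - 1)"

text \<open>The step lengths decrease from \<open>4 j\<close> and skip \<open>2 j\<close>; a special
  block has to supply that difference.\<close>

lemma rosa_diff:
  assumes "0 < j"
  shows "\<bar>rosa j (Suc i) - rosa j i\<bar> = \<bar>if i < 2 * j then 4 * int j - int i else 4 * int j - int i - 1\<bar>"
proof (cases "even i")
  case True
  then obtain k where "i = 2 * k" by (elim evenE)
  then show ?thesis by (auto simp: rosa_def)
next
  case False
  then obtain k where "i = Suc (2 * k)" by (elim oddE) simp
  then show ?thesis by (auto simp: rosa_def)
qed

text \<open>The labels with indices \<open>1\<close> to \<open>4 j - 1\<close> represent all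
  residues except \<open>j\<close>. With the apex of the fan at \<open>(j, 0)\<close>, the one mixed
  difference out of reach is 0, and two special blocks have it.\<close>

lemma rosa_surj:
  assumes j: "0 < j"
  shows "4 * int j dvd d \<or> (\<exists>i\<in>{1..<4 * j}. 4 * int j dvd (int j - rosa j i - d))"
proof -
  define e where "e = (d + int j) mod (4 * int j)"
  have e: "0 \<le> e" "e < 4 * int j" "4 * int j dvd (e - (d + int j))"
    using j by (auto simp: e_def mod_eq_dvd_iff[symmetric])
  obtain k where k: "e = int k" using e(1) by (metis nonneg_int_cases)
  have *: ?thesis if "i \<in> {1..<4 * j}" "int j - rosa j i = e - int j \<or> int j - rosa j i = e - int j - 4 * int j" for i
  proof -
    have "4 * int j dvd (e - (d + int j) - 4 * int j)" using e(3) by (metis dvd_diff dvd_refl)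
    moreover have "int j - rosa j i - d = e - (d + int j) \<or>
        int j - rosa j i - d = e - (d + int j) - 4 * int j" using that(2) by linarith
    ultimately have "4 * int j dvd (int j - rosa j i - d)" using e(3) by metis
    then show ?thesis using that(1) by blast
  qed
  \<comment> \<open>The wanted label is \<open>2 j - k\<close>. Labels from 0 on stand at odd
    indices, with a shift at the omitted label \<open>j\<close>, and negative ones at even
    indices.\<close>
  consider "k = j" | "k < j" | "j < k" "k \<le> 2 * j" | "2 * j < k" by linarith
  then show ?thesis
  proof cases
    case 1
    then show ?thesis using e k by simp
  next
    case 2
    then show ?thesis by (intro *[of "Suc (2 * k)"]) (auto simp: rosa_def k)
  next
    case 3
    then obtain l where "k = Suc l" by (cases k) auto
    with 3 show ?thesis by (intro *[of "Suc (2 * l)"]) (auto simp: rosa_def k)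
  next
    case 4
    have "k < 4 * j" using e k by simp
    then show ?thesis using 4
      by (intro *[of "2 * (4 * j - k)"]) (auto simp: rosa_def k of_nat_diff)
  qed
qed

text \<open>The zigzag fans have step lengths \<open>1, ..., 4 j - 3\<close>: modulo
  \<open>4 j\<close> and up to sign, the differences 1 and 2 occur once, \<open>2 j\<close> once,
  which is enough for it, and the others twice. The fan over \<open>rosa\<close> on level 2 has the
  lengths from \<open>4 j - 2\<close> down to 3 without \<open>2 j\<close>. So the special blocks
  contribute the differences 1 and 2 on levels 0 and 1, and on level 2 the difference 1 twice and 2
  and \<open>2 j\<close> once each.\<close>

definition blkA :: "nat \<Rightarrow> nat \<times> nat \<Rightarrow> (int \<times> nat) set" where
  "blkA k ct = (let j = int k; t = snd ct in
     if fst ct = 0 then {(0, 1), (- zigzag t, 0), (- zigzag (Suc t), 0)}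
     else if fst ct = 1 then {(j, 0), (rosa k (Suc t), 2), (rosa k t, 2)}
     else if fst ct = 2 then {(2 * j - 1, 2), (2 * j - 1 - zigzag (Suc t), 1), (2 * j - 1 - zigzag t, 1)}
     else [{(0, 0), (0, 1), (0, 2)}, {(1 - 2 * j, 0), (0, 1), (2, 1)}, {(1 - 2 * j, 0), (2, 1), (1, 1)},
       {(1 - 2 * j, 0), (1, 1), (1 - 2 * j, 2)}, {(1, 1), (1 - 2 * j, 2), (2 - 2 * j, 2)},
       {(1 + j, 0), (1 - 2 * j, 2), (2 - 2 * j, 2)}, {(1 + j, 0), (1 - 2 * j, 2), (1, 2)},
       {(1, 2), (1 + j, 0), (2 + j, 0)}, {(1, 2), (2 + j, 0), (j, 0)},
       {(0, 1), (2 * j - 1, 2), (2 * j + 1, 2)}] ! t)"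

text \<open>The fan over \<open>rosa\<close> begins at index 2: step 0 has length
  \<open>4 j\<close>, so its end points coincide modulo \<open>4 j\<close>, and step 1 has the
  difference 1, which the special blocks 4 and 5 supply twice already.\<close>

definition tagsA :: "nat \<Rightarrow> (nat \<times> nat) list" where
  "tagsA j = [(3, 0)] @ map (Pair 0) [0..<4 * j - 3] @
     [(3, 1), (3, 2), (3, 3), (3, 4), (3, 5), (3, 6), (3, 7), (3, 8)] @
     map (Pair 1) (rev [2..<4 * j - 3]) @ [(3, 9)] @ map (Pair 2) (rev [0..<4 * j - 3])"

lemma gray_system_A:
  assumes j: "2 \<le> j"
  shows "gray_system (12 * j) 2"
proof (rule shifted_gray_systemI[where m = "4 * int j" and ts = "tagsA j" and blk = "blkA j"
      and fixpt = False and g = "2 * int j - 1"])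
  let ?m = "4 * int j"
  let ?S = "\<lambda>t t'. share_pair ?m 0 (blkA j t) (blkA j t')" and ?D = "\<lambda>i k d t. has_diff ?m i k d (blkA j t)"
  let ?T = "set (tagsA j)"
  note bl = blkA_def Let_def
  have len: "length (tagsA j) = 12 * j - 1" using j by (simp add: tagsA_def)
  have nm: "nat ?m = 4 * j" by simp
  obtain J where J: "j = Suc (Suc J)" using j by (metis add_2_eq_Suc le_Suc_ex)
  have z3: "zigzag (4 * j - 3) = 2 * int j - 1"
  proof -
    have eq: "4 * j - 3 = 2 * (2 * j - 1) - 1" using j by arith
    show ?thesis unfolding eq zigzag_double using j by (simp add: zigzag_double(2)[OF zero_less_diff[THEN iffD2]] of_nat_diff del: One_nat_def)
  qed
  have z2: "zigzag (4 * j - 2) = 1 - 2 * int j"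
  proof -
    have eq: "4 * j - 2 = 2 * (2 * j - 1)" using j by arith
    show ?thesis unfolding eq zigzag_double using j by (simp add: zigzag_double(2)[OF zero_less_diff[THEN iffD2]] of_nat_diff del: One_nat_def)
  qed
  have z1: "zigzag (4 * j - 1) = 2 * int j"
    using zigzag_double(2)[of "2 * j"] j by simp
  have Suc3: "Suc (4 * j - 4) = 4 * j - 3" using j by simp
  have r: "rosa j 2 = 1 - 2 * int j" "rosa j 3 = 2 * int j - 1" "rosa j (4 * j - 3) = 1"
    using j unfolding J by (auto simp: rosa_def)
  have r': "rosa j (Suc 2) = 2 * int j - 1" "rosa j (Suc (Suc (Suc 0))) = 2 * int j - 1" "rosa j (Suc (Suc 0)) = 1 - 2 * int j"
    using r by (simp_all add: numeral_eq_Suc)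
  have less10: "t < 10 \<longleftrightarrow> t \<in> {0, 1, 2, 3, 4, 5, 6, 7, 8, 9}" for t :: nat
  proof -
    have "{..<10::nat} = {0, 1, 2, 3, 4, 5, 6, 7, 8, 9}"
      by (simp add: lessThan_nat_numeral lessThan_Suc) auto
    moreover have "t < 10 \<longleftrightarrow> t \<in> {..<10}" by simp
    ultimately show ?thesis by simp
  qed
  have mem: "(c, t) \<in> ?T \<longleftrightarrow>
      c \<in> {0, 2} \<and> t < 4 * j - 3 \<or> c = 1 \<and> 2 \<le> t \<and> t < 4 * j - 3 \<or> c = 3 \<and> t < 10" for c t
  proof (cases "c = 3")
    case True
    then show ?thesis unfolding tagsA_def by (simp add: mem_Pair_image less10)
  next
    case False
    then show ?thesis unfolding tagsA_def by (simp add: mem_Pair_image) blast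
  qed
  show "0 < ?m" using j by simp
  show "distinct (tagsA j)"
    unfolding tagsA_def by (simp add: distinct_map inj_on_Pair disjoint_iff mem_Pair_image)
  \<comment> \<open>The generator is the position of the apex of fan 2: the last block contains
    \<open>(2 j - 1, 2)\<close> and \<open>(2 j - 1, 1)\<close>, a pair of the translated first
    block.\<close>
  show "coprime (2 * int j - 1) ?m"
  proof (rule coprimeI)
    fix c assume c: "c dvd 2 * int j - 1" "c dvd ?m"
    have "c dvd (2 * int j - 1) * (2 * int j - 1) - ?m * (int j - 1)"
      by (rule dvd_diff[OF dvd_mult2[OF c(1)] dvd_mult2[OF c(2)]])
    also have "(2 * int j - 1) * (2 * int j - 1) - ?m * (int j - 1) = 1" by (simp add: algebra_simps)
    finally show "is_unit c" .
  qed
  show "3 \<le> nat ?m * length (tagsA j)"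
    unfolding len nm using mult_le_mono[of 1 "4 * j" 3 "12 * j - 1"] j by simp
  show "12 * j = 3 * nat ?m + of_bool False" by simp
  show "3 * (nat ?m * length (tagsA j)) = 12 * j * (12 * j - 1)"
    unfolding len nm by simp
  show "finite (blkA j ct) \<and> card (blkA j ct) \<le> 3 \<and> snd ` blkA j ct \<subseteq> {..<3} \<union> (if False then {3} else {})"
    if "ct \<in> ?T" for ct
  proof -
    have card: "card {a, b} \<le> 2" "card {a, b, c} \<le> 3" for a b c :: "int \<times> nat"
      by (simp_all add: card_insert_if)
    obtain c t where ct: "ct = (c, t)" by force
    have "c \<in> {0, 1, 2} \<or> c = 3 \<and> t \<in> {0, 1, 2, 3, 4, 5, 6, 7, 8, 9}"
      using that unfolding ct mem by (simp add: less10) blast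
    then show ?thesis unfolding ct bl
      by (elim disjE conjE insertE emptyE) (simp_all add: card)
  qed
  show "successively ?S (tagsA j)"
  proof -
    have L0: "successively ?S (map (Pair 0) [0..<4 * j - 3])"
    proof (rule successively_map_upt)
      show "?S (0, t) (0, Suc t)" for t
        by (rule share_pair0I[of 0 1 _ "- zigzag (Suc t)" 0]) (auto simp: bl)
    qed
    have L1: "successively ?S (map (Pair 1) (rev [2..<4 * j - 3]))"
    proof (rule successively_map_rev_upt)
      show "?S (1, Suc t) (1, t)" for t
        by (rule share_pair0I[of "int j" 0 _ "rosa j (Suc t)" 2]) (auto simp: bl)
    qed
    have L2: "successively ?S (map (Pair 2) (rev [0..<4 * j - 3]))"
    proof (rule successively_map_rev_upt)
      show "?S (2, Suc t) (2, t)" for t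
        by (rule share_pair0I[of "2 * int j - 1" 2 _ "2 * int j - 1 - zigzag (Suc t)" 1]) (auto simp: bl)
    qed
    have S0: "?S (3, 0) (0, 0)"
      by (rule share_pair0I[of 0 0 _ 0 1]) (simp_all add: bl)
    have S1: "?S (0, 4 * j - 4) (3, 1)"
      by (rule share_pair0I[of "1 - 2 * int j" 0 _ 0 1]) (simp_all add: bl Suc3 z3)
    have S2: "?S (3, 1) (3, 2)"
      by (rule share_pair0I[of "1 - 2 * int j" 0 _ 2 1]) (simp_all add: bl)
    have S3: "?S (3, 2) (3, 3)"
      by (rule share_pair0I[of "1 - 2 * int j" 0 _ 1 1]) (simp_all add: bl)
    have S4: "?S (3, 3) (3, 4)"
      by (rule share_pair0I[of 1 1 _ "1 - 2 * int j" 2]) (simp_all add: bl)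
    have S5: "?S (3, 4) (3, 5)"
      by (rule share_pairI[of "1 - 2 * int j" 2 _ "2 - 2 * int j" 2 "1 - 2 * int j" _ "2 - 2 * int j"])
        (use j in \<open>auto simp: bl dest: zdvd_imp_le\<close>)
    have S6: "?S (3, 5) (3, 6)"
      by (rule share_pair0I[of "1 + int j" 0 _ "1 - 2 * int j" 2]) (simp_all add: bl)
    have S7: "?S (3, 6) (3, 7)"
      by (rule share_pair0I[of "1 + int j" 0 _ 1 2]) (simp_all add: bl)
    have S8: "?S (3, 7) (3, 8)"
      by (rule share_pair0I[of "2 + int j" 0 _ 1 2]) (simp_all add: bl)
    have S9: "?S (3, 8) (1, 4 * j - 4)"
      by (rule share_pair0I[of "int j" 0 _ 1 2]) (simp_all add: bl Suc3 r)
    have S10: "?S (1, 2) (3, 9)"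
      by (rule share_pairI[of "2 * int j - 1" 2 _ "1 - 2 * int j" 2 "2 * int j - 1" _ "2 * int j + 1"])
        (use j r r' in \<open>auto simp: bl dest: zdvd_imp_le\<close>)
    have S11: "?S (3, 9) (2, 4 * j - 4)"
      by (rule share_pair0I[of "2 * int j - 1" 2 _ 0 1]) (simp_all add: bl Suc3 z3)
    have ne: "[0..<4 * j - 3] \<noteq> []" "last [0..<4 * j - 3] = 4 * j - 4" "hd [0..<4 * j - 3] = 0"
      "[2..<4 * j - 3] \<noteq> []" "last [2..<4 * j - 3] = 4 * j - 4" "hd [2..<4 * j - 3] = 2"
      using j by auto
    show ?thesis
      unfolding tagsA_def
      using L0 L1 L2 S0 S1 S2 S3 S4 S5 S6 S7 S8 S9 S10 S11 ne
      by (simp add: successively_append_iff successively_Cons hd_append hd_map last_map hd_rev last_rev)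
  qed
  show "share_pair ?m (2 * int j - 1) (blkA j (last (tagsA j))) (blkA j (hd (tagsA j)))"
  proof -
    have "[0..<4 * j - 3] \<noteq> []" "hd [0..<4 * j - 3] = 0"
      using j by auto
    then have "last (tagsA j) = (2, 0)" "hd (tagsA j) = (3, 0)"
      by (simp_all add: tagsA_def last_map last_rev)
    moreover have "share_pair ?m (2 * int j - 1) (blkA j (2, 0)) (blkA j (3, 0))"
      by (rule share_pairI[of "2 * int j - 1" 2 _ "2 * int j - 1" 1 0 _ 0]) (simp_all add: bl)
    ultimately show ?thesis by simp
  qed
  have pick: "\<exists>t\<in>?T. \<exists>t'\<in>?T. t \<noteq> t' \<and> ?D i k d t \<and> ?D i k d t'"
    if "?D i k d x" "?D i k d y" "x \<noteq> y" "x \<in> ?T" "y \<in> ?T" for x y i k d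
    using that by blast
  show "\<exists>t\<in>?T. has_diff ?m i i d (blkA j t) \<and> (2 * d = ?m \<or>
     (\<exists>t'\<in>?T. t \<noteq> t' \<and> has_diff ?m i i d (blkA j t')))"
    if id: "i < 3" "0 < d" "2 * d \<le> ?m" for i d
  proof -
    define n where "n = nat d"
    have n: "d = int n" "0 < n" "n \<le> 2 * j" using id by (auto simp: n_def)
    have zz: "\<bar>zigzag (Suc t) - zigzag t\<bar> = int (Suc t)" for t
      using zigzag_diff[of t] by auto
    have low0: "?D 0 0 d (0, t)" if "int (Suc t) = d \<or> int (Suc t) = ?m - d" for t
      by (rule has_diff_pureI[of "- zigzag t" _ _ "- zigzag (Suc t)"])
        (use that zz[of t] in \<open>auto simp: bl abs_minus_commute\<close>)
    have low1: "?D 1 1 d (2, t)" if "int (Suc t) = d \<or> int (Suc t) = ?m - d" for t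
      by (rule has_diff_pureI[of "2 * int j - 1 - zigzag (Suc t)" _ _ "2 * int j - 1 - zigzag t"])
        (use that zz[of t] in \<open>auto simp: bl\<close>)
    have low2: "?D 2 2 d (1, t)"
      if "\<bar>rosa j (Suc t) - rosa j t\<bar> = d \<or> \<bar>rosa j (Suc t) - rosa j t\<bar> = ?m - d" for t
      by (rule has_diff_pureI[of "rosa j t" _ _ "rosa j (Suc t)"])
        (use that in \<open>auto simp: bl\<close>)
    \<comment> \<open>The difference \<open>2 j\<close> is its own negative, so one block on each
      level is enough.\<close>
    have half: ?thesis if "n = 2 * j"
    proof -
      have "?D 0 0 d (0, n - 1)" "?D 1 1 d (2, n - 1)"
        using low0[of "n - 1"] low1[of "n - 1"] n by auto
      moreover have "?D 2 2 d (3, 6)"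
        by (rule has_diff_pureI[of "1 - 2 * int j" _ _ 1]) (use that n in \<open>auto simp: bl\<close>)
      moreover have "(0, n - 1) \<in> ?T" "(2, n - 1) \<in> ?T" "(3, 6) \<in> ?T"
        using that j by (auto simp: mem)
      moreover have "2 * d = ?m" using that n by simp
      moreover from id have "i = 0 \<or> i = 1 \<or> i = 2" by auto
      ultimately show ?thesis by blast
    qed
    have "\<exists>t\<in>?T. \<exists>t'\<in>?T. t \<noteq> t' \<and> has_diff ?m i i d (blkA j t) \<and>
      has_diff ?m i i d (blkA j t')" if "n < 2 * j"
    proof -
      from id consider "i = 0" | "i = 1" | "i = 2" by linarith
      then show ?thesis
      proof cases
        case 1
        have 0: "?D 0 0 d (0, n - 1)" "(0, n - 1) \<in> ?T"
          using low0[of "n - 1"] n j by (auto simp: mem)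
        \<comment> \<open>The difference \<open>n\<close> comes from the step lengths
          \<open>n\<close> and \<open>4 j - n\<close>; the latter exceeds the last length
          \<open>4 j - 3\<close> if \<open>n\<close> is 1 or 2.\<close>
        consider "n = 1" | "n = 2" | "3 \<le> n" using n by linarith
        then show ?thesis
        proof cases
          case c: 1
          have "?D 0 0 d (3, 7)"
            by (rule has_diff_pureI[of "1 + int j" _ _ "2 + int j"]) (use c n in \<open>auto simp: bl\<close>)
          then show ?thesis using 1 0 by (intro pick[of _ _ _ "(0, n - 1)" "(3, 7)"]) (auto simp: mem)
        next
          case c: 2
          have "?D 0 0 d (3, 8)"
            by (rule has_diff_pureI[of "int j" _ _ "2 + int j"]) (use c n in \<open>auto simp: bl\<close>)
          then show ?thesis using 1 0 by (intro pick[of _ _ _ "(0, n - 1)" "(3, 8)"]) (auto simp: mem)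
        next
          case c: 3
          have "?D 0 0 d (0, 4 * j - n - 1)" "(0, 4 * j - n - 1) \<in> ?T"
            using low0[of "4 * j - n - 1"] n c that by (auto simp: mem of_nat_diff)
          then show ?thesis using 1 0 that c by (intro pick[of _ _ _ "(0, n - 1)" "(0, 4 * j - n - 1)"]) auto
        qed
      next
        case 2
        have 0: "?D 1 1 d (2, n - 1)" "(2, n - 1) \<in> ?T"
          using low1[of "n - 1"] n j by (auto simp: mem)
        consider "n = 1" | "n = 2" | "3 \<le> n" using n by linarith
        then show ?thesis
        proof cases
          case c: 1
          have "?D 1 1 d (3, 2)"
            by (rule has_diff_pureI[of 2 _ _ 1]) (use c n in \<open>auto simp: bl\<close>)
          then show ?thesis using 2 0 by (intro pick[of _ _ _ "(2, n - 1)" "(3, 2)"]) (auto simp: mem)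
        next
          case c: 2
          have "?D 1 1 d (3, 1)"
            by (rule has_diff_pureI[of 0 _ _ 2]) (use c n in \<open>auto simp: bl\<close>)
          then show ?thesis using 2 0 by (intro pick[of _ _ _ "(2, n - 1)" "(3, 1)"]) (auto simp: mem)
        next
          case c: 3
          have "?D 1 1 d (2, 4 * j - n - 1)" "(2, 4 * j - n - 1) \<in> ?T"
            using low1[of "4 * j - n - 1"] n c that by (auto simp: mem of_nat_diff)
          then show ?thesis using 2 0 that c by (intro pick[of _ _ _ "(2, n - 1)" "(2, 4 * j - n - 1)"]) auto
        qed
      next
        case 3
        consider "n = 1" | "n = 2" | "3 \<le> n" using n by linarith
        then show ?thesis
        proof cases
          case c: 1
          have "?D 2 2 d (3, 4)"
            by (rule has_diff_pureI[of "1 - 2 * int j" _ _ "2 - 2 * int j"]) (use c n in \<open>auto simp: bl\<close>)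
          moreover have "?D 2 2 d (3, 5)"
            by (rule has_diff_pureI[of "1 - 2 * int j" _ _ "2 - 2 * int j"]) (use c n in \<open>auto simp: bl\<close>)
          ultimately show ?thesis using 3 by (intro pick[of _ _ _ "(3, 4)" "(3, 5)"]) (auto simp: mem)
        next
          case c: 2
          have "?D 2 2 d (3, 9)"
            by (rule has_diff_pureI[of "2 * int j - 1" _ _ "2 * int j + 1"]) (use c n in \<open>auto simp: bl\<close>)
          moreover have "?D 2 2 d (1, 2)"
            by (rule low2) (use r r' c n j in auto)
          ultimately show ?thesis using 3 j by (intro pick[of _ _ _ "(3, 9)" "(1, 2)"]) (auto simp: mem)
        next
          case c: 3
          have "?D 2 2 d (1, n)"
            by (rule low2) (use rosa_diff[of j n] that j n in auto)
          moreover have "?D 2 2 d (1, 4 * j - 1 - n)"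
            by (rule low2) (use rosa_diff[of j "4 * j - 1 - n"] that j n in \<open>auto simp: of_nat_diff\<close>)
          ultimately show ?thesis using 3 that c by (intro pick[of _ _ _ "(1, n)" "(1, 4 * j - 1 - n)"]) (auto simp: mem)
        qed
      qed
    qed
    then show ?thesis using half n by (cases "n = 2 * j") auto
  qed
  show "\<exists>t\<in>?T. \<exists>t'\<in>?T. t \<noteq> t' \<and> ?D i k d t \<and> ?D i k d t'"
    if ik: "(i, k) \<in> {(0, 1), (1, 2), (2, 0)}" for i k d
  proof -
    have surj: "\<exists>t<4 * j. ?m dvd (zigzag t - d)"
      using zigzag_surj[of "4 * j" d] j by simp
    have cases: "t = 0 \<or> (\<exists>u. t = Suc u \<and> u < 4 * j - 4) \<or> t = 4 * j - 3 \<or> t = 4 * j - 2 \<or> t = 4 * j - 1"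
      if "t < 4 * j" for t
      using that by (cases t) auto
    from ik consider "i = 0" "k = 1" | "i = 1" "k = 2" | "i = 2" "k = 0" by auto
    then show ?thesis
    proof cases
      case ik: 1
      obtain t where t: "t < 4 * j" and e: "?m dvd (zigzag t - d)" using surj by blast
      note D = has_diffI[OF _ _ e]
      consider "t = 0" | u where "t = Suc u" "u < 4 * j - 4" | "t = 4 * j - 3" | "t = 4 * j - 2" | "t = 4 * j - 1"
        using cases[OF t] by blast
      then show ?thesis
      proof cases
        case 1
        show ?thesis by (rule pick[of _ _ _ "(3, 0)" "(0, 0)", OF D[of 0 _ _ 0] D[of 0 _ _ 0]])
            (use 1 ik j in \<open>auto simp: bl mem\<close>)
      next
        case (2 u)
        show ?thesis by (rule pick[of _ _ _ "(0, u)" "(0, Suc u)", OF D[of "- zigzag t" _ _ 0] D[of "- zigzag t" _ _ 0]])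
            (use 2 ik in \<open>auto simp: bl mem\<close>)
      next
        case 3
        show ?thesis by (rule pick[of _ _ _ "(0, 4 * j - 4)" "(3, 1)", OF D[of "1 - 2 * int j" _ _ 0] D[of "1 - 2 * int j" _ _ 0]])
            (use 3 ik z3 j in \<open>auto simp: bl mem Suc3\<close>)
      next
        case 4
        show ?thesis by (rule pick[of _ _ _ "(3, 1)" "(3, 2)", OF D[of "1 - 2 * int j" _ _ 2] D[of "1 - 2 * int j" _ _ 2]])
            (use 4 ik z2 in \<open>auto simp: bl mem\<close>)
      next
        case 5
        show ?thesis by (rule pick[of _ _ _ "(3, 2)" "(3, 3)", OF D[of "1 - 2 * int j" _ _ 1] D[of "1 - 2 * int j" _ _ 1]])
            (use 5 ik z1 in \<open>auto simp: bl mem\<close>)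
      qed
    next
      case ik: 2
      obtain t where t: "t < 4 * j" and e: "?m dvd (zigzag t - d)" using surj by blast
      note D = has_diffI[OF _ _ e]
      consider "t = 0" | u where "t = Suc u" "u < 4 * j - 4" | "t = 4 * j - 3" | "t = 4 * j - 2" | "t = 4 * j - 1"
        using cases[OF t] by blast
      then show ?thesis
      proof cases
        case 1
        show ?thesis by (rule pick[of _ _ _ "(3, 0)" "(2, 0)", OF D[of 0 _ _ 0] D[of "2 * int j - 1" _ _ "2 * int j - 1"]])
            (use 1 ik j in \<open>auto simp: bl mem\<close>)
      next
        case (2 u)
        show ?thesis by (rule pick[of _ _ _ "(2, u)" "(2, Suc u)", OF D[of "2 * int j - 1 - zigzag t" _ _ "2 * int j - 1"] D[of "2 * int j - 1 - zigzag t" _ _ "2 * int j - 1"]])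
            (use 2 ik in \<open>auto simp: bl mem\<close>)
      next
        case 3
        show ?thesis by (rule pick[of _ _ _ "(2, 4 * j - 4)" "(3, 9)", OF D[of 0 _ _ "2 * int j - 1"] D[of 0 _ _ "2 * int j - 1"]])
            (use 3 ik z3 j in \<open>auto simp: bl mem Suc3\<close>)
      next
        case 4
        show ?thesis by (rule pick[of _ _ _ "(3, 9)" "(3, 4)", OF D[of 0 _ _ "2 * int j + 1"] D[of 1 _ _ "2 - 2 * int j"]])
            (use 4 ik z2 in \<open>auto simp: bl mem\<close>)
      next
        case 5
        show ?thesis by (rule pick[of _ _ _ "(3, 4)" "(3, 3)", OF D[of 1 _ _ "1 - 2 * int j"] D[of 1 _ _ "1 - 2 * int j"]])
            (use 5 ik z1 in \<open>auto simp: bl mem\<close>)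
      qed
    next
      case ik: 3
      have rr: "rosa j 1 = 2 * int j" "rosa j (4 * j - 2) = -1" "rosa j (4 * j - 1) = 0"
        unfolding J by (auto simp: rosa_def)
      \<comment> \<open>The labels with indices 2 and \<open>4 j - 3\<close> are the ends of the fan
        and occur once in it; those with indices 1, \<open>4 j - 2\<close> and
        \<open>4 j - 1\<close> do not occur.\<close>
      have cases: "t = 1 \<or> t = 2 \<or> (\<exists>u. t = Suc u \<and> 2 \<le> u \<and> u < 4 * j - 4) \<or> t = 4 * j - 3 \<or> t = 4 * j - 2 \<or> t = 4 * j - 1"
        if "t \<in> {1..<4 * j}" for t
        using that by (cases t) auto
      from rosa_surj[of j d] j consider "?m dvd (0 - d)" | t where "t \<in> {1..<4 * j}" "?m dvd (int j - rosa j t - d)"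
        by auto
      then show ?thesis
      proof cases
        case e: 1
        note D = has_diffI[OF _ _ e]
        show ?thesis by (rule pick[of _ _ _ "(3, 0)" "(3, 3)", OF D[of 0 _ _ 0] D[of "1 - 2 * int j" _ _ "1 - 2 * int j"]])
            (use ik in \<open>auto simp: bl mem\<close>)
      next
        case e: (2 t)
        note D = has_diffI[OF _ _ e(2)]
        consider "t = 1" | "t = 2" | u where "t = Suc u" "2 \<le> u" "u < 4 * j - 4" | "t = 4 * j - 3" | "t = 4 * j - 2" | "t = 4 * j - 1"
          using cases[OF e(1)] by blast
        then show ?thesis
        proof cases
          case 1
          show ?thesis by (rule pick[of _ _ _ "(3, 5)" "(3, 6)", OF D[of "1 - 2 * int j" _ _ "1 + int j"] D[of "1 - 2 * int j" _ _ "1 + int j"]])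
              (use 1 ik rr in \<open>auto simp: bl mem\<close>)
        next
          case 2
          show ?thesis by (rule pick[of _ _ _ "(3, 5)" "(1, 2)", OF D[of "2 - 2 * int j" _ _ "1 + int j"] D[of "1 - 2 * int j" _ _ "int j"]])
              (use 2 ik r j in \<open>auto simp: bl mem\<close>)
        next
          case (3 u)
          show ?thesis by (rule pick[of _ _ _ "(1, u)" "(1, Suc u)", OF D[of "rosa j t" _ _ "int j"] D[of "rosa j t" _ _ "int j"]])
              (use 3 ik in \<open>auto simp: bl mem\<close>)
        next
          case 4
          show ?thesis by (rule pick[of _ _ _ "(1, 4 * j - 4)" "(3, 8)", OF D[of 1 _ _ "int j"] D[of 1 _ _ "int j"]])
              (use 4 ik r j in \<open>auto simp: bl mem Suc3\<close>)
        next
          case 5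
          show ?thesis by (rule pick[of _ _ _ "(3, 8)" "(3, 7)", OF D[of 1 _ _ "2 + int j"] D[of 1 _ _ "2 + int j"]])
              (use 5 ik rr in \<open>auto simp: bl mem\<close>)
        next
          case 6
          show ?thesis by (rule pick[of _ _ _ "(3, 7)" "(3, 6)", OF D[of 1 _ _ "1 + int j"] D[of 1 _ _ "1 + int j"]])
              (use 6 ik rr in \<open>auto simp: bl mem\<close>)
        qed
      qed
    qed
  qed
qed simp

section \<open>Closed trails on pairs of points\<close>

text \<open>Pairs of points are regarded as vertices and blocks as edges; a block may join any two of its
  pairs. A closed trail through some of the blocks is then a cyclic ordering of these blocks in
  which neighbours share a pair.\<close>

inductive walk :: "'a set \<Rightarrow> 'a set list \<Rightarrow> 'a set set \<Rightarrow> 'a set \<Rightarrow> bool" where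
  Nil: "walk p [] {} p"
| Cons: "card p = 2 \<Longrightarrow> p \<subseteq> b \<Longrightarrow> q \<subseteq> b \<Longrightarrow> walk q xs S r \<Longrightarrow> walk p (b # xs) (insert p S) r"

text \<open>\<open>L\<close> is only a lower bound for the set of visited pairs, so a trail can be
  described by those pairs at which it will be merged. Pairs may be visited repeatedly, blocks may
  not.\<close>

definition closed_trail :: "'a set set \<Rightarrow> 'a set set \<Rightarrow> bool" where
  "closed_trail X L \<longleftrightarrow> (\<exists>p xs S. distinct xs \<and> set xs = X \<and> walk p xs S p \<and> L \<subseteq> S)"

lemma walk_append: "walk p xs S q \<Longrightarrow> walk q ys T r \<Longrightarrow> walk p (xs @ ys) (S \<union> T) r"
  by (induction rule: walk.induct) (auto intro: walk.intros)

lemma walk_split: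
  "walk p xs S r \<Longrightarrow> q \<in> S \<Longrightarrow>
    \<exists>ys zs S1 S2. xs = ys @ zs \<and> walk p ys S1 q \<and> walk q zs S2 r \<and> S = S1 \<union> S2"
proof (induction rule: walk.induct)
  case (Cons p b q' xs S r)
  show ?case
  proof (cases "q = p")
    case True
    have "walk p (b # xs) (insert p S) r" using Cons.hyps by (rule walk.Cons)
    then show ?thesis using True by (intro exI[of _ "[]"] exI[of _ "b # xs"] exI[of _ "{}"]
          exI[of _ "insert p S"]) (auto intro: walk.Nil)
  next
    case False
    then obtain ys zs S1 S2 where "xs = ys @ zs" "walk q' ys S1 q" "walk q zs S2 r" "S = S1 \<union> S2"
      using Cons by blast
    then show ?thesis using walk.Cons[OF Cons.hyps(1-3), of ys S1 q]
      by (intro exI[of _ "b # ys"] exI[of _ zs] exI[of _ "insert p S1"] exI[of _ S2]) auto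
  qed
qed simp

lemma walk_card_label: "walk p xs S r \<Longrightarrow> q \<in> S \<Longrightarrow> card q = 2"
  by (induction rule: walk.induct) auto

lemma walk_consecutive:
  "walk p xs S r \<Longrightarrow> xs \<noteq> [] \<Longrightarrow>
    p \<subseteq> hd xs \<and> r \<subseteq> last xs \<and> successively (\<lambda>b c. \<exists>q. card q = 2 \<and> q \<subseteq> b \<and> q \<subseteq> c) xs"
proof (induction rule: walk.induct)
  case (Cons p b q xs S r)
  then show ?case
  proof (cases xs)
    case Nil
    then have "q = r" using Cons.hyps by (auto elim: walk.cases)
    then show ?thesis using Cons.hyps Nil by simp
  next
    case (Cons c ys)
    with \<open>walk q xs S r\<close> have "card q = 2" by (auto elim: walk.cases)
    then show ?thesis using Cons Cons.IH Cons.hyps by (auto simp: successively_Cons)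
  qed
qed simp

text \<open>\<open>S\<close> records the pairs from which a block is entered and need not contain
  the final pair; hence the end pairs are inserted before the two sets are compared.\<close>

lemma walk_rev:
  "walk p xs S r \<Longrightarrow> card r = 2 \<Longrightarrow> \<exists>S'. walk r (rev xs) S' p \<and> insert p S' = insert r S"
proof (induction rule: walk.induct)
  case (Nil p)
  then show ?case by (auto intro: walk.Nil)
next
  case (Cons p b q xs S r)
  then obtain S' where S': "walk r (rev xs) S' q" "insert q S' = insert r S" by blast
  have "card q = 2" using \<open>walk q xs S r\<close> \<open>card r = 2\<close> by (auto elim: walk.cases)
  then have "walk q [b] {q} p" using walk.Cons[OF _ _ _ walk.Nil] Cons.hyps by blast
  from walk_append[OF S'(1) this] show ?case using S'(2)
    by (intro exI[of _ "S' \<union> {q}"]) auto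
qed

lemma closed_trail_rebase:
  assumes "closed_trail X L" "q \<in> L"
  shows "\<exists>xs S. distinct xs \<and> set xs = X \<and> walk q xs S q \<and> L \<subseteq> S"
proof -
  obtain p xs S where xs: "distinct xs" "set xs = X" "walk p xs S p" "L \<subseteq> S"
    using assms(1) unfolding closed_trail_def by blast
  then have "q \<in> S" using assms(2) by blast
  then obtain ys zs S1 S2 where s: "xs = ys @ zs" "walk p ys S1 q" "walk q zs S2 p" "S = S1 \<union> S2"
    using walk_split[OF xs(3)] by blast
  have "walk q (zs @ ys) S q" using walk_append[OF s(3,2)] s(4) by (simp add: Un_commute)
  then show ?thesis using xs s by (intro exI[of _ "zs @ ys"] exI[of _ S]) auto
qed

text \<open>As for Euler tours, both trails are rotated so as to start at a common pair and are then
  concatenated.\<close>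

lemma closed_trail_merge:
  assumes "closed_trail X L" "closed_trail Y M" "X \<inter> Y = {}" "L \<inter> M \<noteq> {}"
  shows "closed_trail (X \<union> Y) (L \<union> M)"
proof -
  obtain p where p: "p \<in> L" "p \<in> M" using assms(4) by blast
  obtain xs S where xs: "distinct xs" "set xs = X" "walk p xs S p" "L \<subseteq> S"
    using closed_trail_rebase[OF assms(1) p(1)] by blast
  obtain ys T where ys: "distinct ys" "set ys = Y" "walk p ys T p" "M \<subseteq> T"
    using closed_trail_rebase[OF assms(2) p(2)] by blast
  have "walk p (xs @ ys) (S \<union> T) p" by (rule walk_append[OF xs(3) ys(3)])
  then show ?thesis unfolding closed_trail_def using xs ys assms(3)
    by (intro exI[of _ p] exI[of _ "xs @ ys"] exI[of _ "S \<union> T"]) auto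
qed

text \<open>A block may be entered and left at the same pair, as a loop; this is how leftover blocks
  are inserted.\<close>

lemma closed_trail_single: "card p = 2 \<Longrightarrow> p \<subseteq> b \<Longrightarrow> closed_trail {b} {p}"
  unfolding closed_trail_def using walk.Cons[OF _ _ _ walk.Nil, of p b p]
  by (intro exI[of _ p] exI[of _ "[b]"] exI[of _ "{p}"]) auto

lemma closed_trail_absorb:
  assumes "closed_trail X L" "finite Y" "X \<inter> Y = {}" "\<And>b. b \<in> Y \<Longrightarrow> \<exists>p\<in>L. p \<subseteq> b"
  shows "closed_trail (X \<union> Y) L"
  using assms(2-4)
proof (induction Y rule: finite_induct)
  case empty
  then show ?case using assms(1) by simp
next
  case (insert b Y)
  then have IH: "closed_trail (X \<union> Y) L" by auto
  obtain p where p: "p \<in> L" "p \<subseteq> b" using insert.prems by blast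
  have "card p = 2" using assms(1) p(1) walk_card_label unfolding closed_trail_def by blast
  then have "closed_trail {b} {p}" using p(2) by (rule closed_trail_single)
  moreover have "(X \<union> Y) \<inter> {b} = {}" using insert by auto
  ultimately have "closed_trail ((X \<union> Y) \<union> {b}) (L \<union> {p})"
    using IH p(1) by (intro closed_trail_merge) auto
  then show ?case using p(1) by (simp add: insert_absorb)
qed

text \<open>\<open>conn\<close> says that the graph of shared labels is connected. A maximal
  mergeable family is closed under sharing a label, since any further trail could be merged, and so
  it is the whole of \<open>I\<close>.\<close>

lemma closed_trail_connected:
  assumes "finite I" and tr: "\<And>c. c \<in> I \<Longrightarrow> closed_trail (X c) (L c)"
    and dis: "\<And>c d. c \<in> I \<Longrightarrow> d \<in> I \<Longrightarrow> c \<noteq> d \<Longrightarrow> X c \<inter> X d = {}"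
    and c0: "c0 \<in> I"
    and conn: "\<And>J. c0 \<in> J \<Longrightarrow> J \<subseteq> I \<Longrightarrow> (\<And>c d. c \<in> J \<Longrightarrow> d \<in> I \<Longrightarrow> L c \<inter> L d \<noteq> {} \<Longrightarrow> d \<in> J) \<Longrightarrow> J = I"
  shows "closed_trail (\<Union>c\<in>I. X c) (\<Union>c\<in>I. L c)"
proof -
  define \<J> where "\<J> = {J. c0 \<in> J \<and> J \<subseteq> I \<and> closed_trail (\<Union>c\<in>J. X c) (\<Union>c\<in>J. L c)}"
  have "finite \<J>" unfolding \<J>_def using assms(1) by (auto intro: finite_subset[of _ "Pow I"])
  moreover have "{c0} \<in> \<J>" unfolding \<J>_def using tr c0 by simp
  ultimately obtain J where J: "J \<in> \<J>" and max: "\<And>J'. J' \<in> \<J> \<Longrightarrow> J \<subseteq> J' \<Longrightarrow> J = J'"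
    by (metis finite_has_maximal2)
  have "J = I"
  proof (rule conn)
    show "c0 \<in> J" "J \<subseteq> I" using J by (auto simp: \<J>_def)
    fix c d assume cd: "c \<in> J" "d \<in> I" "L c \<inter> L d \<noteq> {}"
    show "d \<in> J"
    proof (rule ccontr)
      assume d: "d \<notin> J"
      have "closed_trail ((\<Union>c\<in>J. X c) \<union> X d) ((\<Union>c\<in>J. L c) \<union> L d)"
      proof (rule closed_trail_merge)
        show "(\<Union>c\<in>J. X c) \<inter> X d = {}" using dis d cd J by (fastforce simp: \<J>_def)
      qed (use J tr cd in \<open>auto simp: \<J>_def\<close>)
      then have "insert d J \<in> \<J>" using J cd by (auto simp: \<J>_def Un_commute)
      then show False using max[of "insert d J"] d by auto
    qed
  qed
  then show ?thesis using J by (simp add: \<J>_def)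
qed

text \<open>The blocks on both sides of a visited pair contain it and, being different triples, have
  nothing else in common.\<close>

lemma closed_trail_gray_system:
  assumes V: "finite V" "card V = v" and tr: "closed_trail B L" and B: "3 \<le> card B"
    and blocks: "\<And>b. b \<in> B \<Longrightarrow> b \<subseteq> V \<and> card b = 3"
    and pairs: "\<And>x y. x \<in> V \<Longrightarrow> y \<in> V \<Longrightarrow> x \<noteq> y \<Longrightarrow> card {b \<in> B. x \<in> b \<and> y \<in> b} = l"
  shows "gray_system v l"
proof -
  obtain p xs S where xs: "distinct xs" "set xs = B" "walk p xs S p"
    using tr unfolding closed_trail_def by blast
  have len: "3 \<le> length xs" using xs B distinct_card by metis
  then have ne: "xs \<noteq> []" by auto
  have cp: "card p = 2" using xs(3) ne by (auto elim: walk.cases)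
  note cons = walk_consecutive[OF xs(3) ne]
  show ?thesis
  proof (rule gray_systemI[OF V xs(1) len])
    show "b \<subseteq> V \<and> card b = 3" if "b \<in> set xs" for b using blocks that xs by blast
    show "card {b \<in> set xs. x \<in> b \<and> y \<in> b} = l" if "x \<in> V" "y \<in> V" "x \<noteq> y" for x y
      using pairs that xs by blast
    show "card (xs ! i \<inter> xs ! (Suc i mod length xs)) = 2" if i: "i < length xs" for i
    proof -
      let ?j = "Suc i mod length xs"
      have j: "?j < length xs" "?j \<noteq> i" using i len by (auto simp: mod_Suc)
      have "\<exists>q. card q = 2 \<and> q \<subseteq> xs ! i \<and> q \<subseteq> xs ! ?j"
      proof (cases "Suc i < length xs")
        case True
        then show ?thesis using cons by (simp add: successively_conv_nth)
      next
        case False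
        then have "i = length xs - 1" "Suc i = length xs" using i by simp_all
        then have "xs ! i = last xs" "?j = 0" using ne by (simp_all add: last_conv_nth)
        then show ?thesis using cons cp ne by (auto simp: hd_conv_nth)
      qed
      then obtain q where q: "card q = 2" "q \<subseteq> xs ! i \<inter> xs ! ?j" by auto
      have 3: "card (xs ! i) = 3" "card (xs ! ?j) = 3" using blocks xs(2) i j nth_mem by blast+
      then have fin: "finite (xs ! i)" "finite (xs ! ?j)" by (auto intro: card_ge_0_finite)
      have neq: "xs ! i \<noteq> xs ! ?j" using xs(1) i j by (simp add: nth_eq_iff_index_eq)
      have "card (xs ! i \<inter> xs ! ?j) \<noteq> 3"
      proof
        assume c: "card (xs ! i \<inter> xs ! ?j) = 3"
        have "xs ! i \<inter> xs ! ?j = xs ! i" "xs ! i \<inter> xs ! ?j = xs ! ?j"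
          using c 3 fin by (intro card_subset_eq; auto)+
        with neq show False by simp
      qed
      moreover have "card (xs ! i \<inter> xs ! ?j) \<le> 3" using card_mono[OF fin(1), of "xs ! i \<inter> xs ! ?j"] 3 by simp
      moreover have "2 \<le> card (xs ! i \<inter> xs ! ?j)" using card_mono[OF _ q(2)] q(1) fin by simp
      ultimately show ?thesis by linarith
    qed
  qed
qed

section \<open>The colouring of the triples\<close>

text \<open>The points are \<open>(x, a)\<close> for residues \<open>x\<close> modulo \<open>n\<close>, and two points with first component \<open>-1\<close>.\<close>

locale coloured_triples =
  fixes n :: int
  assumes n5: "5 \<le> n" and odd: "odd n" and not3: "\<not> 3 dvd n"
begin

definition R :: "int set" where "R = {0..<n}"
definition V :: "(int \<times> bool) set" where "V = {-1..<n} \<times> UNIV"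

text \<open>A rotational tournament on the residues. It breaks ties between two residues in
  \<open>colour_inf\<close> and later selects the pairs at which cubes are merged.\<close>

definition ahead :: "int \<Rightarrow> int \<Rightarrow> bool" where
  "ahead x y \<longleftrightarrow> 0 < (y - x) mod n \<and> 2 * ((y - x) mod n) < n"

text \<open>For residues \<open>x \<noteq> y\<close> the pair \<open>(x, a)\<close>,
  \<open>(y, b)\<close> has only one finite third point in each of the colours
  \<open>2 x + y\<close> and \<open>x + 2 y\<close>, namely the other copy of \<open>x\<close> or of
  \<open>y\<close>. The two infinite points fill these two gaps, and the parity of the tournament
  and both bits decides which fills which. Exchanging the two points reverses \<open>ahead\<close>
  and also the two branches, so the colour is symmetric.\<close>

definition colour_inf :: "bool \<Rightarrow> int \<times> bool \<Rightarrow> int \<times> bool \<Rightarrow> int" where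
  "colour_inf i p q = (if fst p = fst q then 3 * fst p
     else if i = ((ahead (fst p) (fst q) = snd p) = snd q) then 2 * fst p + fst q
     else fst p + 2 * fst q)"

definition colour :: "int \<times> bool \<Rightarrow> int \<times> bool \<Rightarrow> int \<times> bool \<Rightarrow> int" where
  "colour p q r = (if fst p = -1 then
       (if fst q = -1 then 3 * fst r else if fst r = -1 then 3 * fst q else colour_inf (snd p) q r)
     else if fst q = -1 then (if fst r = -1 then 3 * fst p else colour_inf (snd q) p r)
     else if fst r = -1 then colour_inf (snd r) p q else fst p + fst q + fst r) mod n"

lemma eq_R: "x \<in> R \<Longrightarrow> y \<in> R \<Longrightarrow> n dvd (x - y) \<Longrightarrow> x = y"
  by (metis R_def atLeastLessThan_iff mod_eq_dvd_iff mod_pos_pos_trivial)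

lemma mod_R [simp]: "x mod n \<in> R"
  using n5 by (simp add: R_def)

lemma coprime2: "n dvd 2 * x \<Longrightarrow> n dvd x"
  using odd by (metis coprime_commute coprime_dvd_mult_right_iff coprime_right_2_iff_odd)

lemma coprime3:
  assumes "n dvd 3 * x" shows "n dvd x"
proof -
  define q where "q = n div 3"
  have "n = 3 * q + 1 \<or> n = 3 * q + 2"
    using not3 unfolding q_def by (simp add: dvd_eq_mod_eq_0) presburger
  then show ?thesis
  proof
    assume n: "n = 3 * q + 1"
    have "n dvd n * x - 3 * x * q" by (rule dvd_diff[OF dvd_triv_left dvd_mult2[OF assms]])
    also have "n * x - 3 * x * q = x" unfolding n by (simp add: algebra_simps)
    finally show ?thesis .
  next
    assume n: "n = 3 * q + 2"
    have "n dvd n * (2 * x) - 3 * x * (2 * q + 1)" by (rule dvd_diff[OF dvd_triv_left dvd_mult2[OF assms]])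
    also have "n * (2 * x) - 3 * x * (2 * q + 1) = x" unfolding n by (simp add: algebra_simps)
    finally show ?thesis .
  qed
qed

lemma ahead_flip:
  assumes "x \<in> R" "y \<in> R" "x \<noteq> y" shows "ahead y x \<longleftrightarrow> \<not> ahead x y"
proof -
  have "\<not> n dvd (y - x)" using eq_R[OF assms(2,1)] assms(3) by auto
  then have nz: "(y - x) mod n \<noteq> 0" by (simp add: dvd_eq_mod_eq_0)
  then have "(x - y) mod n = n - (y - x) mod n"
    using zmod_zminus1_eq_if[of "y - x" n] n5 by simp
  moreover have "0 \<le> (y - x) mod n" "(y - x) mod n < n" using n5 by simp_all
  moreover have "2 * ((y - x) mod n) \<noteq> n" using odd by (metis dvd_triv_left)
  ultimately show ?thesis using nz unfolding ahead_def by linarith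
qed

lemma fin_V: "p \<in> V \<Longrightarrow> fst p \<noteq> -1 \<Longrightarrow> fst p \<in> R"
  by (auto simp: V_def R_def)

lemma colour_inf_commute:
  assumes "p \<in> V" "q \<in> V" "fst p \<noteq> -1" "fst q \<noteq> -1"
  shows "colour_inf i p q = colour_inf i q p"
  using ahead_flip[OF fin_V fin_V, of p q] assms
  by (auto simp: colour_inf_def)

lemma colour_commute12:
  assumes "p \<in> V" "q \<in> V" "r \<in> V" shows "colour p q r = colour q p r"
  using assms colour_inf_commute by (auto simp: colour_def algebra_simps)

lemma colour_commute23:
  assumes "p \<in> V" "q \<in> V" "r \<in> V" shows "colour p q r = colour p r q"
  using assms colour_inf_commute by (auto simp: colour_def algebra_simps)

lemma colour_range: "0 \<le> colour p q r" "colour p q r < n"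
  using n5 by (auto simp: colour_def)

definition half :: "int \<Rightarrow> int" where "half t = (t * ((n + 1) div 2)) mod n"

lemma half_R [simp]: "half t \<in> R" by (simp add: half_def)

lemma half_double: "n dvd (2 * half t - t)"
proof -
  have 2: "2 * ((n + 1) div 2) = n + 1" using odd by (auto elim!: oddE)
  have "n dvd (half t - t * ((n + 1) div 2))"
    unfolding half_def by (simp add: mod_eq_dvd_iff[symmetric])
  from dvd_add[OF dvd_mult[OF this, of 2] dvd_triv_left[of n t]]
  have "n dvd 2 * (half t - t * ((n + 1) div 2)) + n * t" .
  also have "2 * (half t - t * ((n + 1) div 2)) + n * t = 2 * half t - t * (2 * ((n + 1) div 2)) + n * t"
    by (simp add: algebra_simps)
  also have "\<dots> = 2 * half t - t" unfolding 2 by (simp add: algebra_simps)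
  finally show ?thesis .
qed

lemma third_exists: "\<exists>x\<in>R. n dvd (3 * x - s)"
proof -
  have "inj_on (\<lambda>x. (3 * x) mod n) R"
  proof (rule inj_onI)
    fix x y assume xy: "x \<in> R" "y \<in> R" "(3 * x) mod n = (3 * y) mod n"
    then have "n dvd 3 * (x - y)" by (simp add: mod_eq_dvd_iff algebra_simps)
    then show "x = y" using xy coprime3 eq_R by blast
  qed
  moreover have "(\<lambda>x. (3 * x) mod n) ` R \<subseteq> R" by auto
  moreover have "finite R" by (simp add: R_def)
  ultimately have "(\<lambda>x. (3 * x) mod n) ` R = R" by (metis endo_inj_surj)
  then have "s mod n \<in> (\<lambda>x. (3 * x) mod n) ` R" by simp
  then show ?thesis by (auto simp: mod_eq_dvd_iff dvd_diff_commute)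
qed

lemma mod_eqI: "n dvd (x - s) \<Longrightarrow> 0 \<le> s \<Longrightarrow> s < n \<Longrightarrow> x mod n = s"
  by (metis mod_eq_dvd_iff mod_pos_pos_trivial)

lemma R_not_inf [simp]: "x \<in> R \<Longrightarrow> x \<noteq> -1" "-1 \<notin> R"
  by (auto simp: R_def)

lemma in_V [simp]: "x \<in> R \<Longrightarrow> (x, a) \<in> V" "(-1, a) \<in> V"
  using n5 by (auto simp: R_def V_def)

lemma mod_sub_dvd: "n dvd (x mod n - x)"
  by (simp add: mod_eq_dvd_iff[symmetric])

lemma colour_finite:
  "x \<in> R \<Longrightarrow> y \<in> R \<Longrightarrow> z \<in> R \<Longrightarrow> colour (x, a) (y, b) (z, c) = (x + y + z) mod n"
  by (simp add: colour_def)

lemma colour_one_inf: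
  assumes "x \<in> R" "y \<in> R" shows
  "colour (x, a) (y, b) (-1, i) = colour_inf i (x, a) (y, b) mod n"
  "colour (x, a) (-1, i) (y, b) = colour_inf i (x, a) (y, b) mod n"
  "colour (-1, i) (x, a) (y, b) = colour_inf i (x, a) (y, b) mod n"
  using assms by (simp_all add: colour_def)

lemma colour_two_inf:
  assumes "x \<in> R" shows
  "colour (x, a) (-1, i) (-1, j) = (3 * x) mod n"
  "colour (-1, i) (-1, j) (x, a) = (3 * x) mod n"
  using assms by (simp_all add: colour_def)

text \<open>If the residue that completes the sum to \<open>s\<close> is new, both its copies do; if
  it equals a residue of the pair, infinite points stand in for the missing copies. For an infinite
  and a finite point the equations \<open>2 x + y = s\<close> and \<open>x + 2 w = s\<close> give
  one residue each, with one suitable bit.\<close>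

lemma two_thirds:
  assumes pq: "p \<in> V" "q \<in> V" "p \<noteq> q" and s: "0 \<le> s" "s < n"
  shows "\<exists>r\<in>V - {p, q}. \<exists>r'\<in>V - {p, q}. r \<noteq> r' \<and> colour p q r = s \<and> colour p q r' = s"
proof -
  have both: "\<exists>r\<in>V - {(x, a), (y, b)}. \<exists>r'\<in>V - {(x, a), (y, b)}. r \<noteq> r' \<and>
      colour (x, a) (y, b) r = s \<and> colour (x, a) (y, b) r' = s"
    if xy: "x \<in> R" "y \<in> R" "(x, a) \<noteq> (y, b)" for x y a b
  proof -
    define z where "z = (s - x - y) mod n"
    have z: "z \<in> R" "n dvd (x + y + z - s)"
      using mod_sub_dvd[of "s - x - y"] by (simp_all add: z_def algebra_simps)
    have full: "colour (x, a) (y, b) (z, c) = s" for c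
      using mod_eqI[OF z(2) s] xy z(1) by (simp add: colour_finite)
    have pickz: "\<exists>r\<in>V - {(x, a), (y, b)}. \<exists>r'\<in>V - {(x, a), (y, b)}. r \<noteq> r' \<and>
      colour (x, a) (y, b) r = s \<and> colour (x, a) (y, b) r' = s"
      if "colour (x, a) (y, b) r = s" "colour (x, a) (y, b) r' = s" "r \<in> V - {(x, a), (y, b)}"
        "r' \<in> V - {(x, a), (y, b)}" "r \<noteq> r'" for r r'
      using that by blast
    show ?thesis
    proof (cases "x = y")
      case True
      then have b: "b = (\<not> a)" using xy by auto
      show ?thesis
      proof (cases "z = x")
        case True
        have "colour (x, a) (y, b) (-1, c) = s" for c
          using mod_eqI[OF z(2) s] xy True \<open>x = y\<close> by (simp add: colour_one_inf colour_inf_def)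
        then show ?thesis using xy
          by (intro pickz[of "(-1, True)" "(-1, False)"]) auto
      next
        case False
        then show ?thesis using xy z full \<open>x = y\<close> by (intro pickz[of "(z, True)" "(z, False)"]) auto
      qed
    next
      case neq: False
      show ?thesis
      proof (cases "z = x \<or> z = y")
        case True
        then show ?thesis
        proof
          assume zx: "z = x"
          have "colour (x, a) (y, b) (-1, (ahead x y = a) = b) = s"
            using mod_eqI[OF z(2) s] xy zx neq by (simp add: colour_one_inf colour_inf_def algebra_simps)
          then show ?thesis using xy z zx neq full[of "\<not> a"]
            by (intro pickz[of "(x, \<not> a)" "(-1, (ahead x y = a) = b)"]) auto
        next
          assume zy: "z = y"
          have "colour (x, a) (y, b) (-1, \<not> ((ahead x y = a) = b)) = s"
            using mod_eqI[OF z(2) s] xy zy neq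
            by (cases b; cases a) (simp_all add: colour_one_inf colour_inf_def algebra_simps)
          then show ?thesis using xy z zy neq full[of "\<not> b"]
            by (intro pickz[of "(y, \<not> b)" "(-1, \<not> ((ahead x y = a) = b))"]) auto
        qed
      next
        case False
        then show ?thesis using xy z full by (intro pickz[of "(z, True)" "(z, False)"]) auto
      qed
    qed
  qed
  have one: "\<exists>r\<in>V - {(x, a), (-1, i)}. \<exists>r'\<in>V - {(x, a), (-1, i)}. r \<noteq> r' \<and>
      colour (x, a) (-1, i) r = s \<and> colour (x, a) (-1, i) r' = s"
    if x: "x \<in> R" for x a i
  proof -
    define y where "y = (s - 2 * x) mod n"
    define w where "w = half (s - x)"
    have y: "y \<in> R" "n dvd (2 * x + y - s)"
      using mod_sub_dvd[of "s - 2 * x"] by (simp_all add: y_def algebra_simps)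
    have w: "w \<in> R" "n dvd (x + 2 * w - s)"
      using half_double[of "s - x"] by (simp_all add: w_def algebra_simps)
    show ?thesis
    proof (cases "n dvd (3 * x - s)")
      case True
      have "colour (x, a) (-1, i) (x, \<not> a) = s" "colour (x, a) (-1, i) (-1, \<not> i) = s"
        using mod_eqI[OF True s] x by (simp_all add: colour_one_inf colour_two_inf colour_inf_def)
      then show ?thesis using x
        by (intro bexI[of _ "(x, \<not> a)"] bexI[of _ "(-1, \<not> i)"]) auto
    next
      case False
      have neq: "y \<noteq> x" "w \<noteq> x" using y w False by auto
      have yw: "y \<noteq> w"
      proof
        assume "y = w"
        have "n dvd 2 * (2 * x + y - s) - (x + 2 * y - s)" by (rule dvd_diff[OF dvd_mult[OF y(2)] w(2)[folded \<open>y = w\<close>]])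
        then show False using False by (simp add: algebra_simps)
      qed
      \<comment> \<open>The bits are solved from the parity condition in \<open>colour_inf\<close>:
        \<open>y\<close> has to fall into its first branch and \<open>w\<close> into its
        second.\<close>
      define b where "b = ((ahead x y = a) = i)"
      then have b: "i = ((ahead x y = a) = b)" by auto
      define c where "c = (\<not> ((ahead x w = a) = i))"
      then have c: "i = (\<not> ((ahead x w = a) = c))" by auto
      have "colour (x, a) (-1, i) (y, b) = s"
        using mod_eqI[OF y(2) s] x y(1) neq b by (simp add: colour_one_inf colour_inf_def)
      moreover have "colour (x, a) (-1, i) (w, c) = s"
        using mod_eqI[OF w(2) s] x w(1) neq c
        by (cases c; cases a) (simp_all add: colour_one_inf colour_inf_def)
      ultimately show ?thesis using x y w yw neq
        by (intro bexI[of _ "(y, b)"] bexI[of _ "(w, c)"]) auto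
    qed
  qed
  obtain x a where p: "p = (x, a)" by force
  obtain y b where q: "q = (y, b)" by force
  consider "x \<in> R" "y \<in> R" | "x \<in> R" "y = -1" | "x = -1" "y \<in> R" | "x = -1" "y = -1"
    using pq fin_V[of p] fin_V[of q] p q by auto
  then show ?thesis
  proof cases
    case 1
    then show ?thesis using both[of x y a b] pq p q by simp
  next
    case 2
    then show ?thesis using one[of x a b] pq p q by simp
  next
    case 3
    then obtain r r' where "r \<in> V - {q, p}" "r' \<in> V - {q, p}" "r \<noteq> r'" "colour q p r = s" "colour q p r' = s"
      using one[of y b a] pq p q by auto
    moreover from this have "colour p q r = s" "colour p q r' = s"
      using pq colour_commute12[of p q] by auto
    ultimately show ?thesis by (intro bexI[of _ r] bexI[of _ r']) auto
  next
    case 4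
    obtain x where x: "x \<in> R" "n dvd (3 * x - s)" using third_exists by blast
    then have "colour p q (x, c) = s" for c
      using mod_eqI[OF x(2) s] 4 x(1) by (simp add: p q colour_two_inf)
    then show ?thesis using x 4 by (intro bexI[of _ "(x, True)"] bexI[of _ "(x, False)"]) (auto simp: p q)
  qed
qed

lemma finite_V [simp]: "finite V" by (simp add: V_def)

lemma card_V: "card V = nat (2 * n + 2)"
  using n5 by (simp add: V_def card_cartesian_product)

text \<open>There are \<open>2 * n\<close> points outside the pair and \<open>n\<close> colours with
  at least two third points each, so each colour has exactly two.\<close>

lemma card_thirds:
  assumes pq: "p \<in> V" "q \<in> V" "p \<noteq> q" and k: "0 \<le> k" "k \<le> n"
  shows "card {r \<in> V - {p, q}. colour p q r < k} = nat (2 * k)"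
proof -
  define N where "N s = {r \<in> V - {p, q}. colour p q r = s}" for s
  have finN: "finite (N s)" for s by (simp add: N_def)
  have disj: "N s \<inter> N t = {}" if "s \<noteq> t" for s t using that by (auto simp: N_def)
  have ge: "2 \<le> card (N s)" if s: "s \<in> {0..<n}" for s
  proof -
    obtain r r' where "r \<in> N s" "r' \<in> N s" "r \<noteq> r'"
      using two_thirds[OF pq, of s] s by (auto simp: N_def)
    then have "card {r, r'} \<le> card (N s)" by (intro card_mono finN) auto
    then show ?thesis using \<open>r \<noteq> r'\<close> by simp
  qed
  have "V - {p, q} = (\<Union>s\<in>{0..<n}. N s)" by (auto simp: N_def colour_range)
  then have "card (V - {p, q}) = (\<Sum>s\<in>{0..<n}. card (N s))"
    using finN disj by (simp add: card_UN_disjoint)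
  moreover have "card (V - {p, q}) = nat (2 * n)"
    using pq n5 by (simp add: card_Diff_subset card_V) 
  ultimately have "(\<Sum>s\<in>{0..<n}. 2) = (\<Sum>s\<in>{0..<n}. card (N s))" using n5 by simp
  then have two: "card (N s) = 2" if "s \<in> {0..<n}" for s
    using sum_mono_inv[of "\<lambda>_. 2" "{0..<n}" "\<lambda>s. card (N s)" s] ge that by simp
  have "{r \<in> V - {p, q}. colour p q r < k} = (\<Union>s\<in>{0..<k}. N s)" by (auto simp: N_def colour_range)
  then have "card {r \<in> V - {p, q}. colour p q r < k} = (\<Sum>s\<in>{0..<k}. card (N s))"
    using finN disj by (simp add: card_UN_disjoint)
  also have "\<dots> = (\<Sum>s\<in>{0..<k}. 2)" using two k by (intro sum.cong) auto
  finally show ?thesis using k by simp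
qed

definition blocks :: "int \<Rightarrow> (int \<times> bool) set set" where
  "blocks k = {{p, q, r} | p q r. p \<in> V \<and> q \<in> V \<and> r \<in> V \<and> p \<noteq> q \<and> p \<noteq> r \<and> q \<noteq> r \<and> colour p q r < k}"

lemma blocks_iff:
  assumes "p \<noteq> q" "p \<noteq> r" "q \<noteq> r"
  shows "{p, q, r} \<in> blocks k \<longleftrightarrow> p \<in> V \<and> q \<in> V \<and> r \<in> V \<and> colour p q r < k"
proof
  assume "{p, q, r} \<in> blocks k"
  then obtain p' q' r' where *: "{p, q, r} = {p', q', r'}" "p' \<in> V" "q' \<in> V" "r' \<in> V" "colour p' q' r' < k"
    "p' \<noteq> q'" "p' \<noteq> r'" "q' \<noteq> r'" unfolding blocks_def by blast
  have "{p, q, r} \<subseteq> V" unfolding *(1) using * by simp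
  then have V: "p \<in> V" "q \<in> V" "r \<in> V" by simp_all
  have "(p = p' \<and> q = q' \<and> r = r') \<or> (p = p' \<and> q = r' \<and> r = q') \<or> (p = q' \<and> q = p' \<and> r = r') \<or>
    (p = q' \<and> q = r' \<and> r = p') \<or> (p = r' \<and> q = p' \<and> r = q') \<or> (p = r' \<and> q = q' \<and> r = p')"
  proof -
    have "p \<in> {p', q', r'}" "q \<in> {p', q', r'}" "r \<in> {p', q', r'}" using *(1) by auto
    then show ?thesis using assms by auto
  qed
  then have "colour p q r = colour p' q' r'"
    using *(2-4) V colour_commute12 colour_commute23 by (elim disjE conjE) metis+
  then show "p \<in> V \<and> q \<in> V \<and> r \<in> V \<and> colour p q r < k" using V * by simp
next
  assume "p \<in> V \<and> q \<in> V \<and> r \<in> V \<and> colour p q r < k"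
  then show "{p, q, r} \<in> blocks k" unfolding blocks_def using assms by blast
qed

lemma blocks_card: "b \<in> blocks k \<Longrightarrow> b \<subseteq> V \<and> card b = 3"
  by (auto simp: blocks_def)

lemma finite_blocks [simp]: "finite (blocks k)"
  by (rule finite_subset[of _ "Pow V"]) (use blocks_card in auto)

lemma blocks_pair:
  assumes pq: "p \<in> V" "q \<in> V" "p \<noteq> q" and k: "0 \<le> k" "k \<le> n"
  shows "card {b \<in> blocks k. p \<in> b \<and> q \<in> b} = nat (2 * k)"
proof -
  have "{b \<in> blocks k. p \<in> b \<and> q \<in> b} = (\<lambda>r. {p, q, r}) ` {r \<in> V - {p, q}. colour p q r < k}"
  proof (intro equalityI subsetI)
    fix b assume b: "b \<in> {b \<in> blocks k. p \<in> b \<and> q \<in> b}"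
    then have "card (b - {p, q}) = 1" "b \<subseteq> V" using blocks_card[of b k] pq by (auto simp: card_Diff_subset)
    then obtain r where r: "b - {p, q} = {r}" by (metis card_1_singletonE)
    then have "b = {p, q, r}" "r \<noteq> p" "r \<noteq> q" using b by auto
    then show "b \<in> (\<lambda>r. {p, q, r}) ` {r \<in> V - {p, q}. colour p q r < k}"
      using b blocks_iff[of p q r k] pq by auto
  next
    fix b assume "b \<in> (\<lambda>r. {p, q, r}) ` {r \<in> V - {p, q}. colour p q r < k}"
    then obtain r where "b = {p, q, r}" "r \<in> V" "p \<noteq> r" "q \<noteq> r" "colour p q r < k" by blast
    then show "b \<in> {b \<in> blocks k. p \<in> b \<and> q \<in> b}" using pq by (simp add: blocks_iff)
  qed
  moreover have "inj_on (\<lambda>r. {p, q, r}) {r \<in> V - {p, q}. colour p q r < k}"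
    by (rule inj_onI) auto
  ultimately show ?thesis using card_thirds[OF assms] by (simp add: card_image)
qed

section \<open>Closed trails through the cubes\<close>

text \<open>In the tournament on \<open>T\<close>, the residue \<open>m\<close> has one arrow in and
  one arrow out. In a cyclic triangle this leaves a choice; the second clause then keeps
  \<open>m\<close> from being a residue isolated from two neighbouring ones, as
  \<open>mid_adjacent\<close> needs.\<close>

definition is_mid :: "int set \<Rightarrow> int \<Rightarrow> bool" where
  "is_mid T m \<longleftrightarrow> (\<exists>y z. T = {m, y, z} \<and> ahead m y \<and> ahead z m) \<and>
     (\<forall>u\<in>T. (u + 1) mod n \<in> T \<longrightarrow> (m + 1) mod n \<in> T \<or> (m - 1) mod n \<in> T)"

definition mid :: "int set \<Rightarrow> int" where
  "mid T = (SOME m. is_mid T m)"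

definition cube :: "int set \<Rightarrow> (int \<times> bool) set set" where
  "cube T = {b. card b = 3 \<and> fst ` b = T}"

text \<open>Blocks are the vertices of a cube and pairs its edges: a pair fixes two bits and leaves
  the third free. These labels are the eight edges of one Hamilton cycle. The bit of the mid is
  prescribed by \<open>ahead\<close>, the other bits are free; so a pair with both bits prescribed
  is a label whichever residue is the mid.\<close>

definition cube_labels :: "int set \<Rightarrow> (int \<times> bool) set set" where
  "cube_labels T = {{(u, a), (w, c)} | u w a c. u \<in> T \<and> w \<in> T \<and> u \<noteq> w \<and>
     (u = mid T \<longrightarrow> a = (\<not> ahead u w)) \<and> (w = mid T \<longrightarrow> c = (\<not> ahead w u))}"

lemma dvd_small:
  assumes "n dvd x" "- n < x" "x < n" shows "x = 0"
proof (rule ccontr)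
  assume "x \<noteq> 0"
  then have "\<bar>n\<bar> \<le> \<bar>x\<bar>" using assms(1) by (rule dvd_imp_le_int)
  then show False using assms by linarith
qed

text \<open>From \<open>u\<close> to \<open>u + 1\<close> the distance to \<open>y\<close> decreases
  by one, so the arrow changes only if \<open>y\<close> lies opposite, at distance
  \<open>(n + 1) / 2\<close> from \<open>u\<close>. As \<open>n \<ge> 5\<close>, such a
  \<open>y\<close> is a neighbour of neither.\<close>

lemma ahead_succ:
  assumes "u \<in> R" "v = (u + 1) mod n" "y \<in> R" "y \<noteq> u" "y \<noteq> v"
  shows "ahead u v" "ahead u y \<Longrightarrow> ahead v y"
    "ahead u y \<noteq> ahead v y \<Longrightarrow> (y + 1) mod n \<notin> {u, v} \<and> (y - 1) mod n \<notin> {u, v}"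
proof -
  define d where "d = (y - u) mod n"
  have d: "0 \<le> d" "d < n" "n dvd (d - (y - u))" using n5 by (simp_all add: d_def mod_sub_dvd)
  have v: "v \<in> R" "n dvd (v - (u + 1))" using assms(2) mod_sub_dvd by simp_all
  have d0: "d \<noteq> 0"
  proof
    assume "d = 0"
    then have "n dvd (u - y)" using d(3) by simp
    then show False using eq_R[OF assms(1,3)] assms(4) by simp
  qed
  have d1: "d \<noteq> 1"
  proof
    assume "d = 1"
    then have "n dvd (d - (y - u)) + (v - (u + 1))" using dvd_add[OF d(3) v(2)] by simp
    then have "n dvd (v - y)" using \<open>d = 1\<close> by simp
    then show False using eq_R[OF v(1) assms(3)] assms(5) by auto
  qed
  have vy: "(y - v) mod n = d - 1"
  proof (rule mod_eqI)
    have "n dvd - ((d - (y - u)) + (v - (u + 1)))" using dvd_add[OF d(3) v(2)] by (simp only: dvd_minus_iff)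
    then show "n dvd (y - v) - (d - 1)" by (simp add: algebra_simps)
  qed (use d(1,2) d0 in linarith)+
  have uv: "(v - u) mod n = 1"
    by (rule mod_eqI) (use v(2) n5 in \<open>simp_all add: diff_diff_eq\<close>)
  show "ahead u v" using n5 by (simp add: ahead_def uv)
  have au: "ahead u y \<longleftrightarrow> 2 * d < n" and av: "ahead v y \<longleftrightarrow> 2 * (d - 1) < n"
    using d(1) d0 d1 unfolding ahead_def vy d_def[symmetric] by linarith+
  show "ahead u y \<Longrightarrow> ahead v y" using au av by auto
  assume "ahead u y \<noteq> ahead v y"
  moreover have "2 * d \<noteq> n" using odd by (metis dvd_triv_left)
  moreover have "2 * d \<noteq> n + 2" using odd by presburger
  ultimately have 2: "2 * d = n + 1" using au av by (smt (verit))
  have no: False if "z mod n = w" "n dvd (z - w) \<Longrightarrow> n dvd e" "e \<noteq> 0" "- n < e" "e < n" for z w e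
  proof -
    have "n dvd (z - w)" using that(1) mod_sub_dvd[of z] by (metis dvd_diff_commute)
    then show False using that dvd_small by blast
  qed
  have A: "n dvd (y - u - d)" using d(3) by (simp add: dvd_diff_commute)
  have B: "n dvd (v - u - 1)" using v(2) by (simp add: diff_diff_eq)
  have "(y + 1) mod n \<noteq> u"
  proof
    assume h: "(y + 1) mod n = u"
    show False by (rule no[OF h, of "d + 1 - n"])
      (use dvd_diff[OF _ A, of "y + 1 - u"] 2 n5 in \<open>auto simp: algebra_simps\<close>)
  qed
  moreover have "(y + 1) mod n \<noteq> v"
  proof
    assume h: "(y + 1) mod n = v"
    show False by (rule no[OF h, of d])
      (use dvd_add[OF dvd_diff[OF _ A, of "y + 1 - v"] B] 2 n5 in \<open>auto simp: algebra_simps\<close>)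
  qed
  moreover have "(y - 1) mod n \<noteq> u"
  proof
    assume h: "(y - 1) mod n = u"
    show False by (rule no[OF h, of "d - 1"])
      (use dvd_diff[OF _ A, of "y - 1 - u"] 2 n5 in \<open>auto simp: algebra_simps\<close>)
  qed
  moreover have "(y - 1) mod n \<noteq> v"
  proof
    assume h: "(y - 1) mod n = v"
    show False by (rule no[OF h, of "d - 2"])
      (use dvd_add[OF dvd_diff[OF _ A, of "y - 1 - v"] B] 2 n5 in \<open>auto simp: algebra_simps\<close>)
  qed
  ultimately show "(y + 1) mod n \<notin> {u, v} \<and> (y - 1) mod n \<notin> {u, v}" by simp
qed

lemma succ_neq: "u \<in> R \<Longrightarrow> (u + 1) mod n \<noteq> u" "u \<in> R \<Longrightarrow> (u - 1) mod n \<noteq> u"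
  using n5 mod_sub_dvd[of "u + 1"] mod_sub_dvd[of "u - 1"] dvd_small[of 1] dvd_small[of "-1"] by auto

lemma pred_succ: "u \<in> R \<Longrightarrow> ((u + 1) mod n - 1) mod n = u" "u \<in> R \<Longrightarrow> ((u - 1) mod n + 1) mod n = u"
  by (auto simp: mod_diff_left_eq mod_add_left_eq R_def)

text \<open>Given neighbours \<open>u\<close> and \<open>v = u + 1\<close>, one of them serves:
  \<open>v\<close> if \<open>ahead u w\<close>, since then \<open>ahead v w\<close>, and otherwise
  \<open>u\<close>. Without neighbours the second clause of \<open>is_mid\<close> is vacuous, and
  any triangle of a tournament has a vertex with one arrow in and one out.\<close>

lemma mid_exists:
  assumes "x \<in> R" "y \<in> R" "z \<in> R" "x \<noteq> y" "x \<noteq> z" "y \<noteq> z"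
  shows "\<exists>m. is_mid {x, y, z} m"
proof (cases "\<exists>u\<in>{x, y, z}. (u + 1) mod n \<in> {x, y, z}")
  case True
  then obtain u where u: "u \<in> {x, y, z}" "(u + 1) mod n \<in> {x, y, z}" by blast
  define v where "v = (u + 1) mod n"
  have uR: "u \<in> R" using u assms by auto
  have "v \<noteq> u" using succ_neq uR by (simp add: v_def)
  then obtain w where w: "{x, y, z} = {u, v, w}" "w \<noteq> u" "w \<noteq> v" "w \<in> R"
  proof -
    have uv: "u \<in> {x, y, z}" "v \<in> {x, y, z}" using u by (simp_all add: v_def)
    then have "card ({x, y, z} - {u, v}) = 1"
      using card_Diff_subset[of "{u, v}" "{x, y, z}"] assms(4-6) \<open>v \<noteq> u\<close> by simp
    then obtain w where w: "{x, y, z} - {u, v} = {w}" by (rule card_1_singletonE)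
    then have "{x, y, z} = {u, v, w}" "w \<in> {x, y, z}" "w \<notin> {u, v}" using uv by blast+
    moreover from this(2) have "w \<in> R" using assms(1-3) by auto
    ultimately show thesis by (intro that) simp_all
  qed
  have uv: "ahead u v" "ahead u w \<Longrightarrow> ahead v w"
    using ahead_succ(1,2)[OF uR v_def w(4,2,3)] by auto
  show ?thesis
  proof (cases "ahead u w")
    case True
    have "{x, y, z} = {v, w, u} \<and> ahead v w \<and> ahead u v" using w(1) uv True by auto
    moreover have "(v - 1) mod n \<in> {x, y, z}" using pred_succ(1)[OF uR] u(1) by (simp add: v_def)
    ultimately have "is_mid {x, y, z} v" unfolding is_mid_def by blast
    then show ?thesis by blast
  next
    case False
    then have "ahead w u" using ahead_flip[OF uR w(4)] w by auto
    have "{x, y, z} = {u, v, w} \<and> ahead u v \<and> ahead w u" using w(1) uv \<open>ahead w u\<close> by auto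
    then have "is_mid {x, y, z} u" unfolding is_mid_def using u(2) by blast
    then show ?thesis by blast
  qed
next
  case False
  have *: "is_mid {x, y, z} m" if "{x, y, z} = {m, p, q}" "ahead m p" "ahead q m" for m p q
    using False that unfolding is_mid_def by blast
  have f: "ahead y x = (\<not> ahead x y)" "ahead z x = (\<not> ahead x z)" "ahead z y = (\<not> ahead y z)"
    by (rule ahead_flip[OF assms(1,2,4)], rule ahead_flip[OF assms(1,3,5)], rule ahead_flip[OF assms(2,3,6)])
  have s: "{x, y, z} = {x, z, y}" "{x, y, z} = {y, x, z}" "{x, y, z} = {y, z, x}"
    "{x, y, z} = {z, x, y}" "{x, y, z} = {z, y, x}"
    by auto
  have "is_mid {x, y, z} x \<or> is_mid {x, y, z} y \<or> is_mid {x, y, z} z"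
    using *[OF refl] *[OF s(1)] *[OF s(2)] *[OF s(3)] *[OF s(4)] *[OF s(5)] f by argo
  then show ?thesis by blast
qed

lemma mid_is_mid:
  assumes "T \<subseteq> R" "card T = 3" shows "is_mid T (mid T)"
proof -
  obtain x y z where "T = {x, y, z}" "x \<noteq> y" "x \<noteq> z" "y \<noteq> z" using assms(2) by (auto simp: card_3_iff)
  then have "\<exists>m. is_mid T m" using mid_exists assms(1) by auto
  then show ?thesis unfolding mid_def by (rule someI_ex)
qed

text \<open>As the mid, \<open>y\<close> would have different arrows to the neighbours
  \<open>u\<close> and \<open>v\<close>. By \<open>ahead_succ\<close> it would then be a neighbour
  of neither, against the second clause of \<open>is_mid\<close>.\<close>

lemma mid_adjacent:
  assumes "u \<in> R" "v = (u + 1) mod n" "y \<in> R" "y \<noteq> u" "y \<noteq> v"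
  shows "mid {u, v, y} \<noteq> y"
proof
  assume m: "mid {u, v, y} = y"
  have vR: "v \<in> R" and vu: "v \<noteq> u" using assms succ_neq by auto
  have "is_mid {u, v, y} y"
  proof -
    have "{u, v, y} \<subseteq> R" "card {u, v, y} = 3" using assms(1,3,4,5) vR vu by simp_all
    from mid_is_mid[OF this] show ?thesis using m by simp
  qed
  then have 1: "\<exists>p q. {u, v, y} = {y, p, q} \<and> ahead y p \<and> ahead q y"
    and 2: "\<forall>u'\<in>{u, v, y}. (u' + 1) mod n \<in> {u, v, y} \<longrightarrow> (y + 1) mod n \<in> {u, v, y} \<or> (y - 1) mod n \<in> {u, v, y}"
    unfolding is_mid_def by (rule conjunct1, rule conjunct2)
  have "(u + 1) mod n \<in> {u, v, y}" using assms(2) by simp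
  with 2 have adj: "(y + 1) mod n \<in> {u, v, y} \<or> (y - 1) mod n \<in> {u, v, y}" by (meson insertI1)
  from 1 obtain p q where pq: "{u, v, y} = {y, p, q}" "ahead y p" "ahead q y" by (elim exE conjE)
  have "p \<noteq> y" "q \<noteq> y" using pq by (auto simp: ahead_def)
  have "p \<noteq> q"
  proof
    assume "p = q"
    then have "card {u, v, y} \<le> 2" unfolding pq(1) by (simp add: card_insert_if)
    then show False using assms(4,5) vu by simp
  qed
  have "p \<in> {u, v, y}" "q \<in> {u, v, y}" using pq(1) by auto
  then have "p = u \<and> q = v \<or> p = v \<and> q = u" using \<open>p \<noteq> y\<close> \<open>q \<noteq> y\<close> \<open>p \<noteq> q\<close> by auto
  moreover have "ahead y u = (\<not> ahead u y)" "ahead y v = (\<not> ahead v y)"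
    using ahead_flip[OF assms(1,3)] ahead_flip[OF vR assms(3)] assms(4,5) by simp_all
  ultimately have "ahead u y \<noteq> ahead v y" using pq(2,3) by auto
  from ahead_succ(3)[OF assms this] adj succ_neq[OF assms(3)] show False by auto
qed

lemma cube_eq:
  assumes "m \<noteq> y" "m \<noteq> z" "y \<noteq> z"
  shows "cube {m, y, z} = {{(m, a), (y, b), (z, c)} | a b c. True}"
proof (intro equalityI subsetI)
  fix t assume t: "t \<in> cube {m, y, z}"
  then have t3: "card t = 3" and f: "fst ` t = {m, y, z}" by (auto simp: cube_def)
  have "m \<in> fst ` t" "y \<in> fst ` t" "z \<in> fst ` t" using f by auto
  then obtain a b c where abc: "(m, a) \<in> t" "(y, b) \<in> t" "(z, c) \<in> t" by force
  have "finite t" using t3 by (auto intro: card_ge_0_finite)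
  moreover have "card {(m, a), (y, b), (z, c)} = 3" using assms by simp
  ultimately have "{(m, a), (y, b), (z, c)} = t" using abc t3 by (intro card_subset_eq) auto
  then show "t \<in> {{(m, a), (y, b), (z, c)} | a b c. True}" by blast
qed (use assms in \<open>auto simp: cube_def\<close>)

text \<open>Since one arrow enters the mid and one leaves it, its prescribed bits with the two other
  residues differ. Equal bits would make the four prescribed edges the boundary of a face, which no
  Hamilton cycle of the cube contains.\<close>

lemma cube_trail:
  assumes "T \<subseteq> R" "card T = 3"
  shows "closed_trail (cube T) (cube_labels T)"
proof -
  obtain y z where T: "T = {mid T, y, z}" "ahead (mid T) y" "ahead z (mid T)"
    using mid_is_mid[OF assms] unfolding is_mid_def by blast
  define m where "m = mid T"
  have dist: "m \<noteq> y" "m \<noteq> z" "y \<noteq> z"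
    using T assms(2) unfolding m_def[symmetric] by (auto simp: card_insert_if split: if_splits)
  have R: "m \<in> R" "y \<in> R" "z \<in> R" using T assms(1) unfolding m_def by auto
  have ah: "ahead m y" "\<not> ahead m z" using T ahead_flip[OF R(1,3)] dist by (auto simp: m_def)
  define B where "B a b c = {(m, a), (y, b), (z, c)}" for a b c :: bool
  define my mz yz where "my a b = {(m, a), (y, b)}" and "mz a c = {(m, a), (z, c)}"
    and "yz b c = {(y, b), (z, c)}" for a b c :: bool
  have c2: "card (my a b) = 2" "card (mz a c) = 2" "card (yz b c) = 2" for a b c
    by (simp_all add: my_def mz_def yz_def dist)
  have sub: "my a b \<subseteq> B a b c" "mz a c \<subseteq> B a b c" "yz b c \<subseteq> B a b c" for a b c
    by (auto simp: my_def mz_def yz_def B_def)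
  \<comment> \<open>This cycle uses all four edges that flip the bit of \<open>m\<close>; it flips
    the bit of \<open>z\<close> where that of \<open>m\<close> is \<open>False\<close>, and the bit
    of \<open>y\<close> where it is \<open>True\<close>.\<close>
  define xs where "xs = [B False False False, B True False False, B True True False, B False True False,
    B False True True, B True True True, B True False True, B False False True]"
  define S where "S = {my False False, yz False False, mz True False, yz True False,
    my False True, yz True True, mz True True, yz False True}"
  have w: "walk (my False False) xs S (my False False)"
    unfolding xs_def S_def
    by (rule walk.Cons[OF c2(1) sub(1) sub(3)], rule walk.Cons[OF c2(3) sub(3) sub(2)],
        rule walk.Cons[OF c2(2) sub(2) sub(3)], rule walk.Cons[OF c2(3) sub(3) sub(1)],
        rule walk.Cons[OF c2(1) sub(1) sub(3)], rule walk.Cons[OF c2(3) sub(3) sub(2)],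
        rule walk.Cons[OF c2(2) sub(2) sub(3)], rule walk.Cons[OF c2(3) sub(3) sub(1)], rule walk.Nil)
  have inj: "B a b c = B a' b' c' \<longleftrightarrow> a = a' \<and> b = b' \<and> c = c'" for a b c a' b' c'
  proof
    have mem: "(m, e) \<in> B a b c \<longleftrightarrow> e = a" "(y, e) \<in> B a b c \<longleftrightarrow> e = b" "(z, e) \<in> B a b c \<longleftrightarrow> e = c" for a b c e
      using dist by (auto simp: B_def)
    assume "B a b c = B a' b' c'"
    then show "a = a' \<and> b = b' \<and> c = c'" using mem by metis
  qed simp
  have "distinct xs" by (simp add: xs_def inj)
  moreover have "set xs = cube T"
  proof -
    have "cube T = {B a b c | a b c. True}"
      using cube_eq[OF dist] T(1) unfolding B_def m_def[symmetric] by simp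
    also have "\<dots> = set xs"
      unfolding xs_def by (auto simp: ex_bool_eq)
    finally show ?thesis by simp
  qed
  moreover have "cube_labels T \<subseteq> S"
  proof
    fix l assume "l \<in> cube_labels T"
    then obtain u w a c where l: "l = {(u, a), (w, c)}" "u \<in> {m, y, z}" "w \<in> {m, y, z}" "u \<noteq> w"
      "u = m \<longrightarrow> a = (\<not> ahead u w)" "w = m \<longrightarrow> c = (\<not> ahead w u)"
      unfolding cube_labels_def using T(1) unfolding m_def[symmetric] by blast
    have sym: "my a b = {(y, b), (m, a)}" "mz a c = {(z, c), (m, a)}" "yz b c = {(z, c), (y, b)}" for a b c
      by (auto simp: my_def mz_def yz_def)
    have all: "yz b c \<in> S" "my False b \<in> S" "mz True c \<in> S" for b c
      by (cases b; cases c; simp add: S_def)+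
    consider "u = m" "w = y" | "u = m" "w = z" | "u = y" "w = m" | "u = y" "w = z"
      | "u = z" "w = m" | "u = z" "w = y" using l by auto
    then show "l \<in> S"
    proof cases
      case 1 then show ?thesis using l ah all(2)[of c] by (simp add: my_def)
    next
      case 2 then show ?thesis using l ah all(3)[of c] by (simp add: mz_def)
    next
      case 3 then show ?thesis using l ah all(2)[of a] by (simp add: sym)
    next
      case 4 then show ?thesis using l all(1)[of a c] by (simp add: yz_def)
    next
      case 5 then show ?thesis using l ah all(3)[of a] by (simp add: sym)
    next
      case 6 then show ?thesis using l all(1)[of c a] by (simp add: sym)
    qed
  qed
  ultimately show ?thesis using w unfolding closed_trail_def by blast
qed

text \<open>The pair depends on \<open>u\<close> and \<open>w\<close> alone, so all cubes over two
  common residues can be merged there.\<close>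

lemma canonical_label:
  assumes "u \<in> T" "w \<in> T" "u \<noteq> w"
  shows "{(u, \<not> ahead u w), (w, \<not> ahead w u)} \<in> cube_labels T"
  using assms unfolding cube_labels_def by blast

text \<open>As \<open>y\<close> is not the mid, its bit is free: the cube has a label through either
  copy of \<open>y\<close>. This attaches the pivot trails.\<close>

lemma adjacent_label:
  assumes "x \<in> R" "y \<in> R" "e = 1 \<or> e = -1" "x' = (x + e) mod n" "x \<noteq> y" "x' \<noteq> y"
  shows "\<exists>a. {(x, a), (y, b)} \<in> cube_labels {x, x', y}"
proof -
  have mid_neq: "mid {x, x', y} \<noteq> y"
    using assms(3)
  proof
    assume "e = 1"
    then show ?thesis using mid_adjacent[of x x' y] assms by auto
  next
    assume e: "e = -1"
    have "mid {x', x, y} \<noteq> y"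
    proof (rule mid_adjacent)
      show "x' \<in> R" using assms(4) by simp
      show "x = (x' + 1) mod n" using pred_succ(2)[OF assms(1)] e assms(4) by simp
    qed (use assms in simp_all)
    then show ?thesis by (simp add: insert_commute)
  qed
  have "{(x, \<not> ahead x y), (y, b)} \<in> cube_labels {x, x', y}"
    unfolding cube_labels_def
    by (rule CollectI, rule exI[of _ x], rule exI[of _ y], rule exI[of _ "\<not> ahead x y"], rule exI[of _ b])
      (use mid_neq assms(5) in auto)
  then show ?thesis by blast
qed

section \<open>Closed trails at the pivots\<close>

text \<open>The blocks of colour \<open>s\<close> in which the point \<open>p\<close> has the residue that occurs only once
  in the colour sum form a path from \<open>{(-1, False), p}\<close> to \<open>{(-1, True), p}\<close>.\<close>

definition pivot_path :: "int \<times> bool \<Rightarrow> int \<Rightarrow> (int \<times> bool) set list" where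
  "pivot_path p s = (let x = half (s - fst p); a = (ahead x (fst p) \<noteq> snd p) in
     if n dvd 3 * fst p - s then [{(-1, False), (-1, True), p}]
     else [{(-1, False), (x, a), p}, {(x, False), (x, True), p}, {(-1, True), (x, \<not> a), p}])"

definition pivot_labels :: "int \<times> bool \<Rightarrow> int set \<Rightarrow> (int \<times> bool) set set" where
  "pivot_labels p E = {{(-1, i), p} | i. True} \<union>
     {{(half (s - fst p), a), p} | s a. s \<in> E \<and> \<not> n dvd 3 * fst p - s}"

lemma inf_not_R [simp]: "x \<in> R \<Longrightarrow> -1 \<noteq> x"
  by (auto simp: R_def)

text \<open>The doubled residue meets the pivot exactly for the colour \<open>3 y\<close>; there the
  path shrinks to the block with both infinite points.\<close>

lemma half_eq_iff:
  assumes "y \<in> R" shows "half (s - y) = y \<longleftrightarrow> n dvd 3 * y - s"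
proof
  assume "half (s - y) = y"
  then show "n dvd 3 * y - s" using half_double[of "s - y"] by (simp add: algebra_simps)
next
  assume "n dvd 3 * y - s"
  then have "n dvd (2 * half (s - y) - (s - y)) - (3 * y - s)" using half_double by (rule dvd_diff[rotated])
  then have "n dvd 2 * (half (s - y) - y)" by (simp add: algebra_simps)
  then show "half (s - y) = y" using coprime2 eq_R[OF half_R assms] by blast
qed

lemma pivot_path_walk:
  assumes y: "y \<in> R" and p: "p = (y, b)"
  shows "\<exists>S. walk {(-1, False), p} (pivot_path p s) S {(-1, True), p} \<and>
    insert {(-1, True), p} S \<supseteq> pivot_labels p {s}"
proof -
  define x where "x = half (s - y)"
  define a where "a = (ahead x y \<noteq> b)"
  have inf: "card {(-1, i), p} = 2" for i using y p by auto
  show ?thesis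
  proof (cases "n dvd 3 * y - s")
    case True
    have "walk {(-1, False), p} [{(-1, False), (-1, True), p}] {{(-1, False), p}} {(-1, True), p}"
      by (rule walk.Cons[OF _ _ _ walk.Nil]) (use inf in auto)
    moreover have "insert {(-1, True), p} {{(-1, False), p}} \<supseteq> pivot_labels p {s}"
      using True p by (auto simp: pivot_labels_def)
    ultimately show ?thesis using True p by (auto simp: pivot_path_def)
  next
    case False
    have xy: "x \<noteq> y" using half_eq_iff[OF y, of s] False by (simp add: x_def)
    have c: "card {(x, e), p} = 2" for e using xy p by auto
    have "walk {(-1, False), p} [{(-1, False), (x, a), p}, {(x, False), (x, True), p}, {(-1, True), (x, \<not> a), p}]
      {{(-1, False), p}, {(x, a), p}, {(x, \<not> a), p}} {(-1, True), p}"
      by (rule walk.Cons[where q = "{(x, a), p}"], use inf in simp, blast, blast,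
          rule walk.Cons[where q = "{(x, \<not> a), p}"], rule c, (cases a; simp), (cases a; simp),
          rule walk.Cons[OF _ _ _ walk.Nil], rule c, blast, blast)
    moreover have "insert {(-1, True), p} {{(-1, False), p}, {(x, a), p}, {(x, \<not> a), p}} \<supseteq> pivot_labels p {s}"
      (is "?Z \<supseteq> _")
    proof -
      have "{(-1, i), p} \<in> ?Z" for i by (cases i) simp_all
      then have "range (\<lambda>i. {(-1, i), p}) \<subseteq> ?Z" by (rule image_subsetI)
      moreover have "{(x, e), p} \<in> ?Z" for e by (cases e; cases a) simp_all
      then have "range (\<lambda>e. {(x, e), p}) \<subseteq> ?Z" by (rule image_subsetI)
      moreover have "pivot_labels p {s} \<subseteq> range (\<lambda>i. {(-1, i), p}) \<union> range (\<lambda>e. {(x, e), p})"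
        unfolding pivot_labels_def p x_def by auto
      ultimately show ?thesis by (meson Un_least order_trans)
    qed
    moreover have "pivot_path p s = [{(-1, False), (x, a), p}, {(x, False), (x, True), p}, {(-1, True), (x, \<not> a), p}]"
      using False p by (simp add: pivot_path_def x_def a_def Let_def)
    ultimately show ?thesis by (simp only:) (rule exI, rule conjI)
  qed
qed

lemma pivot_path_block:
  assumes p: "p = (y, b)" "y \<in> R" and s: "0 \<le> s" "s < n" and t: "t \<in> set (pivot_path p s)"
  shows "t \<in> blocks k \<longleftrightarrow> s < k"
proof (cases "n dvd 3 * y - s")
  case True
  then have "t = {(-1, False), (-1, True), (y, b)}" using t p by (simp add: pivot_path_def)
  moreover have "colour (-1, False) (-1, True) (y, b) = s"
    using mod_eqI[OF True s] p by (simp add: colour_two_inf)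
  ultimately show ?thesis using p by (simp add: blocks_iff)
next
  case False
  define x where "x = half (s - y)"
  define a where "a = (ahead x y \<noteq> b)"
  have x: "x \<in> R" "x \<noteq> y" "n dvd (2 * x + y - s)"
    using half_double[of "s - y"] half_eq_iff[OF p(2), of s] False by (simp_all add: x_def algebra_simps)
  note m = mod_eqI[OF x(3) s]
  have "t = {(-1, False), (x, a), (y, b)} \<or> t = {(x, False), (x, True), (y, b)} \<or> t = {(-1, True), (x, \<not> a), (y, b)}"
    using t p False by (auto simp: pivot_path_def x_def a_def Let_def)
  then show ?thesis
  proof (elim disjE)
    assume t: "t = {(-1, False), (x, a), (y, b)}"
    have "colour (-1, False) (x, a) (y, b) = s"
      using m x p by (cases b; cases "ahead x y") (simp_all add: colour_one_inf colour_inf_def a_def)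
    then show ?thesis using t x p by (simp add: blocks_iff)
  next
    assume t: "t = {(x, False), (x, True), (y, b)}"
    have "colour (x, False) (x, True) (y, b) = s"
      using m x p by (simp add: colour_finite)
    then show ?thesis using t x p by (simp add: blocks_iff)
  next
    assume t: "t = {(-1, True), (x, \<not> a), (y, b)}"
    have "colour (-1, True) (x, \<not> a) (y, b) = s"
      using m x p by (cases b; cases "ahead x y") (simp_all add: colour_one_inf colour_inf_def a_def)
    then show ?thesis using t x p by (simp add: blocks_iff)
  qed
qed

text \<open>Membership in \<open>blocks k\<close> for all \<open>k\<close> determines the colour, so
  no comparison of shapes is needed.\<close>

lemma pivot_path_colour:
  assumes "p = (y, b)" "y \<in> R" "0 \<le> s" "s < n" "t \<in> set (pivot_path p s)"
    and "p' = (y', b')" "y' \<in> R" "0 \<le> s'" "s' < n" "t \<in> set (pivot_path p' s')"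
  shows "s = s'"
  using pivot_path_block[OF assms(1-5)] pivot_path_block[OF assms(6-10)]
  by (metis less_irrefl linorder_neqE_linordered_idom)

lemma pivot_path_disjoint:
  assumes "p = (y, b)" "y \<in> R" "s \<in> {0..<n}" "s' \<in> {0..<n}" "s \<noteq> s'"
  shows "set (pivot_path p s) \<inter> set (pivot_path p s') = {}"
proof -
  have "s = s'" if "t \<in> set (pivot_path p s)" "t \<in> set (pivot_path p s')" for t
    by (rule pivot_path_colour[OF assms(1,2) _ _ that(1) assms(1,2) _ _ that(2)]) (use assms in auto)
  then show ?thesis using assms(5) by blast
qed

lemma pivot_path_shape:
  assumes p: "p = (y, b)" "y \<in> R" and t: "t \<in> set (pivot_path p s)"
  obtains "t = {(-1, False), (-1, True), p}"
  | x i a where "x \<in> R" "x \<noteq> y" "n dvd (2 * x + y - s)" "t = {(-1, i), (x, a), p}"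
  | x where "x \<in> R" "x \<noteq> y" "n dvd (2 * x + y - s)" "t = {(x, False), (x, True), p}"
proof (cases "n dvd 3 * y - s")
  case True
  then have "t = {(-1, False), (-1, True), p}" using t p by (simp add: pivot_path_def)
  then show thesis by (rule that(1))
next
  case False
  define x where "x = half (s - y)"
  have x: "x \<in> R" "x \<noteq> y" "n dvd (2 * x + y - s)"
    using half_double[of "s - y"] half_eq_iff[OF p(2), of s] False by (simp_all add: x_def algebra_simps)
  have "(\<exists>i a. t = {(-1, i), (x, a), p}) \<or> t = {(x, False), (x, True), p}"
    using t p False by (auto simp: pivot_path_def x_def Let_def)
  then show thesis using that(2,3) x by blast
qed

text \<open>Without an infinite point the pivot has the residue that occurs once. With one infinite
  point, two pivots \<open>x\<close> and \<open>y\<close> would give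
  \<open>2 x + y = 2 y + x\<close> modulo \<open>n\<close>, hence \<open>x = y\<close>.\<close>

lemma pivot_path_pivot:
  assumes p: "p = (y, b)" "y \<in> R" and t: "t \<in> set (pivot_path p s)"
    and p': "p' = (y', b')" "y' \<in> R" and t': "t \<in> set (pivot_path p' s)"
  shows "p = p'"
proof (rule ccontr)
  assume neq: "p \<noteq> p'"
  from pivot_path_shape[OF p t] have pt: "p \<in> t" by cases simp_all
  from pivot_path_shape[OF p' t'] have pt': "p' \<in> t" by cases simp_all
  from pivot_path_shape[OF p t] show False
  proof cases
    case 1
    then show ?thesis using pt' neq p'(2) p' by auto
  next
    case (2 x i a)
    then have "p' = (x, a)" using pt' neq p' by auto
    from pivot_path_shape[OF p' t'] show False
    proof cases
      case 1
      then show False using pt neq p by auto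
    next
      case (2 x' i' a')
      then have "p = (x', a')" using pt neq p by auto
      then have "n dvd 2 * x + y - s" "n dvd 2 * y + x - s"
        using \<open>n dvd 2 * x + y - s\<close> 2 \<open>p' = (x, a)\<close> p p' by auto
      then have "n dvd (2 * x + y - s) - (2 * y + x - s)" by (rule dvd_diff)
      then have "n dvd x - y" by (simp add: algebra_simps)
      then show False using eq_R[OF \<open>x \<in> R\<close> p(2)] \<open>x \<noteq> y\<close> by simp
    next
      case (3 x')
      have "(-1, i) \<in> t" using \<open>t = {(-1, i), (x, a), p}\<close> by simp
      then show False using 3 p' by auto
    qed
  next
    case (3 x)
    then have px: "y' = x" using pt' neq p' by auto
    from pivot_path_shape[OF p' t'] show False
    proof cases
      case 1
      have "(-1, True) \<in> t" using 1 by simp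
      then show False using 3 p by auto
    next
      case (2 x' i' a')
      have "(-1, i') \<in> t" using 2 by simp
      then show False using 3 p by auto
    next
      case c3: (3 x')
      then have "x' = y" using pt neq p by auto
      moreover have "(x', \<not> b) \<in> t" using c3 by (cases b) auto
      ultimately have "(y, \<not> b) \<in> t" by simp
      then show False using 3 p by auto
    qed
  qed
qed

lemma pivot_path_distinct:
  assumes "p = (y, b)" "y \<in> R" shows "distinct (pivot_path p s)"
proof (cases "n dvd 3 * y - s")
  case True
  then show ?thesis using assms by (simp add: pivot_path_def)
next
  case False
  define x where "x = half (s - y)"
  have xR: "x \<in> R" by (simp add: x_def)
  have "{(-1, False), (x, e), p} \<noteq> {(x, False), (x, True), p}" for e
  proof
    assume "{(-1, False), (x, e), p} = {(x, False), (x, True), p}"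
    then have "(-1, False) \<in> {(x, False), (x, True), p}" by blast
    then show False using xR assms by auto
  qed
  moreover have "{(-1, True), (x, e), p} \<noteq> {(x, False), (x, True), p}" for e
  proof
    assume "{(-1, True), (x, e), p} = {(x, False), (x, True), p}"
    then have "(-1, True) \<in> {(x, False), (x, True), p}" by blast
    then show False using xR assms by auto
  qed
  moreover have "{(-1, False), (x, e), p} \<noteq> {(-1, True), (x, e'), p}" for e e'
  proof
    assume "{(-1, False), (x, e), p} = {(-1, True), (x, e'), p}"
    then have "(-1, False) \<in> {(-1, True), (x, e'), p}" by blast
    then show False using xR assms by auto
  qed
  ultimately show ?thesis using False assms by (simp add: pivot_path_def x_def Let_def) metis
qed

lemma pivot_trail2:
  assumes p: "p = (y, b)" "y \<in> R" and s: "s \<in> {0..<n}" "s' \<in> {0..<n}" "s \<noteq> s'"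
  shows "closed_trail (set (pivot_path p s) \<union> set (pivot_path p s')) (pivot_labels p {s, s'})"
proof -
  obtain S where S: "walk {(-1, False), p} (pivot_path p s) S {(-1, True), p}"
    "insert {(-1, True), p} S \<supseteq> pivot_labels p {s}"
    using pivot_path_walk[OF p(2,1)] by blast
  obtain S1 where S1: "walk {(-1, False), p} (pivot_path p s') S1 {(-1, True), p}"
    "insert {(-1, True), p} S1 \<supseteq> pivot_labels p {s'}"
    using pivot_path_walk[OF p(2,1)] by blast
  have "card {(-1, True), p} = 2" using p by auto
  from walk_rev[OF S1(1) this] obtain S2 where S2: "walk {(-1, True), p} (rev (pivot_path p s')) S2 {(-1, False), p}"
    "insert {(-1, False), p} S2 = insert {(-1, True), p} S1" by blast
  have w: "walk {(-1, False), p} (pivot_path p s @ rev (pivot_path p s')) (S \<union> S2) {(-1, False), p}"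
    by (rule walk_append[OF S(1) S2(1)])
  \<comment> \<open>Each path starts at the end pair that the label bound of the other one has to
    insert.\<close>
  have F: "{(-1, False), p} \<in> S"
    using S(1) p by (auto simp: pivot_path_def Let_def split: if_splits elim: walk.cases)
  have T: "{(-1, True), p} \<in> S2"
  proof -
    have "rev (pivot_path p s') \<noteq> []" by (simp add: pivot_path_def Let_def)
    then show ?thesis using S2(1) by (auto elim: walk.cases)
  qed
  have "pivot_labels p {s} \<subseteq> S \<union> S2"
    by (rule order_trans[OF S(2)]) (use T in simp)
  moreover have "pivot_labels p {s'} \<subseteq> S \<union> S2"
    by (rule order_trans[OF S1(2)[folded S2(2)]]) (use F in simp)
  moreover have "pivot_labels p {s, s'} = pivot_labels p {s} \<union> pivot_labels p {s'}"
    by (auto simp: pivot_labels_def)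
  ultimately have "pivot_labels p {s, s'} \<subseteq> S \<union> S2" by simp
  moreover have "set (pivot_path p s) \<inter> set (pivot_path p s') = {}"
    by (rule pivot_path_disjoint[OF p s])
  ultimately show ?thesis unfolding closed_trail_def using w pivot_path_distinct[OF p]
    by (intro exI[of _ "{(-1, False), p}"] exI[of _ "pivot_path p s @ rev (pivot_path p s')"] exI[of _ "S \<union> S2"]) auto
qed

lemma pivot_trail:
  assumes p: "p = (y, b)" "y \<in> R"
  shows "finite E \<Longrightarrow> even (card E) \<Longrightarrow> E \<noteq> {} \<Longrightarrow> E \<subseteq> {0..<n} \<Longrightarrow>
    closed_trail (\<Union>s\<in>E. set (pivot_path p s)) (pivot_labels p E)"
proof (induction "card E" arbitrary: E rule: less_induct)
  case less
  obtain s where s: "s \<in> E" using less.prems by blast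
  have "card E \<noteq> 1" using less.prems by auto
  then have "E \<noteq> {s}" by auto
  then obtain s' where s': "s' \<in> E" "s' \<noteq> s" using s by blast
  have two: "closed_trail (set (pivot_path p s) \<union> set (pivot_path p s')) (pivot_labels p {s, s'})"
    by (rule pivot_trail2[OF p]) (use s s' less.prems in auto)
  define F where "F = E - {s, s'}"
  have E: "E = insert s (insert s' F)" "s \<notin> F" "s' \<notin> F" using s s' by (auto simp: F_def)
  have F: "finite F" "card E = Suc (Suc (card F))"
  proof -
    show "finite F" using less.prems by (simp add: F_def)
    then show "card E = Suc (Suc (card F))" unfolding E(1) using E(2,3) s'(2) by simp
  qed
  show ?case
  proof (cases "F = {}")
    case True
    then show ?thesis using two E by simp
  next
    case False
    have IH: "closed_trail (\<Union>s\<in>F. set (pivot_path p s)) (pivot_labels p F)"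
    proof (rule less.hyps)
      show "card F < card E" "even (card F)" using F(2) less.prems(2) by simp_all
      show "F \<subseteq> {0..<n}" using less.prems(4) by (auto simp: F_def)
    qed (use F False in simp_all)
    have d: "set (pivot_path p u) \<inter> set (pivot_path p t) = {}" if "u \<in> {s, s'}" "t \<in> F" for u t
      by (rule pivot_path_disjoint[OF p]) (use that E less.prems(4) in auto)
    have "(set (pivot_path p s) \<union> set (pivot_path p s')) \<inter> (\<Union>t\<in>F. set (pivot_path p t)) =
      (\<Union>t\<in>F. set (pivot_path p s) \<inter> set (pivot_path p t)) \<union> (\<Union>t\<in>F. set (pivot_path p s') \<inter> set (pivot_path p t))"
      by blast
    also have "\<dots> = {}" using d by simp
    finally have "(set (pivot_path p s) \<union> set (pivot_path p s')) \<inter> (\<Union>s\<in>F. set (pivot_path p s)) = {}" .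
    moreover have "{(-1, True), p} \<in> pivot_labels p {s, s'} \<inter> pivot_labels p F"
      by (auto simp: pivot_labels_def)
    ultimately have "closed_trail ((set (pivot_path p s) \<union> set (pivot_path p s')) \<union> (\<Union>s\<in>F. set (pivot_path p s)))
      (pivot_labels p {s, s'} \<union> pivot_labels p F)"
      by (intro closed_trail_merge[OF two IH]) blast+
    moreover have "pivot_labels p {s, s'} \<union> pivot_labels p F = pivot_labels p E"
      unfolding E(1) by (auto simp: pivot_labels_def)
    ultimately show ?thesis unfolding E(1) by (simp add: Un_assoc)
  qed
qed

end

section \<open>Connectedness of the trails\<close>

lemma constant_on_interval:
  fixes P :: "int \<Rightarrow> bool"
  assumes step: "\<And>i. a \<le> i \<Longrightarrow> i < b \<Longrightarrow> P i = P (i + 1)"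
    and i: "a \<le> i" "i \<le> b" and j: "a \<le> j" "j \<le> b"
  shows "P i = P j"
proof -
  have "P i = P a" if "a \<le> i" "i \<le> b" for i
    using that
  proof (induction i rule: int_ge_induct)
    case (step i)
    then show ?case using assms(1)[of i] by simp
  qed simp
  then show ?thesis using i j by metis
qed

context coloured_triples
begin

definition cube_index :: "int \<Rightarrow> int set set" where
  "cube_index k = {T. T \<subseteq> R \<and> card T = 3 \<and> \<Sum>T mod n < k}"

text \<open>For odd \<open>k\<close> one colour is left out at every point, so that the remaining pivot paths
  can be closed up in pairs.\<close>

definition used_colours :: "int \<Rightarrow> int \<Rightarrow> int set" where
  "used_colours k y = (if even k then {0..<k}
     else {0..<k} - {if (3 * y) mod n < k then (3 * y) mod n else 1})"

definition trail_index :: "int \<Rightarrow> (int set + int \<times> bool) set" where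
  "trail_index k = Inl ` cube_index k \<union> Inr ` {p. fst p \<in> R}"

definition trail_blocks :: "int \<Rightarrow> int set + int \<times> bool \<Rightarrow> (int \<times> bool) set set" where
  "trail_blocks k = case_sum cube (\<lambda>p. \<Union>s\<in>used_colours k (fst p). set (pivot_path p s))"

definition trail_labels :: "int \<Rightarrow> int set + int \<times> bool \<Rightarrow> (int \<times> bool) set set" where
  "trail_labels k = case_sum cube_labels (\<lambda>p. pivot_labels p (used_colours k (fst p)))"

lemma cube_indexI:
  assumes "x \<in> R" "y \<in> R" "z \<in> R" "x \<noteq> y" "x \<noteq> z" "y \<noteq> z" "n dvd (x + y + z - s)" "0 \<le> s" "s < k" "k \<le> n"
  shows "{x, y, z} \<in> cube_index k"
proof -
  have "(x + y + z) mod n = s" by (rule mod_eqI) (use assms in auto)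
  then show ?thesis using assms by (simp add: cube_index_def add.assoc)
qed

lemma cube_indexE:
  assumes "T \<in> cube_index k" "u \<in> T" "w \<in> T" "u \<noteq> w"
  obtains z s where "z \<in> R" "T = {u, w, z}" "z \<noteq> u" "z \<noteq> w" "n dvd (u + w + z - s)" "0 \<le> s" "s < k"
proof -
  have T: "T \<subseteq> R" "card T = 3" "\<Sum>T mod n < k" using assms(1) by (auto simp: cube_index_def)
  then have "card (T - {u, w}) = 1" using assms by (simp add: card_Diff_subset)
  then obtain z where z: "T - {u, w} = {z}" by (rule card_1_singletonE)
  then have Tz: "T = {u, w, z}" "z \<noteq> u" "z \<noteq> w" using assms by auto
  have "\<Sum>T = u + w + z" using Tz assms(4) by simp
  then have "n dvd (u + w + z - \<Sum>T mod n)" using mod_sub_dvd[of "\<Sum>T"] by (simp add: dvd_diff_commute)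
  moreover have "z \<in> R" using Tz T by auto
  moreover have "0 \<le> \<Sum>T mod n" using n5 by simp
  ultimately show thesis using that Tz T(3) by blast
qed

lemma cube_indexD: "T \<in> cube_index k \<Longrightarrow> T \<subseteq> R" "T \<in> cube_index k \<Longrightarrow> card T = 3"
  by (auto simp: cube_index_def)

lemma used_colours_even:
  assumes "2 \<le> k" "k \<le> n" "y \<in> R"
  shows "finite (used_colours k y)" "even (card (used_colours k y))" "used_colours k y \<noteq> {}"
    "used_colours k y \<subseteq> {0..<k}"
proof -
  show "finite (used_colours k y)" "used_colours k y \<subseteq> {0..<k}" by (auto simp: used_colours_def)
  show "even (card (used_colours k y))"
  proof (cases "even k")
    case True
    then show ?thesis using assms by (simp add: used_colours_def even_nat_iff)
  next
    case False
    then have "3 \<le> k" using assms(1) by (cases "k = 2") auto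
    \<comment> \<open>The dropped colour does lie below \<open>k\<close>, so dropping it makes the
      number of colours even.\<close>
    define c where "c = (if (3 * y) mod n < k then (3 * y) mod n else 1)"
    have "c \<in> {0..<k}" using \<open>3 \<le> k\<close> n5 by (simp add: c_def)
    then have "card (used_colours k y) = nat k - 1"
      using False by (simp add: used_colours_def c_def[symmetric])
    moreover have "odd (nat k)" using False assms by (simp add: even_nat_iff)
    ultimately show ?thesis by simp
  qed
  show "used_colours k y \<noteq> {}"
  proof (cases "even k")
    case True
    then show ?thesis using assms by (simp add: used_colours_def)
  next
    case False
    have "0 \<in> {0..<k} \<and> 1 \<in> {0..<k}" using assms by simp
    moreover have "{0, 1} - {c} \<noteq> ({} :: int set)" for c by auto
    ultimately show ?thesis using False unfolding used_colours_def by (metis (no_types, lifting) Diff_iff empty_iff insert_iff zero_neq_one)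
  qed
qed

text \<open>With \<open>x = (s - y) / 2\<close> the pivot path of colour \<open>s\<close> contains
  \<open>{(x, a), (y, b)}\<close>. Replacing one copy of \<open>x\<close> by \<open>x + e\<close>
  leads to residues with sum \<open>s + e\<close>, a cube of a neighbouring colour. The second
  condition of non-divisibility keeps \<open>x + e\<close> apart from \<open>y\<close>.\<close>

lemma adjacent_cube:
  assumes y: "y \<in> R" and s: "0 \<le> s" "s < k" and e: "e = 1 \<or> e = -1" "0 \<le> s + e" "s + e < k" and k: "k \<le> n"
    and nc: "\<not> n dvd 3 * y - s" and x': "\<not> n dvd 3 * y - s - 2 * e"
  shows "{half (s - y), (half (s - y) + e) mod n, y} \<in> cube_index k"
    "\<exists>a. {(half (s - y), a), (y, b)} \<in> cube_labels {half (s - y), (half (s - y) + e) mod n, y}"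
proof -
  define x where "x = half (s - y)"
  define z where "z = (x + e) mod n"
  have x: "x \<in> R" "x \<noteq> y" "n dvd (2 * x + y - s)"
    using half_double[of "s - y"] half_eq_iff[OF y, of s] nc by (simp_all add: x_def algebra_simps)
  have z: "z \<in> R" "n dvd z - (x + e)" using mod_sub_dvd by (simp_all add: z_def)
  have "z \<noteq> y"
  proof
    assume "z = y"
    then have "n dvd (2 * x + y - s) + 2 * (z - (x + e))" using x z by (intro dvd_add dvd_mult)
    then show False using x' \<open>z = y\<close> by (simp add: algebra_simps)
  qed
  have "z \<noteq> x" using succ_neq[OF x(1)] e(1) unfolding z_def by auto
  have "n dvd (2 * x + y - s) + (z - (x + e))" using x z by (intro dvd_add)
  then have "n dvd (x + z + y - (s + e))" by (simp add: algebra_simps)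
  then show "{half (s - y), (half (s - y) + e) mod n, y} \<in> cube_index k"
    unfolding x_def[symmetric] z_def[symmetric]
    by (rule cube_indexI[OF x(1) z(1) y, rotated 3]) (use x y z \<open>z \<noteq> y\<close> \<open>z \<noteq> x\<close> e k in auto)
  show "\<exists>a. {(half (s - y), a), (y, b)} \<in> cube_labels {half (s - y), (half (s - y) + e) mod n, y}"
    unfolding x_def[symmetric] z_def[symmetric]
    by (rule adjacent_label[OF x(1) y e(1) z_def x(2) \<open>z \<noteq> y\<close>])
qed

lemma not_dvd_small: "0 < \<bar>x\<bar> \<Longrightarrow> \<bar>x\<bar> < n \<Longrightarrow> \<not> n dvd x"
  using dvd_small[of x] by (auto simp: abs_less_iff)

lemma dvd_diff_small:
  assumes "n dvd a" "0 < \<bar>a - b\<bar>" "\<bar>a - b\<bar> < n" shows "\<not> n dvd b"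
  using not_dvd_small[OF assms(2,3)] dvd_diff[OF assms(1)] by blast

text \<open>Every pivot trail shares a pair with some cube.\<close>

lemma pivot_attached:
  assumes y: "y \<in> R" and k: "2 \<le> k" "k \<le> n"
  shows "\<exists>s e. s \<in> used_colours k y \<and> (e = 1 \<or> e = -1) \<and> 0 \<le> s + e \<and> s + e < k \<and>
    \<not> n dvd 3 * y - s \<and> \<not> n dvd 3 * y - s - 2 * e"
proof -
  \<comment> \<open>With \<open>c = 3 y\<close> modulo \<open>n\<close>, a choice of
    \<open>s\<close> and \<open>e\<close> fails just if \<open>c\<close> is congruent to
    \<open>s\<close> or \<open>s + 2 e\<close>. So \<open>(0, 1)\<close> excludes 0 and 2,
    \<open>(1, -1)\<close> excludes 1 and -1, and \<open>(1, 1)\<close> excludes 1 and 3.\<close>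
  define c where "c = (3 * y) mod n"
  have c: "n dvd (3 * y - c)" "0 \<le> c" "c < n"
    using mod_sub_dvd[of "3 * y"] n5 by (simp_all add: c_def dvd_diff_commute)
  have iff: "n dvd (3 * y - t) \<longleftrightarrow> n dvd (c - t)" for t
    using dvd_add_right_iff[OF c(1), of "c - t"] by simp
  have sm: "\<not> n dvd (c - t)" if "c \<noteq> t" "c - t < n" "t - c < n" for t
    using not_dvd_small[of "c - t"] that by auto
  show ?thesis
  proof (cases "even k")
    case True
    then have u: "used_colours k y = {0..<k}" by (simp add: used_colours_def)
    show ?thesis
    proof (cases "c = 0 \<or> c = 2")
      case True
      then have "\<not> n dvd (c - 1)" "\<not> n dvd (c - (-1))" using n5 sm[of 1] sm[of "-1"] by auto
      then show ?thesis using k u iff[of 1] iff[of "-1"] by - (rule exI[of _ 1], rule exI[of _ "-1"], auto simp: algebra_simps)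
    next
      case False
      then have "\<not> n dvd (c - 0)" "\<not> n dvd (c - 2)" using n5 c sm[of 0] sm[of 2] by auto
      then show ?thesis using k u iff[of 0] iff[of 2] by - (rule exI[of _ 0], rule exI[of _ 1], auto)
    qed
  next
    case odd: False
    then have k3: "3 \<le> k" using k by (cases "k = 2") auto
    have u: "used_colours k y = {0..<k} - {if c < k then c else 1}"
      using odd by (simp add: used_colours_def c_def)
    show ?thesis
    proof (cases "c < k \<and> c \<noteq> 1")
      case True
      then have 1: "1 \<in> used_colours k y" "\<not> n dvd (c - 1)" using k3 u c sm[of 1] n5 by simp_all
      show ?thesis
      proof (cases "c = n - 1")
        case True
        then have "\<not> n dvd (c - 3)" using n5 by (intro not_dvd_small) auto
        then show ?thesis using 1 k3 iff[of 1] iff[of 3] by - (rule exI[of _ 1], rule exI[of _ 1], auto)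
      next
        case False
        then have "\<not> n dvd (c - (-1))" using c by (intro not_dvd_small) auto
        then show ?thesis using 1 k3 iff[of 1] iff[of "-1"] by - (rule exI[of _ 1], rule exI[of _ "-1"], auto simp: algebra_simps)
      qed
    next
      case False
      then have "used_colours k y = {0..<k} - {1}" using u by (cases "c < k") simp_all
      then have "0 \<in> used_colours k y" using k3 by simp
      moreover have "k \<le> c \<or> c = 1" using False by auto
      then have "c \<noteq> 0" "c \<noteq> 2" using k3 by auto
      then have "\<not> n dvd (c - 0)" "\<not> n dvd (c - 2)" using n5 c sm[of 0] sm[of 2] by auto
      ultimately show ?thesis using k3 iff[of 0] iff[of 2] by - (rule exI[of _ 0], rule exI[of _ 1], auto)
    qed
  qed
qed

lemma pivot_label_mem:
  "s \<in> E \<Longrightarrow> \<not> n dvd 3 * y - s \<Longrightarrow> {(half (s - y), a), (y, b)} \<in> pivot_labels (y, b) E"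
  unfolding pivot_labels_def by auto

text \<open>Around a residue \<open>u\<close>, the cubes over \<open>u, w, z\<close> of colour
  \<open>s\<close> and over \<open>u, z, w + 1\<close> of colour \<open>s + 1\<close> meet in
  \<open>u, z\<close>. Thus membership in \<open>J\<close> passes from \<open>w\<close> to
  \<open>w + 1\<close>, unless \<open>z = u\<close>. For \<open>k \<ge> 3\<close> another
  \<open>s\<close> avoids this exception; for \<open>k = 2\<close> a pivot trail gets around
  it.\<close>

lemma trails_connected:
  assumes k: "2 \<le> k" "k \<le> n" and c0: "Inl {0, 1, n - 1} \<in> J" and J: "J \<subseteq> trail_index k"
    and closed: "\<And>c d. c \<in> J \<Longrightarrow> d \<in> trail_index k \<Longrightarrow> trail_labels k c \<inter> trail_labels k d \<noteq> {} \<Longrightarrow> d \<in> J"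
  shows "J = trail_index k"
proof -
  \<comment> \<open>Cubes over two common residues lie in \<open>J\<close> together or not at all,
    so \<open>J\<close> can be described by pairs of residues; the condition is vacuous for a pair
    in no cube.\<close>
  define good where "good u w \<longleftrightarrow> (\<forall>T\<in>cube_index k. u \<in> T \<and> w \<in> T \<longrightarrow> Inl T \<in> J)" for u w
  have cube_J: "T \<in> cube_index k" if "Inl T \<in> J" for T
    using that J by (auto simp: trail_index_def)
  have goodI: "good u w" if "Inl T \<in> J" "u \<in> T" "w \<in> T" "u \<noteq> w" for T u w
    unfolding good_def
  proof (intro ballI impI)
    fix T' assume T': "T' \<in> cube_index k" "u \<in> T' \<and> w \<in> T'"
    have "{(u, \<not> ahead u w), (w, \<not> ahead w u)} \<in> cube_labels T \<inter> cube_labels T'"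
      using canonical_label that T' by blast
    then show "Inl T' \<in> J" using that(1) T'(1)
      by (intro closed[of "Inl T" "Inl T'"]) (auto simp: trail_index_def trail_labels_def)
  qed
  have edge: "good u w = good u w'" if T: "T \<in> cube_index k" "u \<in> T" "w \<in> T" "w' \<in> T" "u \<noteq> w" "u \<noteq> w'" for T u w w'
  proof
    assume "good u w"
    then have "Inl T \<in> J" using T by (simp add: good_def)
    then show "good u w'" by (rule goodI) (use T in auto)
  next
    assume "good u w'"
    then have "Inl T \<in> J" using T by (simp add: good_def)
    then show "good u w" by (rule goodI) (use T in auto)
  qed
  have step: "good u w = good u w'"
    if u: "u \<in> R" and w: "w \<in> R" "w' = (w + 1) mod n" "u \<noteq> w" "u \<noteq> w'" and s: "0 \<le> s" "s + 1 < k"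
      and nd: "\<not> n dvd (s - 2 * u - w)" for u w w' s
  proof -
    define z where "z = (s - u - w) mod n"
    have z: "z \<in> R" "n dvd z - (s - u - w)" using mod_sub_dvd by (simp_all add: z_def)
    have w': "w' \<in> R" "n dvd w' - (w + 1)" "w \<noteq> w'"
      using mod_sub_dvd[of "w + 1"] succ_neq(1)[OF w(1)] by (auto simp: w(2))
    have zu: "z \<noteq> u"
    proof
      assume "z = u"
      then have "n dvd - (z - (s - u - w))" using z(2) by (simp only: dvd_minus_iff)
      then show False using nd \<open>z = u\<close> by (simp add: algebra_simps)
    qed
    have T1: "{u, w, z} \<in> cube_index k" if "z \<noteq> w"
      by (rule cube_indexI[OF u w(1) z(1), of s]) (use z(2) zu that w s k in \<open>auto simp: algebra_simps\<close>)
    have T2: "{u, z, w'} \<in> cube_index k" if "z \<noteq> w'"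
    proof (rule cube_indexI[OF u z(1) w'(1), of "s + 1"])
      show "n dvd (u + z + w' - (s + 1))" using dvd_add[OF z(2) w'(2)] by (simp add: algebra_simps)
    qed (use zu that w s k in auto)
    \<comment> \<open>If \<open>z\<close> coincides with \<open>w\<close> or \<open>w'\<close>, one
      of the two cubes is lost, but the other one is \<open>{u, w, w'}\<close> and contains both
      pairs.\<close>
    consider "z = w" | "z = w'" | "z \<noteq> w" "z \<noteq> w'" by blast
    then show ?thesis
    proof cases
      case 1
      then show ?thesis using edge[of "{u, w, w'}" u w w'] T2 w w' by simp
    next
      case 2
      then show ?thesis using edge[of "{u, w, w'}" u w w'] T1 w w' by simp
    next
      case 3
      have "good u w = good u z" by (rule edge[OF T1[OF 3(1)]]) (use zu w in auto)
      also have "good u z = good u w'" by (rule edge[OF T2[OF 3(2)]]) (use zu w in auto)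
      finally show ?thesis .
    qed
  qed
  \<comment> \<open>Offsets from \<open>u\<close> form the interval from 1 to \<open>n - 1\<close>;
    for the colours \<open>s\<close> and \<open>s + 1\<close> the passage from \<open>i\<close> to
    \<open>i + 1\<close> fails only for \<open>i\<close> congruent to
    \<open>s - 3 u\<close>.\<close>
  define g where "g u i = good u ((u + i) mod n)" for u i
  have offset: "\<exists>i. 1 \<le> i \<and> i \<le> n - 1 \<and> w = (u + i) mod n" if "u \<in> R" "w \<in> R" "u \<noteq> w" for u w
  proof (intro exI conjI)
    have "(w - u) mod n \<noteq> 0" using eq_R[OF that(2,1)] that(3) by (auto simp: dvd_eq_mod_eq_0)
    then show "1 \<le> (w - u) mod n" "(w - u) mod n \<le> n - 1"
      using n5 pos_mod_sign[of n "w - u"] pos_mod_bound[of n "w - u"] by linarith+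
    show "w = (u + (w - u) mod n) mod n" using that(2) by (simp add: mod_add_right_eq R_def)
  qed
  have gstep: "g u i = g u (i + 1)"
    if u: "u \<in> R" and i: "1 \<le> i" "i < n - 1" and s: "0 \<le> s" "s + 1 < k" and nd: "\<not> n dvd (s - 3 * u - i)" for u i s
    unfolding g_def
  proof (rule step[OF u _ _ _ _ s])
    have d: "n dvd (u + i) mod n - (u + i)" "n dvd (u + (i + 1)) mod n - (u + (i + 1))"
      by (rule mod_sub_dvd)+
    show "(u + (i + 1)) mod n = ((u + i) mod n + 1) mod n" by (simp add: mod_add_left_eq add.assoc)
    show "u \<noteq> (u + i) mod n"
    proof
      assume "u = (u + i) mod n"
      then have "n dvd u - (u + i)" using d(1) by simp
      then show False using not_dvd_small[of "-i"] i by simp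
    qed
    show "u \<noteq> (u + (i + 1)) mod n"
    proof
      assume "u = (u + (i + 1)) mod n"
      then have "n dvd u - (u + (i + 1))" using d(2) by simp
      then show False using not_dvd_small[of "-(i + 1)"] i by simp
    qed
    show "\<not> n dvd (s - 2 * u - (u + i) mod n)"
    proof
      assume "n dvd (s - 2 * u - (u + i) mod n)"
      from dvd_add[OF this d(1)] show False using nd by (simp add: algebra_simps)
    qed
  qed simp
  have attach: "Inr (u, b) \<in> J \<longleftrightarrow> Inl {half (s - u), (half (s - u) + e) mod n, u} \<in> J"
    if u: "u \<in> R" and s: "s \<in> used_colours k u" and e: "e = 1 \<or> e = -1" "0 \<le> s + e" "s + e < k"
      and nd: "\<not> n dvd 3 * u - s" "\<not> n dvd 3 * u - s - 2 * e" for u s e b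
  proof -
    have s': "0 \<le> s" "s < k" using s used_colours_even(4)[OF k u] by auto
    let ?T = "{half (s - u), (half (s - u) + e) mod n, u}"
    have T: "?T \<in> cube_index k" by (rule adjacent_cube(1)[OF u s' e k(2) nd])
    obtain a where "{(half (s - u), a), (u, b)} \<in> cube_labels ?T"
      using adjacent_cube(2)[OF u s' e k(2) nd] by blast
    moreover have "{(half (s - u), a), (u, b)} \<in> pivot_labels (u, b) (used_colours k u)"
      by (rule pivot_label_mem[OF s nd(1)])
    ultimately have sh: "trail_labels k (Inl ?T) \<inter> trail_labels k (Inr (u, b)) \<noteq> {}"
      by (auto simp: trail_labels_def)
    have I: "Inl ?T \<in> trail_index k" "Inr (u, b) \<in> trail_index k" using T u by (auto simp: trail_index_def)
    show ?thesis using closed[of "Inl ?T" "Inr (u, b)"] closed[of "Inr (u, b)" "Inl ?T"] sh I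
      by (auto simp: Int_commute)
  qed
  have all_good: "good u w"
    if u: "u \<in> R" and T0: "Inl T0 \<in> J" "u \<in> T0" and w: "w \<in> R" "u \<noteq> w" for u w T0
  proof -
    have T0R: "T0 \<subseteq> R" "card T0 = 3" using cube_J[OF T0(1)] cube_indexD by auto
    then have "\<not> T0 \<subseteq> {u}" using card_mono[of "{u}" T0] by auto
    then obtain w0 where w0: "w0 \<in> T0" "w0 \<noteq> u" by blast
    obtain i0 where i0: "1 \<le> i0" "i0 \<le> n - 1" "w0 = (u + i0) mod n"
      using offset[OF u, of w0] w0 T0R by auto
    have g0: "g u i0" unfolding g_def i0(3)[symmetric] by (rule goodI[OF T0 w0(1)]) (use w0 in auto)
    obtain i where i: "1 \<le> i" "i \<le> n - 1" "w = (u + i) mod n" using offset[OF u w] by auto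
    have "g u i"
    proof (cases "3 \<le> k")
      case True
      have "g u j = g u (j + 1)" if "1 \<le> j" "j < n - 1" for j
      \<comment> \<open>The offsets that block \<open>s = 0\<close> and \<open>s = 1\<close> differ
        by one, so each passage is possible for one of them.\<close>
      proof (cases "n dvd (0 - 3 * u - j)")
        case True
        then have "\<not> n dvd (1 - 3 * u - j)" by (rule dvd_diff_small) (use n5 in auto)
        then show ?thesis using gstep[OF u that, of 1] \<open>3 \<le> k\<close> by simp
      next
        case False
        then show ?thesis using gstep[OF u that, of 0] \<open>3 \<le> k\<close> by simp
      qed
      then show ?thesis using constant_on_interval[of 1 "n - 1" "g u" i i0] g0 i i0 by simp
    next
      case False
      then have k2: "k = 2" using k by simp
      \<comment> \<open>Only \<open>s = 0\<close> is available, so the interval of offsets is cut at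
        most once, between \<open>\<alpha>\<close> and \<open>\<alpha> + 1\<close>.\<close>
      define \<alpha> where "\<alpha> = (- 3 * u) mod n"
      have \<alpha>: "0 \<le> \<alpha>" "\<alpha> < n" "n dvd (\<alpha> + 3 * u)"
        using n5 mod_sub_dvd[of "- 3 * u"] by (simp_all add: \<alpha>_def)
      have st: "g u j = g u (j + 1)" if "1 \<le> j" "j < n - 1" "j \<noteq> \<alpha>" for j
      proof (rule gstep[OF u that(1,2), of 0])
        show "\<not> n dvd (0 - 3 * u - j)"
        proof
          assume "n dvd (0 - 3 * u - j)"
          from dvd_add[OF this \<alpha>(3)] have "n dvd (\<alpha> - j)" by (simp add: algebra_simps)
          then show False using not_dvd_small[of "\<alpha> - j"] that \<alpha> by auto
        qed
      qed (use k2 in auto)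
      have left: "g u a = g u b" if "1 \<le> a" "a \<le> \<alpha>" "1 \<le> b" "b \<le> \<alpha>" "a \<le> n - 1" "b \<le> n - 1" for a b
        using constant_on_interval[of 1 \<alpha> "g u" a b] st that \<alpha> by auto
      have right: "g u a = g u b" if "\<alpha> < a" "a \<le> n - 1" "\<alpha> < b" "b \<le> n - 1" "1 \<le> a" "1 \<le> b" for a b
        using constant_on_interval[of "max 1 (\<alpha> + 1)" "n - 1" "g u" a b] st that \<alpha> by auto
      \<comment> \<open>If the cut isolates the offset 1 or \<open>n - 1\<close>, no cube contains
        this pair: for both colours the third residue would repeat one of the two. So the pair is
        vacuously good, and \<open>T0\<close> does not contain it.\<close>
      have dead: "g u a \<and> a \<noteq> i0" if a: "a = 1 \<or> a = n - 1" "n dvd (3 * u + (if a = 1 then 1 else - 2))" for a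
      proof -
        have "False" if T: "T \<in> cube_index k" "u \<in> T" "(u + a) mod n \<in> T" for T
        proof -
          have d: "n dvd (u + a) mod n - (u + a)" by (rule mod_sub_dvd)
          have neq: "u \<noteq> (u + a) mod n"
          proof
            assume "u = (u + a) mod n"
            then have "n dvd u - (u + a)" using d by simp
            then show False using not_dvd_small[of "- a"] a(1) n5 by auto
          qed
          obtain z s where z: "z \<in> R" "z \<noteq> u" "z \<noteq> (u + a) mod n" "n dvd (u + (u + a) mod n + z - s)" "0 \<le> s" "s < 2"
            using cube_indexE[OF T neq] k2 by metis
          have e: "n dvd (2 * u + a + z - s)" using dvd_diff[OF z(4) d] by (simp add: algebra_simps)
          have zz: "\<not> n dvd (z - u)" "\<not> n dvd (z - (u + a))"
            using eq_R[OF z(1) u] z(2) eq_R[OF z(1) mod_R] z(3) dvd_diff[OF _ d, of "z - (u + a)"]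
            by (auto simp: algebra_simps)
          have s: "s = 0 \<or> s = 1" using z(5,6) by auto
          have n1: "n dvd n" by simp
          from a(1) s show False
          proof (elim disjE)
            assume "a = 1" "s = 0"
            then show False using zz(1) dvd_diff[OF e a(2)] by (simp add: algebra_simps)
          next
            assume "a = 1" "s = 1"
            then show False using zz(2) dvd_diff[OF e a(2)] by (simp add: algebra_simps)
          next
            assume as: "a = n - 1" "s = 0"
            then have "a \<noteq> 1" using n5 by simp
            then have "n dvd 2 * u + a + z - s - (3 * u - 2) - n - n"
              using dvd_diff[OF dvd_diff[OF dvd_diff[OF e a(2)] n1] n1] by simp
            moreover have "2 * u + a + z - s - (3 * u - 2) - n - n = z - (u + a)" using as by simp
            ultimately show False using zz(2) by metis
          next
            assume as: "a = n - 1" "s = 1"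
            then have "a \<noteq> 1" using n5 by simp
            then have "n dvd 2 * u + a + z - s - (3 * u - 2) - n"
              using dvd_diff[OF dvd_diff[OF e a(2)] n1] by simp
            moreover have "2 * u + a + z - s - (3 * u - 2) - n = z - u" using as by simp
            ultimately show False using zz(1) by metis
          qed
        qed
        then have "g u a" "\<not> (T0 \<in> cube_index k \<and> u \<in> T0 \<and> (u + a) mod n \<in> T0)"
          by (auto simp: g_def good_def)
        moreover have "T0 \<in> cube_index k" by (rule cube_J[OF T0(1)])
        ultimately show ?thesis using T0(2) w0(1) i0(3) by auto
      qed
      consider "\<alpha> = 0" | "\<alpha> = n - 1" | "\<alpha> = n - 2" | "\<alpha> = 1" | "2 \<le> \<alpha>" "\<alpha> \<le> n - 3" using \<alpha> by linarith
      then show ?thesis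
      proof cases
        case 1
        then show ?thesis using right[of i i0] g0 i i0 by auto
      next
        case 2
        then show ?thesis using left[of i i0] g0 i i0 by auto
      next
        case 3
        have "n dvd (\<alpha> + 3 * u) - n" using \<alpha>(3) by (rule dvd_diff) simp
        then have "n dvd (3 * u - 2)" using 3 by (simp add: algebra_simps)
        then have "g u (n - 1)" "i0 \<noteq> n - 1" using dead[of "n - 1"] n5 by auto
        then show ?thesis using left[of i i0] g0 i i0 3 by (cases "i = n - 1") auto
      next
        case 4
        then have "g u 1" "i0 \<noteq> 1" using dead[of 1] \<alpha>(3) by (auto simp: algebra_simps)
        then show ?thesis using right[of i i0] g0 i i0 4 by (cases "i = 1") auto
      next
        case 5
        have nd: "\<not> n dvd (3 * u - t)" if "t \<in> {0, 2, 1, -1}" for t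
        proof
          assume "n dvd (3 * u - t)"
          from dvd_diff[OF \<alpha>(3) this] have "n dvd (\<alpha> + t)" by (simp add: algebra_simps)
          then show False using not_dvd_small[of "\<alpha> + t"] that 5 by auto
        qed
        \<comment> \<open>The pivot trail at \<open>u\<close> meets a cube through \<open>x\<close>
          in colour 0 and a cube through \<open>x'\<close> in colour 1, and so connects the offsets
          \<open>i1\<close> and \<open>i2\<close> of \<open>x\<close> and \<open>x'\<close>. Modulo
          \<open>n\<close> these satisfy \<open>2 * i1 = \<alpha>\<close> and
          \<open>2 * i2 = \<alpha> + 1\<close>.\<close>
        define x x' where "x = half (0 - u)" and "x' = half (1 - u)"
        let ?T = "{x, (x + 1) mod n, u}" and ?T' = "{x', (x' + -1) mod n, u}"
        have uc: "used_colours k u = {0, 1}" using k2 by (auto simp: used_colours_def)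
        have link: "Inl ?T \<in> J \<longleftrightarrow> Inl ?T' \<in> J"
          using attach[OF u, of 0 1 True] attach[OF u, of 1 "-1" True] nd[of 0] nd[of 1] nd[of 2] nd[of "-1"] uc k2
          unfolding x_def x'_def by (simp add: algebra_simps)
        have T: "?T \<in> cube_index k" "?T' \<in> cube_index k"
          using adjacent_cube(1)[OF u, of 0 k 1] adjacent_cube(1)[OF u, of 1 k "-1"] nd[of 0] nd[of 1] nd[of 2] nd[of "-1"] k2 k(2)
          unfolding x_def x'_def by (simp_all add: algebra_simps)
        have xR: "x \<in> R" "x' \<in> R" by (simp_all add: x_def x'_def)
        have xu: "x \<noteq> u" "x' \<noteq> u" using half_eq_iff[OF u, of 0] half_eq_iff[OF u, of 1] nd[of 0] nd[of 1] by (simp_all add: x_def x'_def)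
        obtain i1 where i1: "1 \<le> i1" "i1 \<le> n - 1" "x = (u + i1) mod n" using offset[OF u xR(1)] xu by auto
        obtain i2 where i2: "1 \<le> i2" "i2 \<le> n - 1" "x' = (u + i2) mod n" using offset[OF u xR(2)] xu by auto
        have "g u i1 \<longleftrightarrow> Inl ?T \<in> J" unfolding g_def i1(3)[symmetric]
        proof
          show "Inl ?T \<in> J" if "good u x" using that T(1) unfolding good_def by simp
          show "good u x" if "Inl ?T \<in> J" by (rule goodI[OF that]) (use xu in auto)
        qed
        moreover have "g u i2 \<longleftrightarrow> Inl ?T' \<in> J" unfolding g_def i2(3)[symmetric]
        proof
          show "Inl ?T' \<in> J" if "good u x'" using that T(2) unfolding good_def by simp
          show "good u x'" if "Inl ?T' \<in> J" by (rule goodI[OF that]) (use xu in auto)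
        qed
        ultimately have g12: "g u i1 = g u i2" using link by simp
        have "n dvd 2 * (x - (u + i1))" "n dvd 2 * (x' - (u + i2))"
          unfolding i1(3) i2(3) by (rule dvd_mult[OF mod_sub_dvd])+
        from dvd_diff[OF dvd_diff[OF half_double[of "0 - u"] this(1)[unfolded x_def]] \<alpha>(3)]
          dvd_diff[OF dvd_diff[OF half_double[of "1 - u"] this(2)[unfolded x'_def]] \<alpha>(3)]
        have "n dvd (2 * i1 - \<alpha>)" "n dvd (2 * i2 - \<alpha> - 1)" by (simp_all add: algebra_simps)
        moreover have "n dvd n" by simp
        ultimately have e: "2 * i1 = \<alpha> \<or> 2 * i1 = \<alpha> + n" "2 * i2 = \<alpha> + 1 \<or> 2 * i2 = \<alpha> + 1 + n"
          using i1 i2 5 dvd_small[of "2 * i1 - \<alpha>"] dvd_small[of "2 * i1 - \<alpha> - n"]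
            dvd_small[of "2 * i2 - \<alpha> - 1"] dvd_small[of "2 * i2 - \<alpha> - 1 - n"]
          by (smt (verit) dvd_diff)+
        obtain h where h: "n = 2 * h + 1" using odd by (elim oddE)
        \<comment> \<open>Exactly one of \<open>\<alpha>\<close> and \<open>\<alpha> + 1\<close> is
          even and is halved directly, to the left of the cut; the other one is first increased by
          the odd \<open>n\<close> and ends to the right.\<close>
        have "i1 \<le> \<alpha> \<and> \<alpha> < i2 \<or> i2 \<le> \<alpha> \<and> \<alpha> < i1" using e 5 h by presburger
        then have "g u i1 = g u i" "g u i1 = g u i0 \<or> g u i2 = g u i0"
        proof -
          assume sides: "i1 \<le> \<alpha> \<and> \<alpha> < i2 \<or> i2 \<le> \<alpha> \<and> \<alpha> < i1"
          show "g u i1 = g u i"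
            using sides left[of i1 i] left[of i2 i] right[of i1 i] right[of i2 i] g12 i i1 i2 by (smt (verit))
          show "g u i1 = g u i0 \<or> g u i2 = g u i0"
            using sides left[of i1 i0] left[of i2 i0] right[of i1 i0] right[of i2 i0] g12 i0 i1 i2 by (smt (verit))
        qed
        then show ?thesis using g0 g12 by blast
      qed
    qed
    then show ?thesis by (simp add: g_def i(3))
  qed
  have zero: "0 \<in> R" using n5 by (simp add: R_def)
  have every: "Inl T \<in> J" if T: "T \<in> cube_index k" for T
  proof -
    have "card T = 3" "T \<subseteq> R" using cube_indexD[OF T] by auto
    then obtain u w z where uw: "T = {u, w, z}" "u \<noteq> w" by (auto simp: card_3_iff)
    then have uR: "u \<in> R" "w \<in> R" using \<open>T \<subseteq> R\<close> by auto
    have "\<exists>T0. Inl T0 \<in> J \<and> u \<in> T0"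
    proof (cases "u = 0")
      case True
      then show ?thesis using c0 by blast
    next
      case False
      have "n - u \<in> R" "n - u \<noteq> u" "n - u \<noteq> 0" using False uR odd by (auto simp: R_def)
      \<comment> \<open>These residues have sum 0 modulo \<open>n\<close>, so this cube carries the
        property from the residue 0 of the start cube to \<open>u\<close>.\<close>
      then have "{0, u, n - u} \<in> cube_index k"
        using False uR zero k by (intro cube_indexI[of _ _ _ 0]) auto
      moreover have "good 0 u" by (rule all_good[OF zero c0]) (use uR False in auto)
      ultimately have "Inl {0, u, n - u} \<in> J" by (simp add: good_def)
      then show ?thesis by blast
    qed
    then obtain T0 where "Inl T0 \<in> J" "u \<in> T0" by blast
    then have "good u w" using all_good[OF uR(1) _ _ uR(2) uw(2)] by blast
    then show ?thesis using T uw(1) by (simp add: good_def)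
  qed
  have "Inr (y, b) \<in> J" if y: "y \<in> R" for y b
  proof -
    obtain s e where se: "s \<in> used_colours k y" "e = 1 \<or> e = -1" "0 \<le> s + e" "s + e < k"
      "\<not> n dvd 3 * y - s" "\<not> n dvd 3 * y - s - 2 * e" using pivot_attached[OF y k] by blast
    have s': "0 \<le> s" "s < k" using se(1) used_colours_even(4)[OF k y] by auto
    have "Inl {half (s - y), (half (s - y) + e) mod n, y} \<in> J"
      by (rule every, rule adjacent_cube(1)[OF y s' se(2-4) k(2) se(5,6)])
    then show ?thesis using attach[OF y se] by simp
  qed
  then show ?thesis using J every by (auto simp: trail_index_def)
qed

lemma finite_trail_index: "finite (trail_index k)"
proof -
  have "finite R" by (simp add: R_def)
  moreover have "cube_index k \<subseteq> Pow R" by (auto simp: cube_index_def)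
  moreover have "{p :: int \<times> bool. fst p \<in> R} = R \<times> UNIV" by auto
  ultimately show ?thesis by (simp add: trail_index_def finite_subset)
qed

lemma start_cube: "2 \<le> k \<Longrightarrow> k \<le> n \<Longrightarrow> {0, 1, n - 1} \<in> cube_index k"
  using n5 by (intro cube_indexI[of _ _ _ 0]) (auto simp: R_def)

lemma trail_closed:
  assumes "2 \<le> k" "k \<le> n" "c \<in> trail_index k"
  shows "closed_trail (trail_blocks k c) (trail_labels k c)"
proof (cases c)
  case (Inl T)
  then have "T \<in> cube_index k" using assms by (auto simp: trail_index_def)
  then show ?thesis using Inl cube_trail[OF cube_indexD] by (simp add: trail_blocks_def trail_labels_def)
next
  case (Inr p)
  then have y: "fst p \<in> R" using assms by (auto simp: trail_index_def)
  note u = used_colours_even[OF assms(1,2) y]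
  have "closed_trail (\<Union>s\<in>used_colours k (fst p). set (pivot_path p s)) (pivot_labels p (used_colours k (fst p)))"
    by (rule pivot_trail[of p "fst p" "snd p"]) (use u y assms in auto)
  then show ?thesis using Inr by (simp add: trail_blocks_def trail_labels_def)
qed

section \<open>Disjointness of the trails, and the remaining blocks\<close>

lemma cube_blocks:
  assumes "T \<in> cube_index k" "t \<in> cube T" shows "t \<in> blocks k"
proof -
  have T: "T \<subseteq> R" "card T = 3" "\<Sum>T mod n < k" using assms(1) by (auto simp: cube_index_def)
  obtain x y z where xyz: "T = {x, y, z}" "x \<noteq> y" "x \<noteq> z" "y \<noteq> z" using T(2) by (auto simp: card_3_iff)
  then obtain a b c where t: "t = {(x, a), (y, b), (z, c)}"
    using assms(2) cube_eq[OF xyz(2-4)] by auto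
  have "x \<in> R" "y \<in> R" "z \<in> R" using T(1) xyz(1) by auto
  moreover from this have "(x, a) \<in> V" "(y, b) \<in> V" "(z, c) \<in> V" by (auto simp: V_def R_def)
  moreover have "\<Sum>T = x + y + z" using xyz by simp
  ultimately show ?thesis using T(3) xyz t by (simp add: blocks_iff colour_finite add.assoc)
qed

lemma pivot_index:
  assumes "2 \<le> k" "k \<le> n" "Inr p \<in> trail_index k" "t \<in> trail_blocks k (Inr p)"
  obtains s where "fst p \<in> R" "0 \<le> s" "s < k" "s < n" "s \<in> used_colours k (fst p)" "t \<in> set (pivot_path p s)"
proof -
  have y: "fst p \<in> R" using assms(3) by (auto simp: trail_index_def)
  obtain s where s: "s \<in> used_colours k (fst p)" "t \<in> set (pivot_path p s)"
    using assms(4) by (auto simp: trail_blocks_def)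
  have "s \<in> {0..<k}" using used_colours_even(4)[OF assms(1,2) y] s(1) by blast
  then show thesis using that[OF y _ _ _ s] assms(2) by simp
qed

lemma trail_blocks_subset:
  assumes "2 \<le> k" "k \<le> n" "c \<in> trail_index k"
  shows "trail_blocks k c \<subseteq> blocks k"
proof
  fix t assume t: "t \<in> trail_blocks k c"
  show "t \<in> blocks k"
  proof (cases c)
    case (Inl T)
    then have "T \<in> cube_index k" "t \<in> cube T" using assms t by (auto simp: trail_index_def trail_blocks_def)
    then show ?thesis by (rule cube_blocks)
  next
    case (Inr p)
    obtain s where s: "fst p \<in> R" "0 \<le> s" "s < k" "s < n" "t \<in> set (pivot_path p s)"
      using pivot_index[OF assms(1,2) assms(3)[unfolded Inr] t[unfolded Inr]] by metis
    show ?thesis using pivot_path_block[of p "fst p" "snd p" s t k] s by simp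
  qed
qed

lemma cube_pivot_disjoint:
  assumes "T \<in> cube_index k" "t \<in> cube T" "fst p \<in> R" "t \<in> set (pivot_path p s)"
  shows False
proof -
  have T: "fst ` t = T" "T \<subseteq> R" "card T = 3" using assms(1,2) cube_indexD by (auto simp: cube_def)
  have inf: "-1 \<notin> R" by (simp add: R_def)
  have "p = (fst p, snd p)" by simp
  from pivot_path_shape[OF this assms(3,4)] show False
  proof cases
    case 1
    then have "-1 \<in> fst ` t" by simp
    then show False using T inf by blast
  next
    case (2 x i a)
    then have "-1 \<in> fst ` t" by simp
    then show False using T inf by blast
  next
    case (3 x)
    then have "T = {x, fst p}" using T(1) by auto
    then show False using T(3) by (auto simp: card_insert_if split: if_splits)
  qed
qed

lemma trail_blocks_disjoint:
  assumes k: "2 \<le> k" "k \<le> n" and cd: "c \<in> trail_index k" "d \<in> trail_index k" "c \<noteq> d"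
  shows "trail_blocks k c \<inter> trail_blocks k d = {}"
proof (rule ccontr)
  assume "trail_blocks k c \<inter> trail_blocks k d \<noteq> {}"
  then obtain t where t: "t \<in> trail_blocks k c" "t \<in> trail_blocks k d" by blast
  have mixed: False
    if "Inl T \<in> trail_index k" "Inr p \<in> trail_index k" "t \<in> trail_blocks k (Inl T)" "t \<in> trail_blocks k (Inr p)" for T p
  proof -
    note pivot_index = pivot_index[OF k that(2,4)]
    have "T \<in> cube_index k" "t \<in> cube T" using that by (auto simp: trail_index_def trail_blocks_def)
    moreover obtain s where "fst p \<in> R" "t \<in> set (pivot_path p s)"
      using pivot_index by metis
    ultimately show False by (rule cube_pivot_disjoint)
  qed
  show False
  proof (cases c; cases d)
    fix T T' assume i: "c = Inl T" "d = Inl T'"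
    then have "fst ` t = T" "fst ` t = T'" using t by (simp_all add: trail_blocks_def cube_def)
    then show False using cd(3) i by simp
  next
    fix T p assume "c = Inl T" "d = Inr p"
    then show False using mixed[of T p] t cd by simp
  next
    fix p T assume "c = Inr p" "d = Inl T"
    then show False using mixed[of T p] t cd by simp
  next
    fix p q assume i: "c = Inr p" "d = Inr q"
    obtain s where s: "fst p \<in> R" "0 \<le> s" "s < n" "t \<in> set (pivot_path p s)"
      using pivot_index[OF k cd(1)[unfolded i] t(1)[unfolded i]] by metis
    obtain s' where s': "fst q \<in> R" "0 \<le> s'" "s' < n" "t \<in> set (pivot_path q s')"
      using pivot_index[OF k cd(2)[unfolded i] t(2)[unfolded i]] by metis
    have e: "p = (fst p, snd p)" "q = (fst q, snd q)" by simp_all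
    have "s = s'" by (rule pivot_path_colour[OF e(1) s e(2) s'])
    then have "p = q" using pivot_path_pivot[OF e(1) s(1,4) e(2) s'(1)] s'(4) by simp
    then show False using cd(3) i by simp
  qed
qed

lemma repeated_residue:
  assumes "{p, q, r} \<in> blocks k" "p \<noteq> q" "p \<noteq> r" "q \<noteq> r" "fst p = fst q" "fst p \<in> R" "fst r \<in> R"
  shows "\<exists>x y b. x \<in> R \<and> y \<in> R \<and> x \<noteq> y \<and> {p, q, r} = {(x, False), (x, True), (y, b)} \<and> (2 * x + y) mod n < k"
proof -
  obtain x a a' y b where pqr: "p = (x, a)" "q = (x, a')" "r = (y, b)"
    using assms(5) by (cases p; cases q; cases r) auto
  have a: "a' = (\<not> a)" using assms(2) pqr by auto
  have "x \<noteq> y" using assms(3,4) pqr a by auto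
  moreover have "{p, q, r} = {(x, False), (x, True), (y, b)}" using pqr a by (cases a) auto
  moreover have "colour p q r = (2 * x + y) mod n" using assms(6,7) pqr by (simp add: colour_finite)
  moreover have "colour p q r < k" using assms(1-4) blocks_iff by blast
  ultimately show ?thesis using assms(6,7) pqr by (intro exI[of _ x] exI[of _ y] exI[of _ b]) simp
qed

lemma block_shape:
  assumes "t \<in> blocks k"
  obtains T where "T \<in> cube_index k" "t \<in> cube T"
  | i y b where "y \<in> R" "{(-1, i), (y, b)} \<subseteq> t"
  | x y b where "x \<in> R" "y \<in> R" "x \<noteq> y" "t = {(x, False), (x, True), (y, b)}" "(2 * x + y) mod n < k"
proof -
  obtain p q r where t: "t = {p, q, r}" "p \<noteq> q" "p \<noteq> r" "q \<noteq> r" and V: "p \<in> V" "q \<in> V" "r \<in> V"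
    and col: "colour p q r < k" using assms unfolding blocks_def by blast
  show thesis
  proof (cases "\<exists>i. (-1, i) \<in> t")
    case True
    then obtain i where i: "(-1, i) \<in> t" by blast
    have "\<exists>u\<in>t. fst u \<noteq> -1"
    proof (rule ccontr)
      assume "\<not> (\<exists>u\<in>t. fst u \<noteq> -1)"
      then have "t \<subseteq> {(-1, False), (-1, True)}" by auto
      then have "card t \<le> card {(-1 :: int, False), (-1, True)}" by (rule card_mono[rotated]) simp
      then show False using blocks_card[OF assms] by simp
    qed
    then obtain u where u: "u \<in> t" "fst u \<noteq> -1" by blast
    have "u \<in> V" using u(1) V t(1) by auto
    then have "fst u \<in> R" using u(2) by (rule fin_V)
    then show thesis using that(2)[of "fst u" i "snd u"] i u by simp
  next
    case False
    then have "fst u \<noteq> -1" if "u \<in> t" for u using that by (metis prod.collapse)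
    then have R: "fst p \<in> R" "fst q \<in> R" "fst r \<in> R" using t V fin_V by auto
    consider "fst p = fst q" | "fst p = fst r" | "fst q = fst r"
      | "fst p \<noteq> fst q" "fst p \<noteq> fst r" "fst q \<noteq> fst r" by blast
    then show thesis
    proof cases
      case 1
      then show thesis using repeated_residue[of p q r k] R t assms that(3) by metis
    next
      case 2
      have "t = {p, r, q}" using t(1) by auto
      then show thesis using repeated_residue[of p r q k] 2 R t assms that(3) by metis
    next
      case 3
      have "t = {q, r, p}" using t(1) by auto
      then show thesis using repeated_residue[of q r p k] 3 R t assms that(3) by metis
    next
      case 4
      have "colour p q r = (fst p + fst q + fst r) mod n"
        using colour_finite[OF R, of "snd p" "snd q" "snd r"] by simp
      moreover have "\<Sum>{fst p, fst q, fst r} = fst p + fst q + fst r" using 4 by simp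
      ultimately have "{fst p, fst q, fst r} \<in> cube_index k" using 4 R col by (simp add: cube_index_def add.assoc)
      moreover have "t \<in> cube {fst p, fst q, fst r}"
        using t(1) blocks_card[OF assms] by (simp add: cube_def)
      ultimately show thesis by (rule that(1))
    qed
  qed
qed

text \<open>A block with an infinite and a finite point contains a pair visited by the trail of that
  finite point. Any other leftover block has a dropped colour different from \<open>3 y\<close>, so
  this colour is 1 and \<open>k \<ge> 3\<close>. The colours 0 and 2 are then both present, and an
  adjacent cube of one of them visits a pair of the block.\<close>

lemma trail_absorbs:
  assumes k: "2 \<le> k" "k \<le> n" and t: "t \<in> blocks k" "t \<notin> (\<Union>c\<in>trail_index k. trail_blocks k c)"
  shows "\<exists>q\<in>(\<Union>c\<in>trail_index k. trail_labels k c). q \<subseteq> t"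
  using t(1)
proof (cases rule: block_shape)
  case (1 T)
  then have "Inl T \<in> trail_index k" "t \<in> trail_blocks k (Inl T)"
    by (simp_all add: trail_index_def trail_blocks_def)
  then show ?thesis using t(2) by blast
next
  case (2 i y b)
  then have "Inr (y, b) \<in> trail_index k" "{(-1, i), (y, b)} \<in> trail_labels k (Inr (y, b))"
    by (auto simp: trail_index_def trail_labels_def pivot_labels_def)
  then show ?thesis using 2(2) by blast
next
  case (3 x y b)
  define s where "s = (2 * x + y) mod n"
  have s: "0 \<le> s" "s < k" "n dvd (2 * x + y - s)"
    using 3(5) n5 mod_sub_dvd[of "2 * x + y"] by (simp_all add: s_def dvd_diff_commute)
  have "n dvd (2 * half (s - y) - (s - y)) - (2 * x + y - s)" by (rule dvd_diff[OF half_double s(3)])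
  then have "n dvd 2 * (half (s - y) - x)" by (simp add: algebra_simps)
  then have x: "half (s - y) = x" using coprime2 eq_R[OF half_R 3(1)] by blast
  have nc: "\<not> n dvd 3 * y - s" using half_eq_iff[OF 3(2), of s] x 3(3) by simp
  have "Inr (y, b) \<in> trail_index k" "t \<in> set (pivot_path (y, b) s)"
    using 3 x nc by (simp_all add: trail_index_def pivot_path_def Let_def)
  then have "s \<notin> used_colours k y" using t(2) by (force simp: trail_blocks_def)
  then have odd: "odd k" and sc: "s = (if (3 * y) mod n < k then (3 * y) mod n else 1)"
    using s by (auto simp: used_colours_def split: if_splits)
  have "s \<noteq> (3 * y) mod n" using nc mod_sub_dvd[of "3 * y"] by (auto simp: dvd_diff_commute)
  then have s1: "s = 1" using sc by (auto split: if_splits)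
  have k3: "3 \<le> k" using odd k(1) by (cases "k = 2") auto
  \<comment> \<open>The two divisibilities to be avoided differ by 4, which is less than
    \<open>n\<close>, so they cannot both hold.\<close>
  have "\<exists>e. (e = 1 \<or> e = -1) \<and> \<not> n dvd 3 * y - s - 2 * e"
  proof (cases "n dvd 3 * y - s - 2 * 1")
    case True
    then have "\<not> n dvd 3 * y - s - 2 * -1" by (rule dvd_diff_small) (use n5 in auto)
    then show ?thesis by blast
  qed blast
  then obtain e where e: "e = 1 \<or> e = -1" "\<not> n dvd 3 * y - s - 2 * e" by blast
  have e': "0 \<le> s + e" "s + e < k" using e(1) s1 k3 by auto
  let ?T = "{x, (x + e) mod n, y}"
  have "?T \<in> cube_index k" using adjacent_cube(1)[OF 3(2) s(1,2) e(1) e' k(2) nc e(2)] x by simp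
  moreover obtain a where "{(x, a), (y, b)} \<in> cube_labels ?T"
    using adjacent_cube(2)[OF 3(2) s(1,2) e(1) e' k(2) nc e(2), of b] x by auto
  moreover have "{(x, a), (y, b)} \<subseteq> t" unfolding 3(4) by (cases a) auto
  moreover have "Inl ?T \<in> trail_index k \<longleftrightarrow> ?T \<in> cube_index k" "trail_labels k (Inl ?T) = cube_labels ?T"
    by (auto simp: trail_index_def trail_labels_def)
  ultimately show ?thesis by blast
qed

section \<open>Assembly of all cases\<close>

lemma gray_system_coloured:
  assumes k: "2 \<le> k" "k \<le> n"
  shows "gray_system (nat (2 * n + 2)) (nat (2 * k))"
proof -
  let ?X = "\<Union>c\<in>trail_index k. trail_blocks k c" and ?L = "\<Union>c\<in>trail_index k. trail_labels k c"
  have c0: "Inl {0, 1, n - 1} \<in> trail_index k" using start_cube[OF k] by (simp add: trail_index_def)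
  have core: "closed_trail ?X ?L"
    by (rule closed_trail_connected[OF finite_trail_index trail_closed[OF k] trail_blocks_disjoint[OF k] c0
          trails_connected[OF k]])
  have X: "?X \<subseteq> blocks k" using trail_blocks_subset[OF k] by blast
  have "closed_trail (?X \<union> (blocks k - ?X)) ?L"
    by (rule closed_trail_absorb[OF core]) (use trail_absorbs[OF k] in auto)
  moreover have "?X \<union> (blocks k - ?X) = blocks k" using X by blast
  ultimately have tr: "closed_trail (blocks k) ?L" by simp
  have pair: "card {b \<in> blocks k. p \<in> b \<and> q \<in> b} = nat (2 * k)" if "p \<in> V" "q \<in> V" "p \<noteq> q" for p q
    using blocks_pair[OF that] k by simp
  have "card {b \<in> blocks k. (0, False) \<in> b \<and> (0, True) \<in> b} = nat (2 * k)"
    by (rule pair) (use n5 in \<open>auto simp: V_def\<close>)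
  moreover have "card {b \<in> blocks k. (0, False) \<in> b \<and> (0, True) \<in> b} \<le> card (blocks k)"
    by (rule card_mono) auto
  ultimately have "3 \<le> card (blocks k)" using k by linarith
  then show ?thesis by (rule closed_trail_gray_system[OF finite_V card_V tr _ blocks_card pair])
qed

end

theorem theorem1:
  fixes v l :: nat
  assumes "v mod 12 = 0 \<or> v mod 12 = 4"
    and "even l" and "2 \<le> l" and "l \<le> v - 2"
  shows "\<exists>(V :: nat set) B. simple_triple_system V B v l \<and>
           (\<exists>bs. cyclic_two_gray_code B bs) \<and> hamiltonian (with_proj (two_big B))"
proof -
  define j where "j = v div 12"
  have v: "v = 12 * j \<or> v = 12 * j + 4"
    using assms(1) unfolding j_def by presburger
  have "gray_system v l"
  proof (cases "l = 2")
    case True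
    from v show ?thesis
    proof
      assume v: "v = 12 * j"
      show ?thesis
      proof (cases "2 \<le> j")
        case j: True
        then show ?thesis using gray_system_A v True by simp
      next
        case False
        then have "j = 1" using v assms(3,4) by (cases j) auto
        then show ?thesis using gray_system_12 v True by simp
      qed
    next
      assume "v = 12 * j + 4"
      then show ?thesis using gray_system_4 gray_system_B[of j] True by (cases "j = 0") simp_all
    qed
  next
    case False
    obtain k where k: "l = 2 * k" using assms(2) by (elim evenE)
    have "2 \<le> k" using False assms(3) k by linarith
    then have j: "1 \<le> j" using v k assms(4) by (cases j) auto
    define n where "n = int (v div 2) - 1"
    \<comment> \<open>From \<open>v = 2 n + 2\<close> and the residue of \<open>v\<close> modulo 12
      it follows that \<open>n\<close> is 1 or -1 modulo 6.\<close>
    have n: "n = 6 * int j - 1 \<or> n = 6 * int j + 1" using v by (auto simp: n_def)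
    interpret coloured_triples n
    proof
      show "5 \<le> n" "odd n" using n j by auto
      show "\<not> 3 dvd n" using n by presburger
    qed
    have "even v" using v by auto
    then have "2 * n + 2 = int v" by (auto simp: n_def)
    then have "nat (2 * n + 2) = v" "int k \<le> n" using k assms(3,4) by linarith+
    moreover have "nat (2 * int k) = l" using k by simp
    ultimately show ?thesis using gray_system_coloured[of "int k"] \<open>2 \<le> k\<close> by simp
  qed
  then show ?thesis by (simp add: gray_system_def)
qed

end
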